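(* Suppose $\Lambda$ is a finitely aligned $k$-graph. Then the following are equivalent: (1) $\Lambda$ is cofinal; (2) for each $v\in\Lambda^0$ and each $x\in\partial\Lambda$ there exists $n\in\mathbb{N}^k$ with $n\le d(x)$ such that $v\Lambda x(n)\neq\emptyset$; (3) the only ideal of $C^*(\Lambda)$ which contains $s_v$ for some $v\in\Lambda^0$ is $C^*(\Lambda)$; and (4) the only ideal of $C^*(\Lambda)$ which nontrivially intersects $C^*(\Lambda)^\gamma$ (that is, whose intersection with $C^*(\Lambda)^\gamma$ is not $\{0\}$) is $C^*(\Lambda)$.
   Context: Conventions. $\mathbb{N}$ contains $0$, $k\ge 1$ is an integer, $\mathbb{N}^k$ and $(\mathbb{N}\cup\{\infty\})^k$ are ordered coordinatewise, and $m\vee n$, $m\wedge n$ denote the coordinatewise maximum and minimum. A $k$-graph $(\Lambda,d)$ is a countable small category $\Lambda$ (identified with its set of morphisms, called paths) with a functor $d:\Lambda\to\mathbb{N}^k$ satisfying the factorisation property: whenever $d(\lambda)=m+n$ there exist unique $\mu,\nu\in\Lambda$ with $d(\mu)=m$, $d(\nu)=n$ and $\lambda=\mu\nu$. Write $\Lambda^n=\{\lambda\in\Lambda: d(\lambda)=n\}$. Objects are identified with their identity morphisms, which form $\Lambda^0$ (the vertices). $r(\lambda),s(\lambda)\in\Lambda^0$ are the unique vertices with $\lambda=r(\lambda)\lambda=\lambda s(\lambda)$; the product $\mu\nu$ is defined exactly when $s(\mu)=r(\nu)$. For $m\le n\le d(\lambda)$, $\lambda(m,n)$ is the unique path in $\Lambda^{n-m}$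 with $\lambda=\lambda'\lambda(m,n)\lambda''$, $d(\lambda')=m$, $d(\lambda'')=d(\lambda)-n$. For $v,w\in\Lambda^0$: $v\Lambda=\{\lambda:r(\lambda)=v\}$ and $v\Lambda w=\{\lambda:r(\lambda)=v,\ s(\lambda)=w\}$. A $k$-graph morphism is a degree-preserving functor. For $\mu,\nu\in\Lambda$, $\operatorname{MCE}(\mu,\nu)=\{\lambda\in\Lambda: d(\lambda)=d(\mu)\vee d(\nu),\ \lambda(0,d(\mu))=\mu,\ \lambda(0,d(\nu))=\nu\}$. $\Lambda$ is finitely aligned if $\operatorname{MCE}(\mu,\nu)$ is finite for all $\mu,\nu\in\Lambda$. A set $E\subseteq v\Lambda$ is exhaustive if for every $\mu\in v\Lambda$ there is $\lambda\in E$ with $\operatorname{MCE}(\mu,\lambda)\neq\emptyset$; $v\operatorname{FE}(\Lambda)$ is the set of finite exhaustive subsets of $v\Lambda$. A Cuntz-Krieger $\Lambda$-family is a set $\{t_\lambda:\lambda\in\Lambda\}$ of partial isometries in a $C^*$-algebra such that: (CK1) $\{t_v:v\in\Lambda^0\}$ are mutually orthogonal projections; (CK2) $t_\mu t_\nu=t_{\mu\nu}$ whenever $s(\mu)=r(\nu)$; (CK3) $t_\mu^*t_\nu=\sum_{\mu\alpha=\nu\beta\in\operatorname{MCE}(\mu,\nu)}t_\alpha t_\beta^*$ for all $\mu,\nu\in\Lambda$; (CK4) $\prod_{\lambda\in E}(t_v-t_\lambda t_\lambda^* )=0$ for all $v\in\Lambda^0$ and $E\in v\operatorname{FE}(\Lambda)$.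 $C^*(\Lambda)$ is the universal $C^*$-algebra generated by a Cuntz-Krieger $\Lambda$-family $\{s_\lambda:\lambda\in\Lambda\}$. The gauge action is the strongly continuous action $\gamma:\mathbb{T}^k\to\operatorname{Aut}(C^*(\Lambda))$ with $\gamma_z(s_\lambda)=z^{d(\lambda)}s_\lambda$ (multi-index notation), and $C^*(\Lambda)^\gamma=\{a:\gamma_z(a)=a\text{ for all }z\in\mathbb{T}^k\}$. Ideals are closed and two-sided. For $m\in(\mathbb{N}\cup\{\infty\})^k$, $\Omega_{k,m}$ is the $k$-graph with morphisms $(p,q)$, $p\le q\le m$, $p,q\in\mathbb{N}^k$, $r(p,q)=(p,p)$, $s(p,q)=(q,q)$, $d(p,q)=q-p$, $(p,q)(q,l)=(p,l)$; the vertex $(q,q)$ is written $q$. For a $k$-graph morphism $x:\Omega_{k,m}\to\Lambda$ put $r(x)=x(0)$, $d(x)=m$. $\partial\Lambda$ is the set of all $k$-graph morphisms $x:\Omega_{k,m}\to\Lambda$ ($m\in(\mathbb{N}\cup\{\infty\})^k$) such that for all $n\in\mathbb{N}^k$ with $n\le d(x)$ and all $E\in x(n)\operatorname{FE}(\Lambda)$ there exists $p\in\mathbb{N}^k$ with $p\le d(x)-n$ and $x(n,n+p)\in E$. $\Lambda$ is cofinal if for all $v,w\in\Lambda^0$ there exists $E\in w\operatorname{FE}(\Lambda)$ such that $v\Lambda s(\alpha)\neq\emptyset$ for every $\alpha\in E$. *)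

theory Defs
  imports
    "HOL-Analysis.Analysis"
    "HOL-Algebra.Module"
    "HOL-Algebra.AbelCoset"
    "HOL-Library.Extended_Nat"
begin

section \<open>Higher-rank graphs\<close>

text \<open>
  The rank \<open>k\<close> is the cardinality of a finite type \<open>'k\<close> (so \<open>k \<ge> 1\<close>), and \<open>\<nat>\<^sup>k\<close> is the type
  \<open>nat ^ 'k\<close> with its coordinatewise order from the library. Categories are one-sorted: objects
  are identified with their identity morphisms, so range and source are morphisms. The
  composition \<open>cmp \<Lambda> \<mu> \<nu>\<close> is meaningful only for \<open>src \<Lambda> \<mu> = rng \<Lambda> \<nu>\<close>.
\<close>

record ('l, 'k::finite) kgraph =
  paths :: "'l set"
  rng :: "'l \<Rightarrow> 'l"
  src :: "'l \<Rightarrow> 'l"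
  cmp :: "'l \<Rightarrow> 'l \<Rightarrow> 'l"
  deg :: "'l \<Rightarrow> nat ^ 'k"

locale small_category =
  fixes \<Lambda> :: "('l, 'k::finite) kgraph"
  assumes rng_closed: "\<rho> \<in> paths \<Lambda> \<Longrightarrow> rng \<Lambda> \<rho> \<in> paths \<Lambda>"
    and src_closed: "\<rho> \<in> paths \<Lambda> \<Longrightarrow> src \<Lambda> \<rho> \<in> paths \<Lambda>"
    and rng_rng: "\<rho> \<in> paths \<Lambda> \<Longrightarrow> rng \<Lambda> (rng \<Lambda> \<rho>) = rng \<Lambda> \<rho>"
    and src_rng: "\<rho> \<in> paths \<Lambda> \<Longrightarrow> src \<Lambda> (rng \<Lambda> \<rho>) = rng \<Lambda> \<rho>"
    and rng_src: "\<rho> \<in> paths \<Lambda> \<Longrightarrow> rng \<Lambda> (src \<Lambda> \<rho>) = src \<Lambda> \<rho>"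
    and src_src: "\<rho> \<in> paths \<Lambda> \<Longrightarrow> src \<Lambda> (src \<Lambda> \<rho>) = src \<Lambda> \<rho>"
    and cmp_closed: "\<mu> \<in> paths \<Lambda> \<Longrightarrow> \<nu> \<in> paths \<Lambda> \<Longrightarrow> src \<Lambda> \<mu> = rng \<Lambda> \<nu> \<Longrightarrow> cmp \<Lambda> \<mu> \<nu> \<in> paths \<Lambda>"
    and rng_cmp: "\<mu> \<in> paths \<Lambda> \<Longrightarrow> \<nu> \<in> paths \<Lambda> \<Longrightarrow> src \<Lambda> \<mu> = rng \<Lambda> \<nu> \<Longrightarrow> rng \<Lambda> (cmp \<Lambda> \<mu> \<nu>) = rng \<Lambda> \<mu>"
    and src_cmp: "\<mu> \<in> paths \<Lambda> \<Longrightarrow> \<nu> \<in> paths \<Lambda> \<Longrightarrow> src \<Lambda> \<mu> = rng \<Lambda> \<nu> \<Longrightarrow> src \<Lambda> (cmp \<Lambda> \<mu> \<nu>) = src \<Lambda> \<nu>"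
    and cmp_rng: "\<rho> \<in> paths \<Lambda> \<Longrightarrow> cmp \<Lambda> (rng \<Lambda> \<rho>) \<rho> = \<rho>"
    and cmp_src: "\<rho> \<in> paths \<Lambda> \<Longrightarrow> cmp \<Lambda> \<rho> (src \<Lambda> \<rho>) = \<rho>"
    and cmp_assoc: "\<rho> \<in> paths \<Lambda> \<Longrightarrow> \<mu> \<in> paths \<Lambda> \<Longrightarrow> \<nu> \<in> paths \<Lambda> \<Longrightarrow>
      src \<Lambda> \<rho> = rng \<Lambda> \<mu> \<Longrightarrow> src \<Lambda> \<mu> = rng \<Lambda> \<nu> \<Longrightarrow>
      cmp \<Lambda> (cmp \<Lambda> \<rho> \<mu>) \<nu> = cmp \<Lambda> \<rho> (cmp \<Lambda> \<mu> \<nu>)"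

locale kgraph = small_category \<Lambda> for \<Lambda> :: "('l, 'k::finite) kgraph" +
  assumes countable_paths: "countable (paths \<Lambda>)"
    and deg_rng: "\<rho> \<in> paths \<Lambda> \<Longrightarrow> deg \<Lambda> (rng \<Lambda> \<rho>) = 0"
    and deg_src: "\<rho> \<in> paths \<Lambda> \<Longrightarrow> deg \<Lambda> (src \<Lambda> \<rho>) = 0"
    and deg_cmp: "\<mu> \<in> paths \<Lambda> \<Longrightarrow> \<nu> \<in> paths \<Lambda> \<Longrightarrow> src \<Lambda> \<mu> = rng \<Lambda> \<nu> \<Longrightarrow>
      deg \<Lambda> (cmp \<Lambda> \<mu> \<nu>) = deg \<Lambda> \<mu> + deg \<Lambda> \<nu>"
    and factorisation: "\<rho> \<in> paths \<Lambda> \<Longrightarrow> deg \<Lambda> \<rho> = m + n \<Longrightarrow>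
      \<exists>!p. p \<in> paths \<Lambda> \<times> paths \<Lambda> \<and> deg \<Lambda> (fst p) = m \<and> deg \<Lambda> (snd p) = n \<and>
        src \<Lambda> (fst p) = rng \<Lambda> (snd p) \<and> \<rho> = cmp \<Lambda> (fst p) (snd p)"

definition vertices :: "('l, 'k::finite) kgraph \<Rightarrow> 'l set" where
  "vertices \<Lambda> = {\<rho> \<in> paths \<Lambda>. deg \<Lambda> \<rho> = 0}"

definition paths_to :: "('l, 'k::finite) kgraph \<Rightarrow> 'l \<Rightarrow> 'l set"  \<comment> \<open>\<open>v\<Lambda>\<close>\<close> where
  "paths_to \<Lambda> v = {\<rho> \<in> paths \<Lambda>. rng \<Lambda> \<rho> = v}"

definition paths_between :: "('l, 'k::finite) kgraph \<Rightarrow> 'l \<Rightarrow> 'l \<Rightarrow> 'l set"  \<comment> \<open>\<open>v\<Lambda>w\<close>\<close> where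
  "paths_between \<Lambda> v w = {\<rho> \<in> paths \<Lambda>. rng \<Lambda> \<rho> = v \<and> src \<Lambda> \<rho> = w}"

text \<open>\<open>segment \<Lambda> \<rho> m n\<close> is \<open>\<rho>(m, n)\<close>; it is meaningful for \<open>m \<le> n \<le> deg \<Lambda> \<rho>\<close>.\<close>

definition segment :: "('l, 'k::finite) kgraph \<Rightarrow> 'l \<Rightarrow> nat ^ 'k \<Rightarrow> nat ^ 'k \<Rightarrow> 'l" where
  "segment \<Lambda> \<rho> m n = (THE \<mu>. \<mu> \<in> paths \<Lambda> \<and> deg \<Lambda> \<mu> = n - m \<and>
     (\<exists>\<rho>'\<in>paths \<Lambda>. \<exists>\<rho>''\<in>paths \<Lambda>. deg \<Lambda> \<rho>' = m \<and> deg \<Lambda> \<rho>'' = deg \<Lambda> \<rho> - n \<and>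
        src \<Lambda> \<rho>' = rng \<Lambda> \<mu> \<and> src \<Lambda> \<mu> = rng \<Lambda> \<rho>'' \<and>
        \<rho> = cmp \<Lambda> \<rho>' (cmp \<Lambda> \<mu> \<rho>'')))"

definition vjoin :: "nat ^ 'k \<Rightarrow> nat ^ 'k \<Rightarrow> nat ^ 'k" where
  "vjoin m n = (\<chi> i. max (m $ i) (n $ i))"

definition MCE :: "('l, 'k::finite) kgraph \<Rightarrow> 'l \<Rightarrow> 'l \<Rightarrow> 'l set" where
  "MCE \<Lambda> \<mu> \<nu> = {\<rho> \<in> paths \<Lambda>. deg \<Lambda> \<rho> = vjoin (deg \<Lambda> \<mu>) (deg \<Lambda> \<nu>) \<and>
     segment \<Lambda> \<rho> 0 (deg \<Lambda> \<mu>) = \<mu> \<and> segment \<Lambda> \<rho> 0 (deg \<Lambda> \<nu>) = \<nu>}"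

definition finitely_aligned :: "('l, 'k::finite) kgraph \<Rightarrow> bool" where
  "finitely_aligned \<Lambda> \<longleftrightarrow> (\<forall>\<mu>\<in>paths \<Lambda>. \<forall>\<nu>\<in>paths \<Lambda>. finite (MCE \<Lambda> \<mu> \<nu>))"

definition exhaustive :: "('l, 'k::finite) kgraph \<Rightarrow> 'l \<Rightarrow> 'l set \<Rightarrow> bool" where
  "exhaustive \<Lambda> v E \<longleftrightarrow>
     E \<subseteq> paths_to \<Lambda> v \<and> (\<forall>\<mu>\<in>paths_to \<Lambda> v. \<exists>\<rho>\<in>E. MCE \<Lambda> \<mu> \<rho> \<noteq> {})"

definition FE :: "('l, 'k::finite) kgraph \<Rightarrow> 'l \<Rightarrow> 'l set set" where
  "FE \<Lambda> v = {E. finite E \<and> exhaustive \<Lambda> v E}"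

definition cofinal_kgraph :: "('l, 'k::finite) kgraph \<Rightarrow> bool" where
  "cofinal_kgraph \<Lambda> \<longleftrightarrow> (\<forall>v\<in>vertices \<Lambda>. \<forall>w\<in>vertices \<Lambda>.
     \<exists>E\<in>FE \<Lambda> w. \<forall>\<alpha>\<in>E. paths_between \<Lambda> v (src \<Lambda> \<alpha>) \<noteq> {})"

subsection \<open>Boundary paths\<close>

definition emb :: "nat ^ 'k \<Rightarrow> enat ^ 'k" where
  "emb n = (\<chi> i. enat (n $ i))"

definition Omega :: "enat ^ 'k \<Rightarrow> ((nat ^ 'k) \<times> (nat ^ 'k), 'k::finite) kgraph" where
  "Omega m = \<lparr>paths = {(p, q). p \<le> q \<and> emb q \<le> m},
     rng = (\<lambda>(p, q). (p, p)), src = (\<lambda>(p, q). (q, q)),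
     cmp = (\<lambda>(p, q) (q', l). (p, l)), deg = (\<lambda>(p, q). q - p)\<rparr>"

definition kgraph_morphism ::
  "('a, 'k::finite) kgraph \<Rightarrow> ('l, 'k) kgraph \<Rightarrow> ('a \<Rightarrow> 'l) \<Rightarrow> bool" where
  "kgraph_morphism \<Gamma> \<Lambda> x \<longleftrightarrow>
     (\<forall>\<rho>\<in>paths \<Gamma>. x \<rho> \<in> paths \<Lambda> \<and> deg \<Lambda> (x \<rho>) = deg \<Gamma> \<rho> \<and>
        rng \<Lambda> (x \<rho>) = x (rng \<Gamma> \<rho>) \<and> src \<Lambda> (x \<rho>) = x (src \<Gamma> \<rho>)) \<and>
     (\<forall>\<mu>\<in>paths \<Gamma>. \<forall>\<nu>\<in>paths \<Gamma>. src \<Gamma> \<mu> = rng \<Gamma> \<nu> \<longrightarrow>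
        x (cmp \<Gamma> \<mu> \<nu>) = cmp \<Lambda> (x \<mu>) (x \<nu>))"

text \<open>
  A boundary path is a pair \<open>(m, x)\<close> with \<open>x\<close> a morphism from \<open>Omega m\<close>, so its degree is \<open>m\<close>;
  the vertex \<open>x(n)\<close> is \<open>x (n, n)\<close>. In \<open>enat\<close>, \<open>\<infinity> - n = \<infinity>\<close> for finite \<open>n\<close>.
\<close>

definition boundary_paths ::
  "('l, 'k::finite) kgraph \<Rightarrow> ((enat ^ 'k) \<times> ((nat ^ 'k) \<times> (nat ^ 'k) \<Rightarrow> 'l)) set" where
  "boundary_paths \<Lambda> = {(m, x). kgraph_morphism (Omega m) \<Lambda> x \<and>
     (\<forall>n. emb n \<le> m \<longrightarrow> (\<forall>E\<in>FE \<Lambda> (x (n, n)). \<exists>p. emb p \<le> m - emb n \<and> x (n, n + p) \<in> E))}"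

section \<open>C*-algebras\<close>

text \<open>
  C*-algebras need not be unital: the field \<open>one\<close> inherited from the record of modules is
  left unconstrained and never used.
\<close>

record 'a cstar_struct = "(complex, 'a) module" +
  star :: "'a \<Rightarrow> 'a"
  cnorm :: "'a \<Rightarrow> real"

definition complex_field :: "complex ring" where
  "complex_field = \<lparr>carrier = UNIV, mult = (*), one = 1, zero = 0, add = (+)\<rparr>"

text \<open>The value off the carrier only serves to make this a metric in the sense of the library.\<close>

definition cdist :: "'a cstar_struct \<Rightarrow> 'a \<Rightarrow> 'a \<Rightarrow> real" where
  "cdist A a b = (if a \<in> carrier A \<and> b \<in> carrier A then cnorm A (a \<ominus>\<^bsub>A\<^esub> b) else 0)"

definition norm_topology :: "'a cstar_struct \<Rightarrow> 'a topology" where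
  "norm_topology A = Metric_space.mtopology (carrier A) (cdist A)"

locale cstar_algebra = Module.module complex_field A for A :: "'a cstar_struct" (structure) +
  assumes mult_closed: "a \<in> carrier A \<Longrightarrow> b \<in> carrier A \<Longrightarrow> a \<otimes> b \<in> carrier A"
    and mult_assoc: "a \<in> carrier A \<Longrightarrow> b \<in> carrier A \<Longrightarrow> c \<in> carrier A \<Longrightarrow>
      (a \<otimes> b) \<otimes> c = a \<otimes> (b \<otimes> c)"
    and distrib_right: "a \<in> carrier A \<Longrightarrow> b \<in> carrier A \<Longrightarrow> c \<in> carrier A \<Longrightarrow>
      (a \<oplus> b) \<otimes> c = a \<otimes> c \<oplus> b \<otimes> c"
    and distrib_left: "a \<in> carrier A \<Longrightarrow> b \<in> carrier A \<Longrightarrow> c \<in> carrier A \<Longrightarrow>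
      c \<otimes> (a \<oplus> b) = c \<otimes> a \<oplus> c \<otimes> b"
    and smult_mult_left: "a \<in> carrier A \<Longrightarrow> b \<in> carrier A \<Longrightarrow> (z \<odot> a) \<otimes> b = z \<odot> (a \<otimes> b)"
    and smult_mult_right: "a \<in> carrier A \<Longrightarrow> b \<in> carrier A \<Longrightarrow> a \<otimes> (z \<odot> b) = z \<odot> (a \<otimes> b)"
    and star_closed: "a \<in> carrier A \<Longrightarrow> star A a \<in> carrier A"
    and star_star: "a \<in> carrier A \<Longrightarrow> star A (star A a) = a"
    and star_add: "a \<in> carrier A \<Longrightarrow> b \<in> carrier A \<Longrightarrow> star A (a \<oplus> b) = star A a \<oplus> star A b"
    and star_smult: "a \<in> carrier A \<Longrightarrow> star A (z \<odot> a) = cnj z \<odot> star A a"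
    and star_mult: "a \<in> carrier A \<Longrightarrow> b \<in> carrier A \<Longrightarrow> star A (a \<otimes> b) = star A b \<otimes> star A a"
    and cnorm_nonneg: "a \<in> carrier A \<Longrightarrow> 0 \<le> cnorm A a"
    and cnorm_eq_zero: "a \<in> carrier A \<Longrightarrow> cnorm A a = 0 \<longleftrightarrow> a = \<zero>"
    and cnorm_triangle: "a \<in> carrier A \<Longrightarrow> b \<in> carrier A \<Longrightarrow> cnorm A (a \<oplus> b) \<le> cnorm A a + cnorm A b"
    and cnorm_smult: "a \<in> carrier A \<Longrightarrow> cnorm A (z \<odot> a) = cmod z * cnorm A a"
    and cnorm_mult: "a \<in> carrier A \<Longrightarrow> b \<in> carrier A \<Longrightarrow> cnorm A (a \<otimes> b) \<le> cnorm A a * cnorm A b"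
    and cstar_identity: "a \<in> carrier A \<Longrightarrow> cnorm A (star A a \<otimes> a) = (cnorm A a)\<^sup>2"
    and complete: "Metric_space.mcomplete (carrier A) (cdist A)"

lemma (in cstar_algebra) Metric_space_cdist: "Metric_space (carrier A) (cdist A)"
proof -
  have neg: "\<ominus> a = (-1) \<odot> a" if "a \<in> carrier A" for a
  proof -
    have 1: "(1::complex) \<odot> a = a"
      using smult_one[OF that] by (simp add: complex_field_def)
    have cl: "z \<odot> a \<in> carrier A" for z
      using that smult_closed by (simp add: complex_field_def)
    have dist: "(z + w) \<odot> a = z \<odot> a \<oplus> w \<odot> a" for z w
      using that smult_l_distr[of z w a] by (simp add: complex_field_def)
    have "0 \<odot> a = 0 \<odot> a \<oplus> 0 \<odot> a"
      using dist[of 0 0] by simp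
    then have 0: "0 \<odot> a = \<zero>"
      using cl by (metis M.add.l_cancel_one')
    have "a \<oplus> (-1) \<odot> a = \<zero>"
      using dist[of 1 "-1"] 0 1 by simp
    then show ?thesis
      using that cl M.minus_equality M.a_comm by metis
  qed
  have sym: "cnorm A (a \<ominus> b) = cnorm A (b \<ominus> a)" if ab: "a \<in> carrier A" "b \<in> carrier A" for a b
  proof -
    have "a \<ominus> b = \<ominus> (b \<ominus> a)"
      using ab by (simp add: a_minus_def M.minus_add M.a_comm)
    also have "\<dots> = (-1) \<odot> (b \<ominus> a)"
      using ab by (intro neg) simp
    finally show ?thesis
      using ab by (simp add: cnorm_smult)
  qed
  show ?thesis
  proof
    fix x y show "0 \<le> cdist A x y"
      by (simp add: cdist_def cnorm_nonneg)
  next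
    fix x y show "cdist A x y = cdist A y x"
      by (auto simp: cdist_def sym)
  next
    fix x y assume "x \<in> carrier A" "y \<in> carrier A"
    then show "cdist A x y = 0 \<longleftrightarrow> x = y"
      using M.minus_equality[of x "\<ominus> y"]
      by (auto simp: cdist_def cnorm_eq_zero a_minus_def M.r_neg)
  next
    fix x y z assume xyz: "x \<in> carrier A" "y \<in> carrier A" "z \<in> carrier A"
    have "x \<ominus> z = (x \<ominus> y) \<oplus> (y \<ominus> z)"
      using xyz by (simp add: a_minus_def M.a_assoc M.r_neg1)
    then show "cdist A x z \<le> cdist A x y + cdist A y z"
      using xyz by (simp add: cdist_def cnorm_triangle)
  qed
qed

definition cstar_hom :: "'a cstar_struct \<Rightarrow> 'b cstar_struct \<Rightarrow> ('a \<Rightarrow> 'b) set" where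
  "cstar_hom A B = {\<pi>. \<pi> \<in> carrier A \<rightarrow> carrier B \<and>
     (\<forall>a\<in>carrier A. \<forall>b\<in>carrier A. \<pi> (a \<oplus>\<^bsub>A\<^esub> b) = \<pi> a \<oplus>\<^bsub>B\<^esub> \<pi> b \<and>
        \<pi> (a \<otimes>\<^bsub>A\<^esub> b) = \<pi> a \<otimes>\<^bsub>B\<^esub> \<pi> b) \<and>
     (\<forall>a\<in>carrier A. \<pi> (star A a) = star B (\<pi> a) \<and>
        (\<forall>z. \<pi> (z \<odot>\<^bsub>A\<^esub> a) = z \<odot>\<^bsub>B\<^esub> \<pi> a))}"

definition cstar_auto :: "'a cstar_struct \<Rightarrow> ('a \<Rightarrow> 'a) set" where
  "cstar_auto A = {\<pi> \<in> cstar_hom A A. bij_betw \<pi> (carrier A) (carrier A)}"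

definition cstar_subalgebra :: "'a set \<Rightarrow> 'a cstar_struct \<Rightarrow> bool" where
  "cstar_subalgebra S A \<longleftrightarrow> additive_subgroup S A \<and>
     (\<forall>a\<in>S. star A a \<in> S \<and> (\<forall>z. z \<odot>\<^bsub>A\<^esub> a \<in> S) \<and> (\<forall>b\<in>S. a \<otimes>\<^bsub>A\<^esub> b \<in> S)) \<and>
     closedin (norm_topology A) S"

definition generates :: "'a set \<Rightarrow> 'a cstar_struct \<Rightarrow> bool" where
  "generates X A \<longleftrightarrow> X \<subseteq> carrier A \<and> (\<forall>S. cstar_subalgebra S A \<and> X \<subseteq> S \<longrightarrow> S = carrier A)"

definition cstar_ideal :: "'a set \<Rightarrow> 'a cstar_struct \<Rightarrow> bool" where
  "cstar_ideal I A \<longleftrightarrow> additive_subgroup I A \<and>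
     (\<forall>a\<in>I. (\<forall>z. z \<odot>\<^bsub>A\<^esub> a \<in> I) \<and> (\<forall>b\<in>carrier A. a \<otimes>\<^bsub>A\<^esub> b \<in> I \<and> b \<otimes>\<^bsub>A\<^esub> a \<in> I)) \<and>
     closedin (norm_topology A) I"

text \<open>Product of a nonempty list; the algebra may lack a unit.\<close>

fun list_mult :: "'a cstar_struct \<Rightarrow> 'a list \<Rightarrow> 'a" where
  "list_mult A [] = undefined"
| "list_mult A [a] = a"
| "list_mult A (a # b # bs) = a \<otimes>\<^bsub>A\<^esub> list_mult A (b # bs)"

section \<open>The C*-algebra of a finitely aligned higher-rank graph\<close>

text \<open>
  In (CK4) the factors commute by (CK3), so the product does not depend on the enumeration of \<open>E\<close>;
  exhaustive sets are nonempty.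
\<close>

locale CK_family =
  fixes \<Lambda> :: "('l, 'k::finite) kgraph" and A :: "'a cstar_struct" (structure) and t :: "'l \<Rightarrow> 'a"
  assumes closed: "\<rho> \<in> paths \<Lambda> \<Longrightarrow> t \<rho> \<in> carrier A"
    and partial_isometry: "\<rho> \<in> paths \<Lambda> \<Longrightarrow> t \<rho> \<otimes> star A (t \<rho>) \<otimes> t \<rho> = t \<rho>"
    and CK1_projection: "v \<in> vertices \<Lambda> \<Longrightarrow> t v \<otimes> t v = t v \<and> star A (t v) = t v"
    and CK1_orthogonal: "v \<in> vertices \<Lambda> \<Longrightarrow> w \<in> vertices \<Lambda> \<Longrightarrow> v \<noteq> w \<Longrightarrow> t v \<otimes> t w = \<zero>"
    and CK2: "\<mu> \<in> paths \<Lambda> \<Longrightarrow> \<nu> \<in> paths \<Lambda> \<Longrightarrow> src \<Lambda> \<mu> = rng \<Lambda> \<nu> \<Longrightarrow> t \<mu> \<otimes> t \<nu> = t (cmp \<Lambda> \<mu> \<nu>)"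
    and CK3: "\<mu> \<in> paths \<Lambda> \<Longrightarrow> \<nu> \<in> paths \<Lambda> \<Longrightarrow>
      star A (t \<mu>) \<otimes> t \<nu> =
        (\<Oplus>p\<in>{(\<alpha>, \<beta>). \<alpha> \<in> paths \<Lambda> \<and> \<beta> \<in> paths \<Lambda> \<and> src \<Lambda> \<mu> = rng \<Lambda> \<alpha> \<and> src \<Lambda> \<nu> = rng \<Lambda> \<beta> \<and>
               cmp \<Lambda> \<mu> \<alpha> = cmp \<Lambda> \<nu> \<beta> \<and> cmp \<Lambda> \<mu> \<alpha> \<in> MCE \<Lambda> \<mu> \<nu>}.
          t (fst p) \<otimes> star A (t (snd p)))"
    and CK4: "v \<in> vertices \<Lambda> \<Longrightarrow> E \<in> FE \<Lambda> v \<Longrightarrow> set ls = E \<Longrightarrow> distinct ls \<Longrightarrow>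
      list_mult A (map (\<lambda>\<rho>. t v \<ominus> t \<rho> \<otimes> star A (t \<rho>)) ls) = \<zero>"

text \<open>
  \<open>(A, s)\<close> is (a copy of) \<open>C*(\<Lambda>)\<close> with its generating family. HOL cannot quantify over all types
  inside a definition, so the algebras \<open>B\<close> of the universal property have their carriers inside
  one fixed type. It has the cardinality of the continuum, and \<open>\<Lambda>\<close> is countable, so the
  C*-algebra generated by any Cuntz-Krieger \<open>\<Lambda>\<close>-family is isomorphic to such a \<open>B\<close>; hence the
  universal property holds for C*-algebras over arbitrary types. The algebraic operations and
  norm of \<open>B\<close> are arbitrary: no structure of the underlying type is used.
  Uniqueness of \<open>\<pi>\<close> follows from \<open>generates\<close>.
\<close>

definition is_graph_cstar_algebra ::
  "('l, 'k::finite) kgraph \<Rightarrow> 'a cstar_struct \<Rightarrow> ('l \<Rightarrow> 'a) \<Rightarrow> bool" where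
  "is_graph_cstar_algebra \<Lambda> A s \<longleftrightarrow>
     cstar_algebra A \<and> CK_family \<Lambda> A s \<and> generates (s ` paths \<Lambda>) A \<and>
     (\<forall>(B :: (nat \<Rightarrow> nat \<Rightarrow> complex) cstar_struct) t. cstar_algebra B \<and> CK_family \<Lambda> B t \<longrightarrow>
        (\<exists>\<pi>\<in>cstar_hom A B. \<forall>\<rho>\<in>paths \<Lambda>. \<pi> (s \<rho>) = t \<rho>))"

definition torus :: "(complex ^ 'k) set" where
  "torus = {z. \<forall>i. cmod (z $ i) = 1}"

definition multi_power :: "complex ^ 'k \<Rightarrow> nat ^ 'k \<Rightarrow> complex" where
  "multi_power z n = (\<Prod>i\<in>UNIV. (z $ i) ^ (n $ i))"

text \<open>Multiplication and unit of \<open>complex ^ 'k\<close> are coordinatewise.\<close>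

definition is_gauge_action ::
  "('l, 'k::finite) kgraph \<Rightarrow> 'a cstar_struct \<Rightarrow> ('l \<Rightarrow> 'a) \<Rightarrow> (complex ^ 'k \<Rightarrow> 'a \<Rightarrow> 'a) \<Rightarrow> bool" where
  "is_gauge_action \<Lambda> A s \<gamma> \<longleftrightarrow>
     (\<forall>z\<in>torus. \<gamma> z \<in> cstar_auto A) \<and>
     (\<forall>a\<in>carrier A. \<gamma> 1 a = a) \<and>
     (\<forall>z\<in>torus. \<forall>w\<in>torus. \<forall>a\<in>carrier A. \<gamma> (z * w) a = \<gamma> z (\<gamma> w a)) \<and>
     (\<forall>a\<in>carrier A. continuous_map (top_of_set torus) (norm_topology A) (\<lambda>z. \<gamma> z a)) \<and>
     (\<forall>z\<in>torus. \<forall>\<rho>\<in>paths \<Lambda>. \<gamma> z (s \<rho>) = multi_power z (deg \<Lambda> \<rho>) \<odot>\<^bsub>A\<^esub> s \<rho>)"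

definition fixed_point_algebra ::
  "'a cstar_struct \<Rightarrow> (complex ^ 'k \<Rightarrow> 'a \<Rightarrow> 'a) \<Rightarrow> 'a set" where
  "fixed_point_algebra A \<gamma> = {a \<in> carrier A. \<forall>z\<in>torus. \<gamma> z a = a}"

end

theory Submission
  imports Defs
begin

text \<open>
  If \<open>\<Lambda>\<close> is not cofinal, there are a vertex \<open>v\<close> and a boundary path none of whose vertices is reached
  from \<open>v\<close>: it is the limit of paths extended so as to meet all finite exhaustive sets while staying
  outside the saturation of the set of vertices reached from \<open>v\<close>. The Hilbert space over the
  countable orbit of this boundary path carries a Cuntz-Krieger family with \<open>t\<^sub>v = 0\<close>, which
  yields a proper ideal containing \<open>s\<^sub>v\<close>. If \<open>\<Lambda>\<close> is cofinal, then (CK4) shows that an ideal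
  containing one vertex projection contains all of them.

  It remains to find a vertex projection in every ideal \<open>I\<close> that meets the fixed-point algebra
  nontrivially. Averaging over roots of unity approximates a fixed point by a combination \<open>b\<close> of elements
  \<open>s\<^sub>\<mu> s\<^sub>\<nu>\<^sup>*\<close> with \<open>d(\<mu>) = d(\<nu>)\<close>, and \<open>b\<close> lies in a finite-dimensional subalgebra \<open>F\<close> spanned by such
  elements. If \<open>I\<close> contains no vertex projection, then compressing an element of \<open>F\<close> to scalar
  multiples of vertex projections bounds its coefficients, hence its norm, by a constant times its
  distance to \<open>I\<close>. For self-adjoint \<open>b\<close>, applying this to the powers \<open>b\<^bsup>2^n\<^esup>\<close> removes the constant. So
  the norm on the core is the distance to \<open>I\<close>, and \<open>I\<close> meets the fixed-point algebra in \<open>0\<close>.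
\<close>

section \<open>Paths and their initial segments\<close>

text \<open>The quotient by \<open>I\<close> is never formed. Distances to elements of
  \<open>I\<close> replace its norm, and what has to be known about them rests on one fact: a
  projection at distance less than 1 from an ideal lies in that ideal. The obstacle of higher rank
  is the finite-dimensional algebra. A product of two spanning elements is a sum over minimal common
  extensions, so new paths appear, and a bound on their degrees does not bound their number, since
  there may be infinitely many paths of one degree. Finite alignment has to be applied degree by
  degree to see that the closing up stops. The spanning elements are moreover dependent through
  (CK4), so coefficients can be bounded only once the redundant pairs are discarded. Boundary paths
  are replaced by sets of paths because adding or removing an initial path is then a set operation,
  free of degrees with infinite coordinates. The universal property speaks of algebras with carriers
  in a type of matrices; hence the Hilbert space is indexed by \<nat> and operators are encoded by
  their matrices.\<close>

lemma vec_nat_le_diff: "(m::nat^'k) \<le> n \<Longrightarrow> m + (n - m) = n"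
  by (simp add: vec_eq_iff less_eq_vec_def)

lemma vec_nat_le_iff_add: "(m::nat^'k) \<le> n \<longleftrightarrow> (\<exists>l. n = m + l)"
  by (metis vec_nat_le_diff less_eq_vec_def le_add1 vector_add_component)

lemma vec_nat_add_left_cancel: "(m::nat^'k) + a = m + b \<longleftrightarrow> a = b"
  by (simp add: vec_eq_iff)

lemma vec_nat_zero_le [simp]: "(0::nat^'k) \<le> n"
  by (simp add: less_eq_vec_def)

lemma vjoin_ge: "m \<le> vjoin m n" "n \<le> vjoin m n"
  by (auto simp: vjoin_def less_eq_vec_def)

lemma vjoin_le_iff: "vjoin m n \<le> l \<longleftrightarrow> m \<le> l \<and> n \<le> l"
  by (auto simp: vjoin_def less_eq_vec_def)

lemma vjoin_absorb: "m \<le> n \<Longrightarrow> vjoin m n = n" "n \<le> m \<Longrightarrow> vjoin m n = m"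
  by (auto simp: vjoin_def less_eq_vec_def vec_eq_iff max_def intro: order.antisym)

lemma vjoin_add: "vjoin (l + m) (l + n) = l + vjoin m n"
  by (auto simp: vjoin_def vec_eq_iff)

lemma finite_vec_nat_atMost: "finite {n::nat^'k::finite. n \<le> N}"
proof -
  have "{n::nat^'k. n \<le> N} \<subseteq> vec_lambda ` (\<Pi>\<^sub>E i\<in>UNIV. {..N $ i})"
  proof
    fix n :: "nat^'k" assume "n \<in> {n. n \<le> N}"
    then have "vec_nth n \<in> (\<Pi>\<^sub>E i\<in>UNIV. {..N $ i})"
      by (auto simp: less_eq_vec_def)
    then show "n \<in> vec_lambda ` (\<Pi>\<^sub>E i\<in>UNIV. {..N $ i})"
      by (metis image_eqI vec_nth_inverse)
  qed
  moreover have "finite (\<Pi>\<^sub>E i\<in>(UNIV::'k set). {..N $ i})"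
    by (intro finite_PiE) auto
  ultimately show ?thesis
    by (meson finite_imageI finite_subset)
qed

text \<open>The total length of a degree, strictly monotone in the coordinatewise order; it is the
  measure of every induction over degrees below.\<close>

definition vsum :: "nat ^ 'k::finite \<Rightarrow> nat" where
  "vsum n = (\<Sum>i\<in>UNIV. n $ i)"

lemma vsum_strict_mono: "m \<le> n \<Longrightarrow> m \<noteq> n \<Longrightarrow> vsum m < vsum n"
  unfolding vsum_def
  by (rule sum_strict_mono_ex1) (auto simp: less_eq_vec_def vec_eq_iff order.strict_iff_order)

section \<open>Composition and the prefix order in a small category\<close>

context small_category
begin

abbreviation comp (infixr \<open>\<cdot>\<close> 70) where "\<mu> \<cdot> \<nu> \<equiv> cmp \<Lambda> \<mu> \<nu>"

definition composable :: "'l \<Rightarrow> 'l \<Rightarrow> bool" where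
  "composable \<mu> \<nu> \<longleftrightarrow> \<mu> \<in> paths \<Lambda> \<and> \<nu> \<in> paths \<Lambda> \<and> src \<Lambda> \<mu> = rng \<Lambda> \<nu>"

text \<open>The prefix order. \<open>segment_zero_eq\<close> and \<open>MCE_iff\<close> express
  segments and minimal common extensions through it, so that definite descriptions are met only
  once.\<close>

definition initial :: "'l \<Rightarrow> 'l \<Rightarrow> bool" (infix \<open>\<preceq>\<close> 50) where
  "\<mu> \<preceq> \<kappa> \<longleftrightarrow> (\<exists>\<alpha>. composable \<mu> \<alpha> \<and> \<kappa> = \<mu> \<cdot> \<alpha>)"

lemma composableD:
  assumes "composable \<mu> \<nu>"
  shows "\<mu> \<in> paths \<Lambda>" "\<nu> \<in> paths \<Lambda>" "src \<Lambda> \<mu> = rng \<Lambda> \<nu>" "\<mu> \<cdot> \<nu> \<in> paths \<Lambda>"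
    "rng \<Lambda> (\<mu> \<cdot> \<nu>) = rng \<Lambda> \<mu>" "src \<Lambda> (\<mu> \<cdot> \<nu>) = src \<Lambda> \<nu>"
  using assms cmp_closed rng_cmp src_cmp by (auto simp: composable_def)

lemma composable_assoc:
  assumes "composable \<mu> \<nu>" "composable \<nu> \<rho>"
  shows "composable (\<mu> \<cdot> \<nu>) \<rho>" "composable \<mu> (\<nu> \<cdot> \<rho>)" "(\<mu> \<cdot> \<nu>) \<cdot> \<rho> = \<mu> \<cdot> (\<nu> \<cdot> \<rho>)"
  using assms composableD[OF assms(1)] composableD[OF assms(2)] cmp_assoc
  by (auto simp: composable_def)

lemma composable_cmp_left: "composable \<mu> \<nu> \<Longrightarrow> composable (\<mu> \<cdot> \<nu>) \<rho> \<longleftrightarrow> composable \<nu> \<rho>"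
  by (auto simp: composable_def cmp_closed src_cmp)

lemma composable_cmp_right: "composable \<nu> \<rho> \<Longrightarrow> composable \<mu> (\<nu> \<cdot> \<rho>) \<longleftrightarrow> composable \<mu> \<nu>"
  by (auto simp: composable_def cmp_closed rng_cmp)

lemma composable_rng: "\<rho> \<in> paths \<Lambda> \<Longrightarrow> composable (rng \<Lambda> \<rho>) \<rho>"
  and composable_src: "\<rho> \<in> paths \<Lambda> \<Longrightarrow> composable \<rho> (src \<Lambda> \<rho>)"
  by (auto simp: composable_def rng_closed src_closed src_rng rng_src)

lemma initial_cmp: "composable \<mu> \<nu> \<Longrightarrow> \<mu> \<preceq> \<mu> \<cdot> \<nu>"
  by (auto simp: initial_def)

lemma initialD:
  assumes "\<mu> \<preceq> \<kappa>" shows "\<mu> \<in> paths \<Lambda>" "\<kappa> \<in> paths \<Lambda>" "rng \<Lambda> \<mu> = rng \<Lambda> \<kappa>"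
  using assms by (auto simp: initial_def dest: composableD)

lemma initial_refl: "\<mu> \<in> paths \<Lambda> \<Longrightarrow> \<mu> \<preceq> \<mu>"
  by (metis composable_src initial_def cmp_src)

lemma initial_rng: "\<mu> \<in> paths \<Lambda> \<Longrightarrow> rng \<Lambda> \<mu> \<preceq> \<mu>"
  by (metis composable_rng initial_def cmp_rng)

lemma initial_trans: "\<sigma> \<preceq> \<mu> \<Longrightarrow> \<mu> \<preceq> \<nu> \<Longrightarrow> \<sigma> \<preceq> \<nu>"
  unfolding initial_def by (metis composable_assoc composable_cmp_left)

lemma initial_cmp_left: "composable \<sigma> \<mu> \<Longrightarrow> \<mu> \<preceq> \<nu> \<Longrightarrow> \<sigma> \<cdot> \<mu> \<preceq> \<sigma> \<cdot> \<nu>"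
  unfolding initial_def by (metis composable_assoc)

end

section \<open>Unique factorisation, degrees and segments\<close>

context kgraph
begin

abbreviation "d \<equiv> deg \<Lambda>"

lemma deg_comp: "composable \<mu> \<nu> \<Longrightarrow> d (\<mu> \<cdot> \<nu>) = d \<mu> + d \<nu>"
  by (simp add: composable_def deg_cmp)

text \<open>Cancellation in \<nat>^k makes the degrees of the right factors agree as well, and then
  both pairs factorise one path with the same degrees.\<close>

lemma factor_unique:
  assumes "composable \<mu> \<nu>" "composable \<mu>' \<nu>'" "\<mu> \<cdot> \<nu> = \<mu>' \<cdot> \<nu>'" "d \<mu> = d \<mu>'"
  shows "\<mu> = \<mu>'" "\<nu> = \<nu>'"
proof -
  have "d \<nu> = d \<nu>'"
    using assms deg_comp vec_nat_add_left_cancel by metis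
  then have "(\<mu>, \<nu>) = (\<mu>', \<nu>')"
    using factorisation[OF composableD(4)[OF assms(1)] deg_comp[OF assms(1)]] assms
    unfolding composable_def
    by (metis (no_types, lifting) SigmaI fst_conv snd_conv)
  then show "\<mu> = \<mu>'" "\<nu> = \<nu>'" by auto
qed

lemma cmp_left_cancel: "composable \<mu> \<alpha> \<Longrightarrow> composable \<mu> \<beta> \<Longrightarrow> \<mu> \<cdot> \<alpha> = \<mu> \<cdot> \<beta> \<Longrightarrow> \<alpha> = \<beta>"
  using factor_unique by blast

lemma factor_exists:
  assumes "\<kappa> \<in> paths \<Lambda>" "n \<le> d \<kappa>"
  obtains \<mu> \<nu> where "composable \<mu> \<nu>" "d \<mu> = n" "\<kappa> = \<mu> \<cdot> \<nu>"
proof -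
  have "d \<kappa> = n + (d \<kappa> - n)" using assms vec_nat_le_diff by metis
  from factorisation[OF assms(1) this] show ?thesis
    using that unfolding composable_def by (metis mem_Times_iff)
qed

text \<open>A path is both \<open>rng \<cdot> \<rho>\<close> and \<open>\<rho> \<cdot> src\<close>.
  If \<open>\<rho>\<close> has degree 0, the two left factors have equal degree, and unique
  factorisation identifies them.\<close>

lemma deg_zero_iff:
  assumes "\<rho> \<in> paths \<Lambda>" shows "d \<rho> = 0 \<longleftrightarrow> rng \<Lambda> \<rho> = \<rho>"
  using factor_unique[OF composable_rng composable_src, OF assms assms] assms cmp_rng cmp_src
  by (metis deg_rng)

lemma vertices_iff: "v \<in> vertices \<Lambda> \<longleftrightarrow> v \<in> paths \<Lambda> \<and> rng \<Lambda> v = v"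
  by (auto simp: vertices_def deg_zero_iff)

lemma vertexD:
  assumes "v \<in> vertices \<Lambda>" shows "v \<in> paths \<Lambda>" "rng \<Lambda> v = v" "src \<Lambda> v = v" "d v = 0"
  using assms src_rng by (auto simp: vertices_iff deg_zero_iff) metis

lemma rng_vertex: "\<rho> \<in> paths \<Lambda> \<Longrightarrow> rng \<Lambda> \<rho> \<in> vertices \<Lambda>"
  and src_vertex: "\<rho> \<in> paths \<Lambda> \<Longrightarrow> src \<Lambda> \<rho> \<in> vertices \<Lambda>"
  by (auto simp: vertices_def deg_rng deg_src rng_closed src_closed)

lemma initial_deg: "\<mu> \<preceq> \<kappa> \<Longrightarrow> d \<mu> \<le> d \<kappa>"
  by (auto simp: initial_def deg_comp vec_nat_le_iff_add)

lemma initial_exists: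
  assumes "\<kappa> \<in> paths \<Lambda>" "n \<le> d \<kappa>" obtains \<mu> where "\<mu> \<preceq> \<kappa>" "d \<mu> = n"
  using factor_exists[OF assms] initial_cmp by metis

lemma initial_unique: "\<mu> \<preceq> \<kappa> \<Longrightarrow> \<nu> \<preceq> \<kappa> \<Longrightarrow> d \<mu> = d \<nu> \<Longrightarrow> \<mu> = \<nu>"
  unfolding initial_def by (metis factor_unique(1))

text \<open>A prefix is determined by its degree, so \<open>\<mu>\<close> is the prefix of
  \<open>\<nu>\<close> of degree \<open>d \<mu>\<close>.\<close>

lemma initial_linear:
  assumes "\<mu> \<preceq> \<kappa>" "\<nu> \<preceq> \<kappa>" "d \<mu> \<le> d \<nu>" shows "\<mu> \<preceq> \<nu>"
  using initial_exists[OF initialD(1)[OF assms(2)] assms(3)] assms initial_unique initial_trans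
  by metis

lemma initial_cmp_cancel:
  assumes "composable \<sigma> \<mu>" "composable \<sigma> \<nu>" shows "\<sigma> \<cdot> \<mu> \<preceq> \<sigma> \<cdot> \<nu> \<longleftrightarrow> \<mu> \<preceq> \<nu>"
proof
  assume "\<sigma> \<cdot> \<mu> \<preceq> \<sigma> \<cdot> \<nu>"
  then obtain \<alpha> where \<alpha>: "composable (\<sigma> \<cdot> \<mu>) \<alpha>" "\<sigma> \<cdot> \<nu> = (\<sigma> \<cdot> \<mu>) \<cdot> \<alpha>"
    by (auto simp: initial_def)
  then have "composable \<mu> \<alpha>" using assms composable_cmp_left by blast
  then show "\<mu> \<preceq> \<nu>"
    using \<alpha> assms composable_assoc cmp_left_cancel initial_def by metis
qed (use assms initial_cmp_left in blast)

lemma segment_zero_eq: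
  assumes "\<kappa> \<in> paths \<Lambda>" "n \<le> d \<kappa>"
  shows "segment \<Lambda> \<kappa> 0 n = \<mu> \<longleftrightarrow> \<mu> \<preceq> \<kappa> \<and> d \<mu> = n"
proof -
  obtain \<mu>' \<nu>' where f: "composable \<mu>' \<nu>'" "d \<mu>' = n" "\<kappa> = \<mu>' \<cdot> \<nu>'"
    using factor_exists assms by metis
  have dn: "d \<nu>' = d \<kappa> - n"
    using f deg_comp by (auto simp: vec_eq_iff)
  have "segment \<Lambda> \<kappa> 0 n = \<mu>'"
    unfolding segment_def
  proof (rule the_equality, intro conjI bexI)
    show "\<mu>' \<in> paths \<Lambda>" "rng \<Lambda> \<mu>' \<in> paths \<Lambda>" "\<nu>' \<in> paths \<Lambda>" "src \<Lambda> \<mu>' = rng \<Lambda> \<nu>'"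
      "src \<Lambda> (rng \<Lambda> \<mu>') = rng \<Lambda> \<mu>'" "d (rng \<Lambda> \<mu>') = 0"
      using composableD[OF f(1)] by (auto simp: rng_closed src_rng deg_rng)
    show "d \<mu>' = n - 0" "d \<nu>' = d \<kappa> - n" using f dn by auto
    show "\<kappa> = (rng \<Lambda> \<mu>') \<cdot> \<mu>' \<cdot> \<nu>'"
      using f cmp_rng composableD by metis
  next
    fix \<mu>'' assume "\<mu>'' \<in> paths \<Lambda> \<and> d \<mu>'' = n - 0 \<and> (\<exists>\<rho>'\<in>paths \<Lambda>. \<exists>\<rho>''\<in>paths \<Lambda>. d \<rho>' = 0 \<and>
        d \<rho>'' = d \<kappa> - n \<and> src \<Lambda> \<rho>' = rng \<Lambda> \<mu>'' \<and> src \<Lambda> \<mu>'' = rng \<Lambda> \<rho>'' \<and> \<kappa> = \<rho>' \<cdot> \<mu>'' \<cdot> \<rho>'')"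
    then obtain \<rho>' \<rho>'' where *: "\<mu>'' \<in> paths \<Lambda>" "d \<mu>'' = n" "\<rho>' \<in> paths \<Lambda>" "\<rho>'' \<in> paths \<Lambda>"
      "d \<rho>' = 0" "src \<Lambda> \<rho>' = rng \<Lambda> \<mu>''" "src \<Lambda> \<mu>'' = rng \<Lambda> \<rho>''" "\<kappa> = \<rho>' \<cdot> \<mu>'' \<cdot> \<rho>''"
      by auto
    then have "composable \<mu>'' \<rho>''" by (simp add: composable_def)
    moreover have "\<rho>' = rng \<Lambda> (\<mu>'' \<cdot> \<rho>'')"
      using * \<open>composable \<mu>'' \<rho>''\<close> composableD vertexD(3) vertices_def by (metis (mono_tags, lifting) mem_Collect_eq)
    ultimately have "\<kappa> = \<mu>'' \<cdot> \<rho>''" using * cmp_rng composableD by metis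
    then show "\<mu>'' = \<mu>'" using f * \<open>composable \<mu>'' \<rho>''\<close> factor_unique(1) by metis
  qed
  then show ?thesis using f initial_cmp initial_unique by metis
qed

section \<open>Minimal common extensions\<close>

lemma MCE_iff:
  "\<kappa> \<in> MCE \<Lambda> \<mu> \<nu> \<longleftrightarrow> \<mu> \<preceq> \<kappa> \<and> \<nu> \<preceq> \<kappa> \<and> d \<kappa> = vjoin (d \<mu>) (d \<nu>)"
proof (cases "\<kappa> \<in> paths \<Lambda> \<and> d \<kappa> = vjoin (d \<mu>) (d \<nu>)")
  case True
  then show ?thesis
    by (simp add: MCE_def segment_zero_eq vjoin_ge)
qed (auto simp: MCE_def dest: initialD)

text \<open>Cut \<open>\<kappa>\<close> at the join of the two degrees; prefixes of one path are
  comparable when their degrees are, so the cut lies above \<open>\<mu>\<close> and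
  \<open>\<nu>\<close>.\<close>

lemma MCE_initial:
  assumes "\<mu> \<preceq> \<kappa>" "\<nu> \<preceq> \<kappa>" obtains \<rho> where "\<rho> \<in> MCE \<Lambda> \<mu> \<nu>" "\<rho> \<preceq> \<kappa>"
proof -
  have "vjoin (d \<mu>) (d \<nu>) \<le> d \<kappa>"
    using assms initial_deg by (simp add: vjoin_le_iff)
  then obtain \<rho> where "\<rho> \<preceq> \<kappa>" "d \<rho> = vjoin (d \<mu>) (d \<nu>)"
    using initial_exists initialD(2)[OF assms(1)] by metis
  then show ?thesis
    using that assms initial_linear MCE_iff vjoin_ge by metis
qed

lemma MCE_nonempty_iff: "MCE \<Lambda> \<mu> \<nu> \<noteq> {} \<longleftrightarrow> (\<exists>\<kappa>. \<mu> \<preceq> \<kappa> \<and> \<nu> \<preceq> \<kappa>)"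
  using MCE_iff MCE_initial by (metis empty_iff ex_in_conv)

lemma MCE_cmp_iff:
  assumes "composable \<sigma> \<mu>" "composable \<sigma> \<nu>" "composable \<sigma> \<kappa>"
  shows "\<sigma> \<cdot> \<kappa> \<in> MCE \<Lambda> (\<sigma> \<cdot> \<mu>) (\<sigma> \<cdot> \<nu>) \<longleftrightarrow> \<kappa> \<in> MCE \<Lambda> \<mu> \<nu>"
  using assms by (simp add: MCE_iff initial_cmp_cancel deg_comp vjoin_add vec_nat_add_left_cancel)

text \<open>The index set of the sum in (CK3): a minimal common extension is recorded by the two
  tails that complete \<open>\<mu>\<close> and \<open>\<nu>\<close> to it.\<close>

definition mce_pairs :: "'l \<Rightarrow> 'l \<Rightarrow> ('l \<times> 'l) set" where
  "mce_pairs \<mu> \<nu> = {(\<alpha>, \<beta>). composable \<mu> \<alpha> \<and> composable \<nu> \<beta> \<and> \<mu> \<cdot> \<alpha> = \<nu> \<cdot> \<beta> \<and> \<mu> \<cdot> \<alpha> \<in> MCE \<Lambda> \<mu> \<nu>}"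

lemma mce_pairsD:
  assumes "p \<in> mce_pairs \<mu> \<nu>"
  shows "composable \<mu> (fst p)" "composable \<nu> (snd p)" "\<mu> \<cdot> fst p = \<nu> \<cdot> snd p" "\<mu> \<cdot> fst p \<in> MCE \<Lambda> \<mu> \<nu>"
    "src \<Lambda> (fst p) = src \<Lambda> (snd p)" "fst p \<in> paths \<Lambda>" "snd p \<in> paths \<Lambda>"
proof -
  show 1: "composable \<mu> (fst p)" "composable \<nu> (snd p)" "\<mu> \<cdot> fst p = \<nu> \<cdot> snd p" "\<mu> \<cdot> fst p \<in> MCE \<Lambda> \<mu> \<nu>"
    using assms by (auto simp: mce_pairs_def)
  then show "src \<Lambda> (fst p) = src \<Lambda> (snd p)" using composableD(6) by metis
  show "fst p \<in> paths \<Lambda>" "snd p \<in> paths \<Lambda>" using 1 composableD by auto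
qed

lemma mce_pairs_eq:
  assumes "\<mu> \<in> paths \<Lambda>" "\<nu> \<in> paths \<Lambda>"
  shows "mce_pairs \<mu> \<nu> = {(\<alpha>, \<beta>). \<alpha> \<in> paths \<Lambda> \<and> \<beta> \<in> paths \<Lambda> \<and> src \<Lambda> \<mu> = rng \<Lambda> \<alpha> \<and>
    src \<Lambda> \<nu> = rng \<Lambda> \<beta> \<and> \<mu> \<cdot> \<alpha> = \<nu> \<cdot> \<beta> \<and> \<mu> \<cdot> \<alpha> \<in> MCE \<Lambda> \<mu> \<nu>}"
  using assms by (auto simp: mce_pairs_def composable_def)

lemma mce_pairs_eqI:
  assumes p: "p \<in> mce_pairs \<mu> \<nu>" and q: "q \<in> mce_pairs \<mu> \<nu>" and "fst p = fst q" shows "p = q"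
proof -
  have "snd p = snd q"
    using mce_pairsD(2,3)[OF p] mce_pairsD(2,3)[OF q] assms(3) cmp_left_cancel by metis
  then show ?thesis using assms(3) by (simp add: prod_eq_iff)
qed

lemma finite_mce_pairs:
  assumes "finitely_aligned \<Lambda>" "\<mu> \<in> paths \<Lambda>" "\<nu> \<in> paths \<Lambda>" shows "finite (mce_pairs \<mu> \<nu>)"
proof (rule finite_imageD)
  show "finite ((\<lambda>p. \<mu> \<cdot> fst p) ` mce_pairs \<mu> \<nu>)"
    by (rule finite_subset[of _ "MCE \<Lambda> \<mu> \<nu>"])
      (use assms in \<open>auto simp: mce_pairs_def finitely_aligned_def\<close>)
  show "inj_on (\<lambda>p. \<mu> \<cdot> fst p) (mce_pairs \<mu> \<nu>)"
    using mce_pairsD(1) mce_pairs_eqI cmp_left_cancel by (meson inj_onI)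
qed

section \<open>Finite exhaustive sets and their transfer along paths\<close>

lemma FE_D:
  assumes "E \<in> FE \<Lambda> v" "\<alpha> \<in> E" shows "\<alpha> \<in> paths \<Lambda>" "rng \<Lambda> \<alpha> = v"
  using assms by (auto simp: FE_def exhaustive_def paths_to_def)

lemma FE_iff: "E \<in> FE \<Lambda> v \<longleftrightarrow> finite E \<and> (\<forall>\<alpha>\<in>E. \<alpha> \<in> paths \<Lambda> \<and> rng \<Lambda> \<alpha> = v) \<and>
    (\<forall>\<mu>\<in>paths \<Lambda>. rng \<Lambda> \<mu> = v \<longrightarrow> (\<exists>\<alpha>\<in>E. \<exists>\<kappa>. \<mu> \<preceq> \<kappa> \<and> \<alpha> \<preceq> \<kappa>))"
  by (auto simp: FE_def exhaustive_def paths_to_def MCE_nonempty_iff)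

lemma FE_nonempty: "E \<in> FE \<Lambda> v \<Longrightarrow> v \<in> vertices \<Lambda> \<Longrightarrow> E \<noteq> {}"
  by (auto simp: FE_iff vertices_iff)

lemma FE_singleton: "v \<in> vertices \<Lambda> \<Longrightarrow> {v} \<in> FE \<Lambda> v"
  by (auto simp: FE_iff vertices_iff intro: initial_refl initial_rng)

text \<open>The usual set of minimal extensions of \<open>\<sigma>\<close> towards \<open>E\<close>;
  it pulls an exhaustive set at the range of \<open>\<sigma>\<close> back to the source.\<close>

definition Ext :: "'l \<Rightarrow> 'l set \<Rightarrow> 'l set" where
  "Ext \<sigma> E = {\<alpha>. composable \<sigma> \<alpha> \<and> (\<exists>\<mu>\<in>E. \<sigma> \<cdot> \<alpha> \<in> MCE \<Lambda> \<sigma> \<mu>)}"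

text \<open>For \<open>\<beta>\<close> at the source, \<open>\<sigma> \<cdot> \<beta>\<close> has a
  common extension \<open>\<kappa>\<close> with some \<open>\<mu>\<close> in \<open>E\<close>. A
  minimal common extension of \<open>\<sigma>\<close> and \<open>\<mu>\<close> lies below
  \<open>\<kappa>\<close>; cancelling \<open>\<sigma>\<close> turns it into a member of
  \<open>Ext \<sigma> E\<close> with a common extension with \<open>\<beta>\<close>. Finite
  alignment gives finiteness.\<close>

lemma Ext_FE:
  assumes fa: "finitely_aligned \<Lambda>" and l: "\<sigma> \<in> paths \<Lambda>" and E: "E \<in> FE \<Lambda> (rng \<Lambda> \<sigma>)"
  shows "Ext \<sigma> E \<in> FE \<Lambda> (src \<Lambda> \<sigma>)"
  unfolding FE_iff
proof (intro conjI ballI impI)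
  have "(\<lambda>\<alpha>. \<sigma> \<cdot> \<alpha>) ` Ext \<sigma> E \<subseteq> (\<Union>\<mu>\<in>E. MCE \<Lambda> \<sigma> \<mu>)"
    by (auto simp: Ext_def)
  moreover have "finite (\<Union>\<mu>\<in>E. MCE \<Lambda> \<sigma> \<mu>)"
    using E fa l by (auto simp: FE_iff finitely_aligned_def)
  moreover have "inj_on (\<lambda>\<alpha>. \<sigma> \<cdot> \<alpha>) (Ext \<sigma> E)"
    by (auto simp: Ext_def inj_on_def dest: cmp_left_cancel)
  ultimately show "finite (Ext \<sigma> E)"
    by (meson finite_subset finite_imageD)
next
  fix \<beta> assume b: "\<beta> \<in> paths \<Lambda>" "rng \<Lambda> \<beta> = src \<Lambda> \<sigma>"
  then have lb: "composable \<sigma> \<beta>" using l by (simp add: composable_def)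
  then obtain \<mu> \<kappa> where k: "\<mu> \<in> E" "\<sigma> \<cdot> \<beta> \<preceq> \<kappa>" "\<mu> \<preceq> \<kappa>"
    using E composableD[OF lb] by (auto simp: FE_iff)
  then have lk: "\<sigma> \<preceq> \<kappa>" using lb initial_cmp initial_trans by blast
  then obtain \<rho> where r: "\<rho> \<in> MCE \<Lambda> \<sigma> \<mu>" "\<rho> \<preceq> \<kappa>" using k MCE_initial by metis
  then obtain \<alpha> where a: "composable \<sigma> \<alpha>" "\<rho> = \<sigma> \<cdot> \<alpha>" using MCE_iff initial_def by metis
  then have "\<alpha> \<in> Ext \<sigma> E" using k r by (auto simp: Ext_def)
  moreover obtain \<gamma> where "composable \<sigma> \<gamma>" "\<kappa> = \<sigma> \<cdot> \<gamma>" using lk initial_def by auto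
  ultimately show "\<exists>\<alpha>\<in>Ext \<sigma> E. \<exists>\<kappa>. \<beta> \<preceq> \<kappa> \<and> \<alpha> \<preceq> \<kappa>"
    using a lb k r initial_cmp_cancel by metis
qed (auto simp: Ext_def composable_def)

text \<open>If \<open>\<mu>\<close> and \<open>\<alpha>\<close> extend to
  \<open>\<alpha> \<cdot> \<gamma>\<close>, then \<open>\<gamma>\<close> meets
  \<open>F \<alpha>\<close>, and prefixing by \<open>\<alpha>\<close> yields the required common
  extension. This is what makes the saturation of a set of vertices closed under a further
  step.\<close>

lemma FE_bind:
  assumes E: "E \<in> FE \<Lambda> v" and F: "\<And>\<alpha>. \<alpha> \<in> E \<Longrightarrow> F \<alpha> \<in> FE \<Lambda> (src \<Lambda> \<alpha>)"
  shows "(\<Union>\<alpha>\<in>E. (\<lambda>\<beta>. \<alpha> \<cdot> \<beta>) ` F \<alpha>) \<in> FE \<Lambda> v"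
  unfolding FE_iff
proof (intro conjI ballI impI)
  show "finite (\<Union>\<alpha>\<in>E. (\<lambda>\<beta>. \<alpha> \<cdot> \<beta>) ` F \<alpha>)"
    using E F by (auto simp: FE_iff)
  fix \<rho> assume "\<rho> \<in> (\<Union>\<alpha>\<in>E. (\<lambda>\<beta>. \<alpha> \<cdot> \<beta>) ` F \<alpha>)"
  then obtain \<alpha> \<beta> where ab: "\<alpha> \<in> E" "\<beta> \<in> F \<alpha>" "\<rho> = \<alpha> \<cdot> \<beta>" by blast
  then have "composable \<alpha> \<beta>"
    using FE_D[OF E ab(1)] FE_D[OF F[OF ab(1)] ab(2)] by (auto simp: composable_def)
  then show "\<rho> \<in> paths \<Lambda>" "rng \<Lambda> \<rho> = v"
    using composableD ab FE_D[OF E ab(1)] by auto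
next
  fix \<mu> assume m: "\<mu> \<in> paths \<Lambda>" "rng \<Lambda> \<mu> = v"
  then obtain \<alpha> \<kappa> where a: "\<alpha> \<in> E" "\<mu> \<preceq> \<kappa>" "\<alpha> \<preceq> \<kappa>" using E by (auto simp: FE_iff)
  then obtain \<gamma> where g: "composable \<alpha> \<gamma>" "\<kappa> = \<alpha> \<cdot> \<gamma>" by (auto simp: initial_def)
  then obtain \<beta> \<eta> where b: "\<beta> \<in> F \<alpha>" "\<gamma> \<preceq> \<eta>" "\<beta> \<preceq> \<eta>"
    using F[OF a(1)] unfolding FE_iff composable_def by metis
  then have "composable \<alpha> \<eta>" "composable \<alpha> \<beta>"
    using g unfolding composable_def by (metis initialD)+
  then have "\<alpha> \<cdot> \<gamma> \<preceq> \<alpha> \<cdot> \<eta>" "\<alpha> \<cdot> \<beta> \<preceq> \<alpha> \<cdot> \<eta>" using b g initial_cmp_left by blast+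
  then show "\<exists>\<alpha>\<in>\<Union>\<alpha>\<in>E. (\<lambda>\<beta>. \<alpha> \<cdot> \<beta>) ` F \<alpha>. \<exists>\<kappa>. \<mu> \<preceq> \<kappa> \<and> \<alpha> \<preceq> \<kappa>"
    using a b g initial_trans by blast
qed

end

context kgraph
begin

section \<open>Boundary paths as filters of paths\<close>

text \<open>A boundary path is encoded by the set of its initial segments.\<close>

definition boundary_filter :: "'l \<Rightarrow> 'l set \<Rightarrow> bool" where
  "boundary_filter v Y \<longleftrightarrow> v \<in> Y \<and> Y \<subseteq> paths_to \<Lambda> v \<and>
     (\<forall>\<kappa>\<in>Y. \<forall>\<mu>. \<mu> \<preceq> \<kappa> \<longrightarrow> \<mu> \<in> Y) \<and>
     (\<forall>\<mu>\<in>Y. \<forall>\<nu>\<in>Y. \<exists>\<kappa>\<in>Y. \<mu> \<preceq> \<kappa> \<and> \<nu> \<preceq> \<kappa>) \<and>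
     (\<forall>\<mu>\<in>Y. \<forall>E\<in>FE \<Lambda> (src \<Lambda> \<mu>). \<exists>\<alpha>\<in>E. \<mu> \<cdot> \<alpha> \<in> Y)"

text \<open>Removal of the initial path \<open>\<sigma>\<close> from a boundary path; on sets of
  prefixes it is a preimage under composition.\<close>

definition shift :: "'l \<Rightarrow> 'l set \<Rightarrow> 'l set" where
  "shift \<sigma> Y = {\<mu>. composable \<sigma> \<mu> \<and> \<sigma> \<cdot> \<mu> \<in> Y}"

text \<open>The image under composition with \<open>\<sigma>\<close> lacks the paths that do not
  extend \<open>\<sigma>\<close>, so it is closed downwards under the prefix order.\<close>

definition prepend :: "'l \<Rightarrow> 'l set \<Rightarrow> 'l set" where
  "prepend \<sigma> Z = {\<kappa>. \<exists>\<mu>\<in>Z. composable \<sigma> \<mu> \<and> \<kappa> \<preceq> \<sigma> \<cdot> \<mu>}"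

lemma boundary_filterD:
  assumes "boundary_filter v Y"
  shows "v \<in> Y" "\<And>\<mu>. \<mu> \<in> Y \<Longrightarrow> \<mu> \<in> paths \<Lambda>" "\<And>\<mu>. \<mu> \<in> Y \<Longrightarrow> rng \<Lambda> \<mu> = v"
    "\<And>\<mu> \<kappa>. \<kappa> \<in> Y \<Longrightarrow> \<mu> \<preceq> \<kappa> \<Longrightarrow> \<mu> \<in> Y"
    "\<And>\<mu> \<nu>. \<mu> \<in> Y \<Longrightarrow> \<nu> \<in> Y \<Longrightarrow> \<exists>\<kappa>\<in>Y. \<mu> \<preceq> \<kappa> \<and> \<nu> \<preceq> \<kappa>"
    "\<And>\<mu> E. \<mu> \<in> Y \<Longrightarrow> E \<in> FE \<Lambda> (src \<Lambda> \<mu>) \<Longrightarrow> \<exists>\<alpha>\<in>E. \<mu> \<cdot> \<alpha> \<in> Y"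
  using assms unfolding boundary_filter_def paths_to_def by blast+

lemma boundary_filter_vertex:
  assumes "boundary_filter v Y" shows "v \<in> vertices \<Lambda>"
  using boundary_filterD(1-3)[OF assms] by (auto simp: vertices_iff)

lemma boundary_filter_linear:
  assumes "boundary_filter v Y" "\<mu> \<in> Y" "\<nu> \<in> Y" "d \<mu> \<le> d \<nu>" shows "\<mu> \<preceq> \<nu>"
  using boundary_filterD(5)[OF assms(1-3)] assms(4) initial_linear by blast

lemma boundary_filter_unique:
  assumes "boundary_filter v Y" "\<mu> \<in> Y" "\<nu> \<in> Y" "d \<mu> = d \<nu>" shows "\<mu> = \<nu>"
  using boundary_filterD(5)[OF assms(1-3)] assms(4) initial_unique by blast

lemma boundary_filter_shift:
  assumes Y: "boundary_filter v Y" and s: "\<sigma> \<in> Y"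
  shows "boundary_filter (src \<Lambda> \<sigma>) (shift \<sigma> Y)"
  unfolding boundary_filter_def
proof (intro conjI ballI allI impI)
  note D = boundary_filterD[OF Y]
  show "src \<Lambda> \<sigma> \<in> shift \<sigma> Y"
    using D(2)[OF s] s by (simp add: shift_def composable_src cmp_src)
  show "shift \<sigma> Y \<subseteq> paths_to \<Lambda> (src \<Lambda> \<sigma>)"
    by (auto simp: shift_def paths_to_def composable_def)
  show "\<mu> \<in> shift \<sigma> Y" if "\<kappa> \<in> shift \<sigma> Y" "\<mu> \<preceq> \<kappa>" for \<kappa> \<mu>
  proof -
    have "composable \<sigma> \<mu>"
      using that initialD[OF that(2)] by (auto simp: shift_def composable_def)
    then show ?thesis using that D(4) initial_cmp_left by (auto simp: shift_def)
  qed
  show "\<exists>\<kappa>\<in>shift \<sigma> Y. \<mu> \<preceq> \<kappa> \<and> \<nu> \<preceq> \<kappa>" if mn: "\<mu> \<in> shift \<sigma> Y" "\<nu> \<in> shift \<sigma> Y" for \<mu> \<nu>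
  proof -
    obtain \<omega> where w: "\<omega> \<in> Y" "\<sigma> \<cdot> \<mu> \<preceq> \<omega>" "\<sigma> \<cdot> \<nu> \<preceq> \<omega>"
      using mn D(5) by (auto simp: shift_def)
    have c: "composable \<sigma> \<mu>" "composable \<sigma> \<nu>" using mn by (auto simp: shift_def)
    then have "\<sigma> \<preceq> \<omega>" using w initial_cmp initial_trans by blast
    then obtain \<kappa> where "composable \<sigma> \<kappa>" "\<omega> = \<sigma> \<cdot> \<kappa>" by (auto simp: initial_def)
    then show ?thesis using c w initial_cmp_cancel unfolding shift_def by blast
  qed
  show "\<exists>\<alpha>\<in>E. \<mu> \<cdot> \<alpha> \<in> shift \<sigma> Y" if m: "\<mu> \<in> shift \<sigma> Y" and E: "E \<in> FE \<Lambda> (src \<Lambda> \<mu>)" for \<mu> E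
  proof -
    have c: "composable \<sigma> \<mu>" "\<sigma> \<cdot> \<mu> \<in> Y" using m by (auto simp: shift_def)
    then obtain \<alpha> where a: "\<alpha> \<in> E" "(\<sigma> \<cdot> \<mu>) \<cdot> \<alpha> \<in> Y"
      using D(6) E composableD(6) by metis
    have "composable \<mu> \<alpha>"
      using c FE_D[OF E a(1)] by (simp add: composable_def)
    from composable_assoc[OF c(1) this] show ?thesis using a by (auto simp: shift_def)
  qed
qed

text \<open>The exhaustive sets are the only difficulty: a path \<open>\<kappa>\<close> of the new
  filter need not be comparable with \<open>\<sigma>\<close>. It is extended to some
  \<open>\<sigma> \<cdot> \<mu> = \<kappa> \<cdot> \<delta>\<close> with \<open>\<mu>\<close> in
  \<open>Z\<close>, and \<open>E\<close> is replaced by \<open>Ext \<delta> E\<close>, which lives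
  at the source of \<open>\<mu>\<close>.\<close>

lemma boundary_filter_prepend:
  assumes fa: "finitely_aligned \<Lambda>" and s: "\<sigma> \<in> paths \<Lambda>" and Z: "boundary_filter (src \<Lambda> \<sigma>) Z"
  shows "boundary_filter (rng \<Lambda> \<sigma>) (prepend \<sigma> Z)"
  unfolding boundary_filter_def
proof (intro conjI ballI allI impI)
  note D = boundary_filterD[OF Z]
  have comp: "composable \<sigma> \<mu>" if "\<mu> \<in> Z" for \<mu>
    using D(2,3)[OF that] s by (simp add: composable_def)
  show "rng \<Lambda> \<sigma> \<in> prepend \<sigma> Z"
    using s D(1) comp unfolding prepend_def by (auto simp: cmp_src intro!: initial_rng bexI[of _ "src \<Lambda> \<sigma>"])
  show "prepend \<sigma> Z \<subseteq> paths_to \<Lambda> (rng \<Lambda> \<sigma>)"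
    by (auto simp: prepend_def paths_to_def initialD composableD(5) dest: initialD)
  show "\<mu> \<in> prepend \<sigma> Z" if "\<kappa> \<in> prepend \<sigma> Z" "\<mu> \<preceq> \<kappa>" for \<kappa> \<mu>
    using that initial_trans unfolding prepend_def by blast
  show "\<exists>\<kappa>\<in>prepend \<sigma> Z. \<mu> \<preceq> \<kappa> \<and> \<nu> \<preceq> \<kappa>" if mn: "\<mu> \<in> prepend \<sigma> Z" "\<nu> \<in> prepend \<sigma> Z" for \<mu> \<nu>
  proof -
    obtain \<mu>' \<nu>' where 1: "\<mu>' \<in> Z" "\<nu>' \<in> Z" "\<mu> \<preceq> \<sigma> \<cdot> \<mu>'" "\<nu> \<preceq> \<sigma> \<cdot> \<nu>'"
      using mn by (auto simp: prepend_def)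
    then obtain \<kappa> where k: "\<kappa> \<in> Z" "\<mu>' \<preceq> \<kappa>" "\<nu>' \<preceq> \<kappa>" using D(5) by blast
    then have "\<mu> \<preceq> \<sigma> \<cdot> \<kappa>" "\<nu> \<preceq> \<sigma> \<cdot> \<kappa>"
      using 1 comp initial_cmp_left initial_trans by meson+
    moreover have "\<sigma> \<cdot> \<kappa> \<in> prepend \<sigma> Z"
      using k comp composableD(4) initial_refl unfolding prepend_def by blast
    ultimately show ?thesis by blast
  qed
  show "\<exists>\<alpha>\<in>E. \<kappa> \<cdot> \<alpha> \<in> prepend \<sigma> Z" if k: "\<kappa> \<in> prepend \<sigma> Z" and E: "E \<in> FE \<Lambda> (src \<Lambda> \<kappa>)" for \<kappa> E
  proof -
    obtain \<mu> where m: "\<mu> \<in> Z" "\<kappa> \<preceq> \<sigma> \<cdot> \<mu>" using k by (auto simp: prepend_def)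
    then obtain \<delta> where dl: "composable \<kappa> \<delta>" "\<sigma> \<cdot> \<mu> = \<kappa> \<cdot> \<delta>" by (auto simp: initial_def)
    have "src \<Lambda> \<delta> = src \<Lambda> \<mu>" using dl m comp composableD(6) by metis
    moreover have "Ext \<delta> E \<in> FE \<Lambda> (src \<Lambda> \<delta>)"
      using Ext_FE[OF fa] dl E composableD by metis
    ultimately obtain \<alpha> where a: "\<alpha> \<in> Ext \<delta> E" "\<mu> \<cdot> \<alpha> \<in> Z" using D(6) m by metis
    then obtain \<epsilon> where e: "composable \<delta> \<alpha>" "\<epsilon> \<in> E" "\<epsilon> \<preceq> \<delta> \<cdot> \<alpha>"
      by (auto simp: Ext_def MCE_iff)
    have ma: "composable \<mu> \<alpha>" "composable \<kappa> \<epsilon>"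
      using e(1) \<open>src \<Lambda> \<delta> = src \<Lambda> \<mu>\<close> D(2)[OF m(1)] FE_D[OF E e(2)] dl(1) by (auto simp: composable_def)
    have "\<kappa> \<cdot> \<epsilon> \<preceq> \<kappa> \<cdot> (\<delta> \<cdot> \<alpha>)"
      using initial_cmp_left ma e by blast
    also have "\<kappa> \<cdot> (\<delta> \<cdot> \<alpha>) = \<sigma> \<cdot> (\<mu> \<cdot> \<alpha>)"
      using composable_assoc dl e(1) ma comp m(1) by metis
    finally show ?thesis
      using a comp e(2) unfolding prepend_def by blast
  qed
qed

lemma prepend_shift:
  assumes Y: "boundary_filter v Y" and s: "\<sigma> \<in> Y" shows "prepend \<sigma> (shift \<sigma> Y) = Y"
proof
  show "prepend \<sigma> (shift \<sigma> Y) \<subseteq> Y"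
    using boundary_filterD(4)[OF Y] by (auto simp: prepend_def shift_def)
  show "Y \<subseteq> prepend \<sigma> (shift \<sigma> Y)"
  proof
    fix \<kappa> assume "\<kappa> \<in> Y"
    then obtain \<omega> where w: "\<omega> \<in> Y" "\<kappa> \<preceq> \<omega>" "\<sigma> \<preceq> \<omega>" using boundary_filterD(5)[OF Y] s by blast
    then obtain \<mu> where "composable \<sigma> \<mu>" "\<omega> = \<sigma> \<cdot> \<mu>" by (auto simp: initial_def)
    then show "\<kappa> \<in> prepend \<sigma> (shift \<sigma> Y)" using w by (auto simp: prepend_def shift_def)
  qed
qed

lemma shift_prepend:
  assumes s: "\<sigma> \<in> paths \<Lambda>" and Z: "boundary_filter (src \<Lambda> \<sigma>) Z"
  shows "shift \<sigma> (prepend \<sigma> Z) = Z"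
proof -
  have comp: "composable \<sigma> \<mu>" if "\<mu> \<in> Z" for \<mu>
    using boundary_filterD(2,3)[OF Z that] s by (simp add: composable_def)
  have "\<mu> \<in> shift \<sigma> (prepend \<sigma> Z) \<longleftrightarrow> \<mu> \<in> Z" for \<mu>
  proof
    assume "\<mu> \<in> shift \<sigma> (prepend \<sigma> Z)"
    then obtain \<nu> where "composable \<sigma> \<mu>" "composable \<sigma> \<nu>" "\<nu> \<in> Z" "\<sigma> \<cdot> \<mu> \<preceq> \<sigma> \<cdot> \<nu>"
      by (auto simp: shift_def prepend_def)
    then show "\<mu> \<in> Z"
      using initial_cmp_cancel boundary_filterD(4)[OF Z] by blast
  next
    assume "\<mu> \<in> Z"
    then show "\<mu> \<in> shift \<sigma> (prepend \<sigma> Z)"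
      using comp composableD(4) initial_refl unfolding shift_def prepend_def by blast
  qed
  then show ?thesis by blast
qed

lemma mem_prepend:
  assumes "\<sigma> \<in> paths \<Lambda>" "boundary_filter (src \<Lambda> \<sigma>) Z" shows "\<sigma> \<in> prepend \<sigma> Z"
  using assms boundary_filterD(1)[OF assms(2)]
  by (auto simp: prepend_def cmp_src composable_src initial_refl intro!: bexI[of _ "src \<Lambda> \<sigma>"])

lemma shift_shift:
  assumes "composable \<mu> \<nu>" shows "shift \<nu> (shift \<mu> Y) = shift (\<mu> \<cdot> \<nu>) Y"
  unfolding shift_def using assms composable_assoc composable_cmp_left composable_cmp_right
  by (metis (no_types, lifting) mem_Collect_eq)

lemma shift_vertex:
  assumes "boundary_filter v Y" shows "shift v Y = Y"
proof -
  note v = vertexD[OF boundary_filter_vertex[OF assms]]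
  have "v \<cdot> \<mu> = \<mu>" if "composable v \<mu>" for \<mu>
    using that v(3) cmp_rng by (metis composable_def)
  moreover have "composable v \<mu>" if "\<mu> \<in> Y" for \<mu>
    using boundary_filterD(2,3)[OF assms that] v by (simp add: composable_def)
  ultimately show ?thesis by (auto simp: shift_def)
qed

text \<open>
  The filter is generated by an increasing sequence of paths along which every finite
  exhaustive set at every vertex passed is met: a bookkeeping enumeration treats each such set
  infinitely often, and \<open>Ext_FE\<close> moves it to the source of the path constructed so far.
\<close>

lemma boundary_filter_exists:
  assumes fa: "finitely_aligned \<Lambda>" and w: "w \<in> vertices \<Lambda>" and Pw: "P w"
    and P: "\<And>u E. P u \<Longrightarrow> u \<in> vertices \<Lambda> \<Longrightarrow> E \<in> FE \<Lambda> u \<Longrightarrow> \<exists>\<alpha>\<in>E. P (src \<Lambda> \<alpha>)"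
  obtains Y where "boundary_filter w Y" "\<And>\<mu>. \<mu> \<in> Y \<Longrightarrow> \<exists>\<kappa>\<in>Y. \<mu> \<preceq> \<kappa> \<and> P (src \<Lambda> \<kappa>)"
proof -
  define T where "T = {(\<mu>, E). \<mu> \<in> paths \<Lambda> \<and> E \<in> FE \<Lambda> (src \<Lambda> \<mu>)}"
  have "T \<subseteq> paths \<Lambda> \<times> {E. finite E \<and> E \<subseteq> paths \<Lambda>}"
    by (auto simp: T_def FE_iff)
  then have cT: "countable T"
    by (rule countable_subset)
      (intro countable_SIGMA countable_paths countable_Collect_finite_subset)
  \<comment> \<open>Only the first component of the decoded pair selects the task; the second one is
    padding that makes every task recur at arbitrarily late stages.\<close>
  define task where "task i = from_nat_into T (fst (prod_decode i))" for i
  have step: "\<exists>\<tau>. \<sigma> \<preceq> \<tau> \<and> P (src \<Lambda> \<tau>) \<and> (\<mu> \<preceq> \<sigma> \<longrightarrow> (\<exists>\<epsilon>\<in>E. \<mu> \<cdot> \<epsilon> \<preceq> \<tau>))"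
    if s: "\<sigma> \<in> paths \<Lambda>" "P (src \<Lambda> \<sigma>)" and E: "(\<mu>, E) \<in> T" for \<sigma> \<mu> E
  proof (cases "\<mu> \<preceq> \<sigma>")
    case False
    then show ?thesis using s initial_refl by blast
  next
    case True
    then obtain \<delta> where dl: "composable \<mu> \<delta>" "\<sigma> = \<mu> \<cdot> \<delta>" by (auto simp: initial_def)
    then have "Ext \<delta> E \<in> FE \<Lambda> (src \<Lambda> \<sigma>)"
      using Ext_FE[OF fa, of \<delta> E] E composableD[OF dl(1)] by (simp add: T_def)
    then obtain \<alpha> where a: "\<alpha> \<in> Ext \<delta> E" "P (src \<Lambda> \<alpha>)" using P s src_vertex by blast
    then obtain \<epsilon> where e: "composable \<delta> \<alpha>" "\<epsilon> \<in> E" "\<epsilon> \<preceq> \<delta> \<cdot> \<alpha>"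
      by (auto simp: Ext_def MCE_iff)
    have "composable \<mu> \<epsilon>"
      using E e(2) FE_D by (auto simp: T_def composable_def)
    then have "\<mu> \<cdot> \<epsilon> \<preceq> \<mu> \<cdot> (\<delta> \<cdot> \<alpha>)" using e initial_cmp_left by blast
    then have "\<mu> \<cdot> \<epsilon> \<preceq> \<sigma> \<cdot> \<alpha>" "\<sigma> \<preceq> \<sigma> \<cdot> \<alpha>" "src \<Lambda> (\<sigma> \<cdot> \<alpha>) = src \<Lambda> \<alpha>"
      using composable_assoc[OF dl(1) e(1)] initial_cmp[of \<sigma> \<alpha>] composableD(6)[of \<sigma> \<alpha>]
      unfolding dl(2) by simp_all
    then show ?thesis using a(2) e(2) by metis
  qed
  \<comment> \<open>Since \<open>T\<close> is nonempty, \<open>from_nat_into\<close> lands in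
    \<open>T\<close> at every index.\<close>
  have wT: "(w, {w}) \<in> T"
    using w FE_singleton[OF w] vertexD[OF w] by (simp add: T_def)
  then have task: "task i \<in> T" for i
    unfolding task_def by (intro from_nat_into) auto
  have "\<exists>f. \<forall>n. (f n \<in> paths \<Lambda> \<and> rng \<Lambda> (f n) = w \<and> P (src \<Lambda> (f n))) \<and>
     (f n \<preceq> f (Suc n) \<and> (fst (task n) \<preceq> f n \<longrightarrow> (\<exists>\<epsilon>\<in>snd (task n). fst (task n) \<cdot> \<epsilon> \<preceq> f (Suc n))))"
  proof (rule dependent_nat_choice)
    show "\<exists>x. x \<in> paths \<Lambda> \<and> rng \<Lambda> x = w \<and> P (src \<Lambda> x)"
      using vertexD[OF w] Pw by metis
    fix x n assume x: "x \<in> paths \<Lambda> \<and> rng \<Lambda> x = w \<and> P (src \<Lambda> x)"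
    with step[of x "fst (task n)" "snd (task n)"] task[of n]
    obtain y where "x \<preceq> y" "P (src \<Lambda> y)"
      "fst (task n) \<preceq> x \<longrightarrow> (\<exists>\<epsilon>\<in>snd (task n). fst (task n) \<cdot> \<epsilon> \<preceq> y)" by auto
    with x show "\<exists>y. (y \<in> paths \<Lambda> \<and> rng \<Lambda> y = w \<and> P (src \<Lambda> y)) \<and>
       (x \<preceq> y \<and> (fst (task n) \<preceq> x \<longrightarrow> (\<exists>\<epsilon>\<in>snd (task n). fst (task n) \<cdot> \<epsilon> \<preceq> y)))"
      using initialD by metis
  qed
  then obtain f where f: "\<And>n. f n \<in> paths \<Lambda>" "\<And>n. rng \<Lambda> (f n) = w" "\<And>n. P (src \<Lambda> (f n))"
    "\<And>n. f n \<preceq> f (Suc n)"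
    "\<And>n. fst (task n) \<preceq> f n \<Longrightarrow> \<exists>\<epsilon>\<in>snd (task n). fst (task n) \<cdot> \<epsilon> \<preceq> f (Suc n)"
    by blast
  have mono: "f i \<preceq> f j" if "i \<le> j" for i j
    using that by (induction rule: dec_induct) (use f initial_refl initial_trans in blast)+
  define Y where "Y = {\<mu>. \<exists>i. \<mu> \<preceq> f i}"
  have fY: "f i \<in> Y" for i using f(1) initial_refl by (auto simp: Y_def)
  have "boundary_filter w Y"
    unfolding boundary_filter_def
  proof (intro conjI ballI allI impI)
    show "w \<in> Y" using initial_rng f(1,2) unfolding Y_def by (metis mem_Collect_eq)
    show "Y \<subseteq> paths_to \<Lambda> w" using f(2) initialD by (auto simp: Y_def paths_to_def)
    show "\<mu> \<in> Y" if "\<kappa> \<in> Y" "\<mu> \<preceq> \<kappa>" for \<kappa> \<mu>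
      using that initial_trans unfolding Y_def by blast
    show "\<exists>\<kappa>\<in>Y. \<mu> \<preceq> \<kappa> \<and> \<nu> \<preceq> \<kappa>" if mn: "\<mu> \<in> Y" "\<nu> \<in> Y" for \<mu> \<nu>
    proof -
      obtain i j where "\<mu> \<preceq> f i" "\<nu> \<preceq> f j" using mn by (auto simp: Y_def)
      then have "\<mu> \<preceq> f (max i j)" "\<nu> \<preceq> f (max i j)"
        using mono initial_trans by (meson max.cobounded1 max.cobounded2)+
      then show ?thesis using fY by blast
    qed
    show "\<exists>\<alpha>\<in>E. \<mu> \<cdot> \<alpha> \<in> Y" if m: "\<mu> \<in> Y" and E: "E \<in> FE \<Lambda> (src \<Lambda> \<mu>)" for \<mu> E
    proof -
      obtain i where i: "\<mu> \<preceq> f i" using m by (auto simp: Y_def)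
      have "(\<mu>, E) \<in> T" using E initialD[OF i] by (simp add: T_def)
      then obtain k where k: "from_nat_into T k = (\<mu>, E)"
        using from_nat_into_surj[OF cT] by blast
      \<comment> \<open>As \<open>prod_encode (k, i)\<close> is at least \<open>i\<close>, stage
        \<open>j\<close> comes after \<open>\<mu>\<close> has been passed.\<close>
      define j where "j = prod_encode (k, i)"
      have "task j = (\<mu>, E)" by (simp add: task_def j_def k)
      moreover have "\<mu> \<preceq> f j"
        using i mono[of i j] le_prod_encode_2 initial_trans by (auto simp: j_def)
      ultimately obtain \<epsilon> where "\<epsilon> \<in> E" "\<mu> \<cdot> \<epsilon> \<preceq> f (Suc j)" using f(5)[of j] by auto
      then show ?thesis by (auto simp: Y_def)
    qed
  qed
  moreover have "\<exists>\<kappa>\<in>Y. \<mu> \<preceq> \<kappa> \<and> P (src \<Lambda> \<kappa>)" if "\<mu> \<in> Y" for \<mu>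
    using that fY f(3) unfolding Y_def by blast
  ultimately show ?thesis using that by blast
qed

lemma boundary_filter_at_vertex:
  assumes "finitely_aligned \<Lambda>" "v \<in> vertices \<Lambda>" obtains Y where "boundary_filter v Y"
proof (rule boundary_filter_exists[OF assms, of "\<lambda>u. True"])
  show "\<exists>\<alpha>\<in>E. True" if "u \<in> vertices \<Lambda>" "E \<in> FE \<Lambda> u" for u E
    using FE_nonempty[OF that(2,1)] by blast
qed (use that in blast)+

text \<open>The saturation of the set of vertices reached from \<open>v\<close> consists of the
  vertices with a finite exhaustive set whose sources are all reached; \<open>P\<close> is its
  complement. By \<open>FE_bind\<close>, every finite exhaustive set at a vertex with
  \<open>P\<close> has a member whose source satisfies \<open>P\<close>, which is the hypothesis of
  \<open>boundary_filter_exists\<close>.\<close>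

lemma not_cofinal_boundary_filter:
  assumes fa: "finitely_aligned \<Lambda>" and "\<not> cofinal_kgraph \<Lambda>"
  obtains v w Y where "v \<in> vertices \<Lambda>" "boundary_filter w Y"
    "\<And>\<mu>. \<mu> \<in> Y \<Longrightarrow> paths_between \<Lambda> v (src \<Lambda> \<mu>) = {}"
proof -
  have "\<exists>v\<in>vertices \<Lambda>. \<exists>w\<in>vertices \<Lambda>. \<forall>E\<in>FE \<Lambda> w. \<exists>\<alpha>\<in>E. paths_between \<Lambda> v (src \<Lambda> \<alpha>) = {}"
    using assms(2) by (simp add: cofinal_kgraph_def)
  then obtain v w where vw: "v \<in> vertices \<Lambda>" "w \<in> vertices \<Lambda>"
    and E: "\<And>E. E \<in> FE \<Lambda> w \<Longrightarrow> \<exists>\<alpha>\<in>E. paths_between \<Lambda> v (src \<Lambda> \<alpha>) = {}"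
    by meson
  define P where "P u \<longleftrightarrow> (\<forall>E\<in>FE \<Lambda> u. \<exists>\<alpha>\<in>E. paths_between \<Lambda> v (src \<Lambda> \<alpha>) = {})" for u
  have step: "\<exists>\<alpha>\<in>E. P (src \<Lambda> \<alpha>)" if u: "P u" "u \<in> vertices \<Lambda>" "E \<in> FE \<Lambda> u" for u E
  proof (rule ccontr)
    assume "\<not> ?thesis"
    then have "\<forall>\<alpha>\<in>E. \<exists>F\<in>FE \<Lambda> (src \<Lambda> \<alpha>). \<forall>\<beta>\<in>F. paths_between \<Lambda> v (src \<Lambda> \<beta>) \<noteq> {}"
      by (simp add: P_def)
    from bchoice[OF this[unfolded Bex_def]]
    obtain F where F: "\<And>\<alpha>. \<alpha> \<in> E \<Longrightarrow> F \<alpha> \<in> FE \<Lambda> (src \<Lambda> \<alpha>)"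
      "\<And>\<alpha> \<beta>. \<alpha> \<in> E \<Longrightarrow> \<beta> \<in> F \<alpha> \<Longrightarrow> paths_between \<Lambda> v (src \<Lambda> \<beta>) \<noteq> {}" by blast
    from u(1)[unfolded P_def] FE_bind[OF u(3) F(1)]
    have "\<exists>\<rho>\<in>\<Union>\<alpha>\<in>E. (\<lambda>\<beta>. \<alpha> \<cdot> \<beta>) ` F \<alpha>. paths_between \<Lambda> v (src \<Lambda> \<rho>) = {}"
      by (rule bspec)
    then obtain \<alpha> \<beta> where ab: "\<alpha> \<in> E" "\<beta> \<in> F \<alpha>"
      "paths_between \<Lambda> v (src \<Lambda> (\<alpha> \<cdot> \<beta>)) = {}"
      by auto
    then have "composable \<alpha> \<beta>"
      using FE_D[OF u(3)] FE_D[OF F(1)] by (auto simp: composable_def)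
    then show False using ab F(2) composableD(6) by metis
  qed
  have "P w" using E by (simp add: P_def)
  then obtain Y where Y: "boundary_filter w Y" "\<And>\<mu>. \<mu> \<in> Y \<Longrightarrow> \<exists>\<kappa>\<in>Y. \<mu> \<preceq> \<kappa> \<and> P (src \<Lambda> \<kappa>)"
    using boundary_filter_exists[OF fa vw(2), of P] step by metis
  have "paths_between \<Lambda> v (src \<Lambda> \<mu>) = {}" if mY: "\<mu> \<in> Y" for \<mu>
  proof (rule ccontr)
    assume "paths_between \<Lambda> v (src \<Lambda> \<mu>) \<noteq> {}"
    then obtain \<beta> where b: "\<beta> \<in> paths \<Lambda>" "rng \<Lambda> \<beta> = v" "src \<Lambda> \<beta> = src \<Lambda> \<mu>"
      by (auto simp: paths_between_def)
    \<comment> \<open>Being reached from \<open>v\<close> is inherited by sources further along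
      \<open>Y\<close>, but \<open>P\<close> holds at some later source, where it forbids this for
      the exhaustive set consisting of the vertex alone.\<close>
    obtain \<kappa> where k: "\<kappa> \<in> Y" "\<mu> \<preceq> \<kappa>" "P (src \<Lambda> \<kappa>)" using Y(2)[OF mY] by meson
    then obtain \<alpha> where a: "composable \<mu> \<alpha>" "\<kappa> = \<mu> \<cdot> \<alpha>" by (auto simp: initial_def)
    then have "composable \<beta> \<alpha>" using b by (simp add: composable_def)
    then have "\<beta> \<cdot> \<alpha> \<in> paths_between \<Lambda> v (src \<Lambda> \<kappa>)"
      using a b composableD unfolding paths_between_def by auto
    moreover have kv: "src \<Lambda> \<kappa> \<in> vertices \<Lambda>" using k(2) initialD src_vertex by blast
    ultimately show False
      using k(3) FE_singleton[OF kv] vertexD(3)[OF kv] unfolding P_def by force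
  qed
  then show ?thesis using that vw Y by blast
qed

text \<open>The degree \<open>m\<close> is the supremum of the degrees in \<open>Y\<close>, possibly
  infinite and not attained. With \<open>y n\<close> the path of degree \<open>n\<close> in
  \<open>Y\<close>, the value \<open>x (p, q)\<close> is the tail by which \<open>y q\<close>
  extends \<open>y p\<close>.\<close>

lemma boundary_path_of_filter:
  assumes Y: "boundary_filter w Y"
  obtains m x where "(m, x) \<in> boundary_paths \<Lambda>"
    "\<And>n. emb n \<le> m \<Longrightarrow> \<exists>\<mu>\<in>Y. x (n, n) = src \<Lambda> \<mu>"
proof -
  note D = boundary_filterD[OF Y]
  define m where "m = (\<chi> i. SUP \<mu>\<in>Y. enat (d \<mu> $ i))"
  \<comment> \<open>The supremum is taken in each coordinate separately; directedness of
    \<open>Y\<close> and finiteness of the rank give one path that is large enough in all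
    coordinates.\<close>
  have upper: "\<exists>\<kappa>\<in>Y. \<forall>i\<in>I. n $ i \<le> d \<kappa> $ i"
    if "finite I" "\<And>i. enat (n $ i) \<le> m $ i" for I and n :: "nat^'k"
    using that(1)
  proof (induction I)
    case empty
    show ?case using D(1) by auto
  next
    case (insert j I)
    then obtain \<kappa> where k: "\<kappa> \<in> Y" "\<forall>i\<in>I. n $ i \<le> d \<kappa> $ i" by blast
    obtain \<mu> where mu: "\<mu> \<in> Y" "n $ j \<le> d \<mu> $ j"
    proof (cases "n $ j")
      case 0
      then show ?thesis using that D(1) by auto
    next
      case (Suc l)
      \<comment> \<open>The supremum may be infinite, so an element is extracted from the strict
        inequality for the predecessor.\<close>
      then have "enat l < (SUP \<mu>\<in>Y. enat (d \<mu> $ j))"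
        using \<open>enat (n $ j) \<le> m $ j\<close> by (simp add: m_def Suc_ile_eq)
      then show ?thesis using that Suc by (auto simp: less_SUP_iff)
    qed
    obtain \<omega> where "\<omega> \<in> Y" "\<kappa> \<preceq> \<omega>" "\<mu> \<preceq> \<omega>" using D(5) k mu by blast
    then show ?case
      using k mu initial_deg unfolding less_eq_vec_def
      by (metis insert_iff order.trans)
  qed
  have deg_iff: "emb n \<le> m \<longleftrightarrow> (\<exists>\<mu>\<in>Y. d \<mu> = n)" for n
  proof
    assume "emb n \<le> m"
    then obtain \<kappa> where "\<kappa> \<in> Y" "n \<le> d \<kappa>"
      using upper[of UNIV n] by (auto simp: emb_def less_eq_vec_def)
    then show "\<exists>\<mu>\<in>Y. d \<mu> = n" using initial_exists D(2,4) by metis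
  next
    assume "\<exists>\<mu>\<in>Y. d \<mu> = n"
    then show "emb n \<le> m" by (auto simp: emb_def m_def less_eq_vec_def intro: SUP_upper)
  qed
  define y where "y n = (SOME \<mu>. \<mu> \<in> Y \<and> d \<mu> = n)" for n
  have y: "y n \<in> Y" "d (y n) = n" if "emb n \<le> m" for n
    using someI_ex[of "\<lambda>\<mu>. \<mu> \<in> Y \<and> d \<mu> = n"] that deg_iff unfolding y_def by blast+
  have y_unique: "\<mu> = y (d \<mu>)" if "\<mu> \<in> Y" for \<mu>
    using boundary_filter_unique[OF Y] that y deg_iff by metis
  define x where "x = (\<lambda>(p, q). SOME \<alpha>. composable (y p) \<alpha> \<and> y q = y p \<cdot> \<alpha>)"
  have emb_mono: "emb p \<le> m" if "p \<le> q" "emb q \<le> m" for p q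
    using that unfolding emb_def less_eq_vec_def by (simp, meson enat_ord_simps(1) order.trans)
  have x: "composable (y p) (x (p, q))" "y q = y p \<cdot> x (p, q)" if "p \<le> q" "emb q \<le> m" for p q
  proof -
    have "y p \<preceq> y q"
      using boundary_filter_linear[OF Y] y that emb_mono by simp
    then show "composable (y p) (x (p, q))" "y q = y p \<cdot> x (p, q)"
      using someI_ex[of "\<lambda>\<alpha>. composable (y p) \<alpha> \<and> y q = y p \<cdot> \<alpha>"]
      unfolding initial_def x_def by auto
  qed
  have x_unique: "x (p, q) = \<alpha>" if "p \<le> q" "emb q \<le> m" "composable (y p) \<alpha>" "y q = y p \<cdot> \<alpha>" for p q \<alpha>
    using x[OF that(1,2)] that cmp_left_cancel by metis
  have xpp: "x (p, p) = src \<Lambda> (y p)" if "emb p \<le> m" for p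
    using x_unique[of p p] that y D(2) composable_src cmp_src by auto
  have xpaths: "x (p, q) \<in> paths \<Lambda>" "rng \<Lambda> (x (p, q)) = x (p, p)" "src \<Lambda> (x (p, q)) = x (q, q)"
    "d (x (p, q)) = q - p" if "p \<le> q" "emb q \<le> m" for p q
  proof -
    note xx = x[OF that] and pm = emb_mono[OF that]
    show "x (p, q) \<in> paths \<Lambda>" "rng \<Lambda> (x (p, q)) = x (p, p)" "src \<Lambda> (x (p, q)) = x (q, q)"
      using xpp that pm composableD[OF xx(1)] xx(2) by auto
    have "q = p + d (x (p, q))"
      using deg_comp[OF xx(1)] xx(2) y that pm by metis
    then show "d (x (p, q)) = q - p" by (metis add_diff_cancel_left')
  qed
  have xcomp: "x (p, l) = x (p, q) \<cdot> x (q, l)" if "p \<le> q" "q \<le> l" "emb l \<le> m" for p q l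
  proof (rule x_unique)
    have qm: "emb q \<le> m" using that emb_mono by blast
    note 1 = x[OF that(1) qm] and 2 = x[OF that(2,3)]
    have c: "composable (x (p, q)) (x (q, l))"
      using 1 2 composable_cmp_left by metis
    show "p \<le> l" "emb l \<le> m" using that by auto
    show "composable (y p) (x (p, q) \<cdot> x (q, l))" using 1 c composable_assoc by blast
    show "y l = y p \<cdot> x (p, q) \<cdot> x (q, l)" using 1 2 c composable_assoc by metis
  qed
  have "kgraph_morphism (Omega m) \<Lambda> x"
    unfolding kgraph_morphism_def
  proof (intro conjI ballI impI)
    fix \<mu> \<nu> assume "\<mu> \<in> paths (Omega m)" "\<nu> \<in> paths (Omega m)" "src (Omega m) \<mu> = rng (Omega m) \<nu>"
    then obtain p q l where "\<mu> = (p, q)" "\<nu> = (q, l)" "p \<le> q" "q \<le> l" "emb l \<le> m"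
      by (auto simp: Omega_def)
    then show "x (cmp (Omega m) \<mu> \<nu>) = x \<mu> \<cdot> x \<nu>"
      using xcomp[of p q l] by (simp add: Omega_def)
  qed (auto simp: Omega_def xpaths)
  moreover have "\<exists>p. emb p \<le> m - emb n \<and> x (n, n + p) \<in> E"
    if n: "emb n \<le> m" and E: "E \<in> FE \<Lambda> (x (n, n))" for n E
  proof -
    obtain \<alpha> where a: "\<alpha> \<in> E" "y n \<cdot> \<alpha> \<in> Y" using D(6) y[OF n] E xpp[OF n] by auto
    have c: "composable (y n) \<alpha>"
      using FE_D[OF E a(1)] xpp[OF n] D(2) y[OF n] by (auto simp: composable_def)
    define p where "p = d \<alpha>"
    have dn: "d (y n \<cdot> \<alpha>) = n + p" using c deg_comp y[OF n] by (simp add: p_def)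
    then have np: "emb (n + p) \<le> m" using deg_iff a(2) by blast
    have "n \<le> n + p" by (auto simp: vec_nat_le_iff_add)
    moreover have "y (n + p) = y n \<cdot> \<alpha>" using y_unique[OF a(2)] dn by simp
    ultimately have "x (n, n + p) = \<alpha>" using x_unique np c by blast
    moreover have "emb p \<le> m - emb n"
      unfolding less_eq_vec_def
    proof
      fix i
      have "enat (n $ i + p $ i) \<le> m $ i" using np by (auto simp: emb_def less_eq_vec_def)
      then show "emb p $ i \<le> (m - emb n) $ i" by (cases "m $ i") (auto simp: emb_def)
    qed
    ultimately show ?thesis using a(1) by blast
  qed
  ultimately have "(m, x) \<in> boundary_paths \<Lambda>" by (auto simp: boundary_paths_def)
  then show ?thesis using that xpp y by metis
qed

text \<open>A boundary path has to pass through the exhaustive set that cofinality provides at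
  \<open>x(0)\<close>; conversely, failure of cofinality yields a boundary path that avoids
  everything reached from \<open>v\<close>.\<close>

lemma cofinal_iff_boundary_paths:
  assumes fa: "finitely_aligned \<Lambda>"
  shows "cofinal_kgraph \<Lambda> \<longleftrightarrow> (\<forall>v\<in>vertices \<Lambda>. \<forall>(m, x)\<in>boundary_paths \<Lambda>.
      \<exists>n. emb n \<le> m \<and> paths_between \<Lambda> v (x (n, n)) \<noteq> {})" (is "?L \<longleftrightarrow> ?R")
proof
  assume L: ?L
  have "\<exists>n. emb n \<le> m \<and> paths_between \<Lambda> v (x (n, n)) \<noteq> {}"
    if v: "v \<in> vertices \<Lambda>" and b: "(m, x) \<in> boundary_paths \<Lambda>" for v m x
  proof -
    have m: "kgraph_morphism (Omega m) \<Lambda> x" using b by (simp add: boundary_paths_def)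
    have z: "emb 0 \<le> m" "m - emb 0 = m"
      by (auto simp: emb_def less_eq_vec_def vec_eq_iff zero_enat_def[symmetric])
    have pm: "x (p, q) \<in> paths \<Lambda>" "src \<Lambda> (x (p, q)) = x (q, q)" "d (x (p, q)) = q - p"
      if "p \<le> q" "emb q \<le> m" for p q
    proof -
      have "(p, q) \<in> paths (Omega m)" using that by (simp add: Omega_def)
      with m have "x (p, q) \<in> paths \<Lambda> \<and> d (x (p, q)) = deg (Omega m) (p, q) \<and>
          src \<Lambda> (x (p, q)) = x (src (Omega m) (p, q))"
        unfolding kgraph_morphism_def by blast
      then show "x (p, q) \<in> paths \<Lambda>" "src \<Lambda> (x (p, q)) = x (q, q)" "d (x (p, q)) = q - p"
        by (simp_all add: Omega_def)
    qed
    have "x (0, 0) \<in> vertices \<Lambda>"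
      using pm[of 0 0] z by (simp add: vertices_def)
    then obtain E where E: "E \<in> FE \<Lambda> (x (0, 0))" "\<forall>\<alpha>\<in>E. paths_between \<Lambda> v (src \<Lambda> \<alpha>) \<noteq> {}"
      using L v unfolding cofinal_kgraph_def by meson
    then obtain p where p: "emb p \<le> m" "x (0, p) \<in> E"
    proof -
      have "\<forall>n. emb n \<le> m \<longrightarrow> (\<forall>E\<in>FE \<Lambda> (x (n, n)). \<exists>p. emb p \<le> m - emb n \<and> x (n, n + p) \<in> E)"
        using b by (simp add: boundary_paths_def)
      from this[rule_format, OF z(1) E(1)] show ?thesis using that z(2) by auto
    qed
    then show ?thesis using E(2) pm[of 0 p] by auto
  qed
  then show ?R by blast
next
  assume R: ?R
  show ?L
  proof (rule ccontr)
    assume "\<not> ?L"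
    then obtain v w Y where Y: "v \<in> vertices \<Lambda>" "boundary_filter w Y"
      "\<And>\<mu>. \<mu> \<in> Y \<Longrightarrow> paths_between \<Lambda> v (src \<Lambda> \<mu>) = {}"
      using not_cofinal_boundary_filter[OF fa] by metis
    obtain m x where "(m, x) \<in> boundary_paths \<Lambda>"
      "\<And>n. emb n \<le> m \<Longrightarrow> \<exists>\<mu>\<in>Y. x (n, n) = src \<Lambda> \<mu>"
      using boundary_path_of_filter[OF Y(2)] by metis
    then show False using R Y(1,3) by force
  qed
qed

end

context kgraph
begin

section \<open>Finite sets of paths closed under transport along minimal common extensions\<close>

text \<open>The product of the spanning elements for \<open>(\<mu>, \<nu>)\<close> and
  \<open>(\<sigma>, \<rho>)\<close> contains the one for
  \<open>(\<mu> \<cdot> \<alpha>, \<rho> \<cdot> \<beta>)\<close> whenever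
  \<open>\<nu> \<cdot> \<alpha> = \<sigma> \<cdot> \<beta>\<close> is a minimal common extension.
  The rule moves the tail \<open>\<alpha>\<close> from \<open>\<nu>\<close> to \<open>\<mu>\<close>
  accordingly; for \<open>\<mu> = \<nu>\<close> it is closure under minimal common
  extensions.\<close>

inductive_set transport_closure :: "'l set \<Rightarrow> 'l set" for E :: "'l set" where
  base: "\<sigma> \<in> E \<Longrightarrow> \<sigma> \<in> transport_closure E"
| transport: "\<mu> \<in> transport_closure E \<Longrightarrow> \<nu> \<in> transport_closure E \<Longrightarrow> \<sigma> \<in> transport_closure E \<Longrightarrow>
    d \<mu> = d \<nu> \<Longrightarrow> src \<Lambda> \<mu> = src \<Lambda> \<nu> \<Longrightarrow> composable \<nu> \<alpha> \<Longrightarrow> \<nu> \<cdot> \<alpha> \<in> MCE \<Lambda> \<nu> \<sigma> \<Longrightarrow>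
    \<mu> \<cdot> \<alpha> \<in> transport_closure E"

lemma transport_closure_paths:
  assumes "E \<subseteq> paths \<Lambda>" shows "transport_closure E \<subseteq> paths \<Lambda>"
proof
  fix \<sigma> assume "\<sigma> \<in> transport_closure E"
  then show "\<sigma> \<in> paths \<Lambda>"
    by induction (use assms in \<open>auto simp: composable_def cmp_closed\<close>)
qed

lemma transport_closure_MCE:
  assumes "E \<subseteq> paths \<Lambda>" "\<mu> \<in> transport_closure E" "\<nu> \<in> transport_closure E" "\<kappa> \<in> MCE \<Lambda> \<mu> \<nu>"
  shows "\<kappa> \<in> transport_closure E"
proof -
  obtain \<alpha> where "composable \<mu> \<alpha>" "\<kappa> = \<mu> \<cdot> \<alpha>" using assms(4) by (auto simp: MCE_iff initial_def)
  then show ?thesis using assms transport_closure.transport[of \<mu> E \<mu> \<nu> \<alpha>] by simp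
qed

text \<open>A path is a minimal common extension of itself with each of its prefixes, so transport
  applies to any tail that stays inside the closure.\<close>

lemma transport_closure_extend:
  assumes "\<mu> \<in> transport_closure E" "\<nu> \<in> transport_closure E" "d \<mu> = d \<nu>" "src \<Lambda> \<mu> = src \<Lambda> \<nu>"
    "composable \<nu> \<alpha>" "\<nu> \<cdot> \<alpha> \<in> transport_closure E"
  shows "\<mu> \<cdot> \<alpha> \<in> transport_closure E"
proof -
  have "\<nu> \<preceq> \<nu> \<cdot> \<alpha>" "\<nu> \<cdot> \<alpha> \<preceq> \<nu> \<cdot> \<alpha>"
    using assms(5) initial_cmp initial_refl composableD(4) by auto
  moreover have "vjoin (d \<nu>) (d (\<nu> \<cdot> \<alpha>)) = d (\<nu> \<cdot> \<alpha>)"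
    using calculation(1) initial_deg vjoin_absorb by blast
  ultimately have "\<nu> \<cdot> \<alpha> \<in> MCE \<Lambda> \<nu> (\<nu> \<cdot> \<alpha>)"
    by (simp add: MCE_iff)
  then show ?thesis using transport_closure.transport[OF assms(1,2,6,3,4,5)] by simp
qed

text \<open>Transport keeps the degree of a minimal common extension, which is the join of two
  degrees; hence an upper bound for the degrees in \<open>E\<close> persists.\<close>

lemma transport_closure_deg_bounded:
  assumes "finite E" "E \<subseteq> paths \<Lambda>"
  obtains N where "\<And>\<sigma>. \<sigma> \<in> transport_closure E \<Longrightarrow> d \<sigma> \<le> N"
proof -
  have "\<exists>N. \<forall>\<sigma>\<in>E. d \<sigma> \<le> N"
    using assms(1)
  proof (induction E)
    case (insert \<sigma> E)
    then obtain N where "\<forall>\<sigma>\<in>E. d \<sigma> \<le> N" by blast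
    then have "\<forall>\<tau>\<in>insert \<sigma> E. d \<tau> \<le> vjoin (d \<sigma>) N"
      using vjoin_ge order.trans by (metis insert_iff)
    then show ?case by blast
  qed simp
  then obtain N where N: "\<forall>\<sigma>\<in>E. d \<sigma> \<le> N" by blast
  have "d \<sigma> \<le> N" if "\<sigma> \<in> transport_closure E" for \<sigma>
    using that
  proof induction
    case (transport \<mu> \<nu> \<sigma> \<alpha>)
    have "composable \<mu> \<alpha>"
      using transport transport_closure_paths[OF assms(2)] by (auto simp: composable_def)
    then have "d (\<mu> \<cdot> \<alpha>) = d (\<nu> \<cdot> \<alpha>)"
      using transport deg_comp by metis
    then show ?case using transport by (simp add: MCE_iff vjoin_le_iff)
  qed (use N in blast)
  then show ?thesis using that by blast
qed

lemma finite_tails: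
  assumes "finite K" shows "finite {\<alpha>. composable \<nu> \<alpha> \<and> \<nu> \<cdot> \<alpha> \<in> K}"
proof (rule finite_imageD)
  show "finite ((\<lambda>\<alpha>. \<nu> \<cdot> \<alpha>) ` {\<alpha>. composable \<nu> \<alpha> \<and> \<nu> \<cdot> \<alpha> \<in> K})"
    by (rule finite_subset[OF _ assms]) auto
  show "inj_on (\<lambda>\<alpha>. \<nu> \<cdot> \<alpha>) {\<alpha>. composable \<nu> \<alpha> \<and> \<nu> \<cdot> \<alpha> \<in> K}"
    using cmp_left_cancel by (auto simp: inj_on_def)
qed

text \<open>
  Induction on the degree \<open>n\<close>: the elements of degree \<open>n\<close> come from those of smaller degree
  through a finite set \<open>K\<close> of minimal common extensions and at most one further transport, because
  two successive transports of an element outside \<open>K\<close> compose to a single one of degree \<open>< n\<close>.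
\<close>

lemma finite_transport_closure_deg:
  assumes fa: "finitely_aligned \<Lambda>" and E: "finite E" "E \<subseteq> paths \<Lambda>"
  shows "finite {\<sigma> \<in> transport_closure E. d \<sigma> = n}"
proof (induction "vsum n" arbitrary: n rule: less_induct)
  case less
  let ?G = "transport_closure E"
  note G = subsetD[OF transport_closure_paths[OF E(2)]]
  define L where "L = {\<sigma> \<in> ?G. d \<sigma> \<le> n \<and> d \<sigma> \<noteq> n}"
  have "L = (\<Union>m\<in>{m. m \<le> n} - {n}. {\<sigma> \<in> ?G. d \<sigma> = m})" by (auto simp: L_def)
  then have fL: "finite L"
    using less vsum_strict_mono finite_vec_nat_atMost[of n] by auto
  define tails where "tails \<nu> K = {\<alpha>. composable \<nu> \<alpha> \<and> \<nu> \<cdot> \<alpha> \<in> K}" for \<nu> K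
  have ft: "finite (tails \<nu> K)" if "finite K" for \<nu> K
    using finite_tails that by (simp add: tails_def)
  \<comment> \<open>Paths of degree \<open>n\<close> that arise without help from others of degree
    \<open>n\<close>: members of \<open>E\<close>, and transports along extensions of two paths of
    smaller degree.\<close>
  define K where "K = {\<sigma> \<in> E. d \<sigma> = n} \<union>
    (\<Union>\<mu>\<in>L. \<Union>\<nu>\<in>L. \<Union>\<sigma>\<in>L. (\<lambda>\<alpha>. \<mu> \<cdot> \<alpha>) ` tails \<nu> (MCE \<Lambda> \<nu> \<sigma>))"
  have MCE_fin: "finite (MCE \<Lambda> \<nu> \<sigma>)" if "\<nu> \<in> L" "\<sigma> \<in> L" for \<nu> \<sigma>
    using fa G that by (simp add: finitely_aligned_def L_def)
  have fK: "finite K"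
    using E(1) fL MCE_fin ft by (auto simp: K_def)
  define T where "T = K \<union> (\<Union>\<mu>\<in>L. \<Union>\<nu>\<in>{\<nu>\<in>L. d \<mu> = d \<nu> \<and> src \<Lambda> \<mu> = src \<Lambda> \<nu>}. (\<lambda>\<alpha>. \<mu> \<cdot> \<alpha>) ` tails \<nu> K)"
  have fT: "finite T"
    using fK fL ft by (auto simp: T_def)
  have "\<sigma> \<in> T" if "\<sigma> \<in> ?G" "d \<sigma> = n" for \<sigma>
    using that
  proof (induction)
    case (base \<sigma>)
    then show ?case by (simp add: T_def K_def)
  next
    case (transport \<mu> \<nu> \<sigma> \<alpha>)
    have ma: "composable \<mu> \<alpha>"
      using transport G by (auto simp: composable_def)
    have dn: "d (\<nu> \<cdot> \<alpha>) = n"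
      using transport ma deg_comp by metis
    have le: "d \<nu> \<le> n" "d \<sigma> \<le> n"
      using transport(7) dn vjoin_ge by (auto simp: MCE_iff)
    show ?case
    proof (cases "d \<nu> = n")
      case True
      then have "d \<alpha> = 0"
        using dn deg_comp[OF transport(6)] by (simp add: vec_eq_iff)
      then have "\<mu> \<cdot> \<alpha> = \<mu>"
        using ma deg_zero_iff composableD(1-3)[OF ma] cmp_src by metis
      then show ?thesis using transport True by simp
    next
      case False
      then have L: "\<mu> \<in> L" "\<nu> \<in> L" using transport le by (auto simp: L_def)
      show ?thesis
      proof (cases "d \<sigma> = n")
        case False
        then have "\<sigma> \<in> L" using transport le by (auto simp: L_def)
        then have "\<mu> \<cdot> \<alpha> \<in> K" using L transport(6,7) unfolding K_def tails_def by blast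
        then show ?thesis by (simp add: T_def)
      next
        case True
        \<comment> \<open>\<open>\<sigma>\<close> is a prefix of the minimal common extension
          \<open>\<nu> \<cdot> \<alpha>\<close> and already has its degree.\<close>
        have \<sigma>: "\<sigma> = \<nu> \<cdot> \<alpha>"
          using transport(7) True dn initial_unique initial_refl composableD(4)[OF transport(6)]
          unfolding MCE_iff by metis
        have "\<sigma> \<in> T" using transport True by blast
        then consider "\<sigma> \<in> K" | \<mu>0 \<nu>0 \<alpha>0 where "\<mu>0 \<in> L" "\<nu>0 \<in> L" "d \<mu>0 = d \<nu>0" "src \<Lambda> \<mu>0 = src \<Lambda> \<nu>0"
          "composable \<nu>0 \<alpha>0" "\<nu>0 \<cdot> \<alpha>0 \<in> K" "\<sigma> = \<mu>0 \<cdot> \<alpha>0"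
          by (auto simp: T_def tails_def)
        then show ?thesis
        proof cases
          case 1
          then have "\<alpha> \<in> tails \<nu> K" using \<sigma> transport(6) by (simp add: tails_def)
          then show ?thesis using L transport(4,5) unfolding T_def by blast
        next
          case 2
          have c0: "composable \<mu>0 \<alpha>0"
            using 2 G by (auto simp: composable_def L_def)
          then have "\<mu>0 \<preceq> \<sigma>" "\<nu> \<preceq> \<sigma>" using 2(7) \<sigma> transport(6) initial_cmp by metis+
          \<comment> \<open>Both \<open>\<mu>0\<close> and \<open>\<nu>\<close> begin
            \<open>\<sigma>\<close>. Cutting \<open>\<sigma>\<close> at their minimal common
            extension \<open>\<rho>\<close> leaves one tail \<open>\<eta>\<close>, and the two
            transports combine to a single one that moves \<open>\<eta>\<close> from
            \<open>\<nu>0 \<cdot> \<delta>\<close> to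
            \<open>\<mu> \<cdot> \<delta>'\<close>.\<close>
          then obtain \<rho> where r: "\<rho> \<in> MCE \<Lambda> \<mu>0 \<nu>" "\<rho> \<preceq> \<sigma>" using MCE_initial by metis
          then obtain \<delta> \<delta>' \<eta> where dl: "composable \<mu>0 \<delta>" "\<rho> = \<mu>0 \<cdot> \<delta>" "composable \<nu> \<delta>'" "\<rho> = \<nu> \<cdot> \<delta>'"
            "composable \<rho> \<eta>" "\<sigma> = \<rho> \<cdot> \<eta>"
            by (auto simp: MCE_iff initial_def)
          have c: "composable \<delta> \<eta>" "composable \<delta>' \<eta>" using dl composable_cmp_left by metis+
          have a0: "\<alpha>0 = \<delta> \<cdot> \<eta>" "\<alpha> = \<delta>' \<cdot> \<eta>"
            using dl c 2 \<sigma> c0 transport(6) composable_assoc cmp_left_cancel by metis+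
          have r': "\<rho> \<in> MCE \<Lambda> \<nu> \<mu>0"
            using r(1) by (auto simp: MCE_iff vjoin_def max.commute)
          show ?thesis
          \<comment> \<open>If \<open>\<rho>\<close> exhausts \<open>\<sigma>\<close>, then
            \<open>\<sigma>\<close> is a minimal common extension of two paths in \<open>L\<close>
            and the result is in \<open>K\<close>; otherwise the new pair has degree below
            \<open>n\<close>.\<close>
          proof (cases "d \<rho> = n")
            case True
            then have "\<rho> = \<sigma>" using r(2) \<open>d \<sigma> = n\<close> initial_unique initial_refl initialD(2) by metis
            then have "\<alpha> \<in> tails \<nu> (MCE \<Lambda> \<nu> \<mu>0)" using r' \<sigma> transport(6) by (simp add: tails_def)
            then have "\<mu> \<cdot> \<alpha> \<in> K" using L 2 unfolding K_def by blast
            then show ?thesis by (simp add: T_def)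
          next
            case False
            have c': "composable \<nu>0 \<delta>" "composable \<mu> \<delta>'"
              using dl 2 transport L G by (auto simp: composable_def L_def)
            have "\<nu>0 \<cdot> \<delta> \<in> ?G"
              using transport_closure.transport[of \<nu>0 E \<mu>0 \<nu> \<delta>] 2 L dl r(1) by (simp add: L_def)
            moreover have "\<mu> \<cdot> \<delta>' \<in> ?G"
              using transport_closure.transport[of \<mu> E \<nu> \<mu>0 \<delta>'] 2 L dl r' transport(4,5) by (simp add: L_def)
            moreover have dd: "d (\<nu>0 \<cdot> \<delta>) = d \<rho>" "d (\<mu> \<cdot> \<delta>') = d \<rho>"
              using deg_comp c' dl 2(3) transport(4) by metis+
            moreover have "d \<rho> \<le> n" using r(2) initial_deg \<open>d \<sigma> = n\<close> by metis
            ultimately have L2: "\<nu>0 \<cdot> \<delta> \<in> L" "\<mu> \<cdot> \<delta>' \<in> L" using False by (auto simp: L_def)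
            have ss: "src \<Lambda> (\<mu> \<cdot> \<delta>') = src \<Lambda> (\<nu>0 \<cdot> \<delta>)"
              using c' dl composableD(6) by metis
            have "\<eta> \<in> tails (\<nu>0 \<cdot> \<delta>) K"
              using 2 a0 c c' composable_assoc by (simp add: tails_def)
            then have "(\<mu> \<cdot> \<delta>') \<cdot> \<eta> \<in> (\<Union>\<nu>\<in>{\<nu>\<in>L. d (\<mu> \<cdot> \<delta>') = d \<nu> \<and> src \<Lambda> (\<mu> \<cdot> \<delta>') = src \<Lambda> \<nu>}.
                (\<lambda>\<alpha>. (\<mu> \<cdot> \<delta>') \<cdot> \<alpha>) ` tails \<nu> K)"
              using L2 ss dd by (intro UN_I[of "\<nu>0 \<cdot> \<delta>"]) auto
            then have "(\<mu> \<cdot> \<delta>') \<cdot> \<eta> \<in> T" using L2 unfolding T_def by blast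
            then show ?thesis using a0 c c' composable_assoc by simp
          qed
        qed
      qed
    qed
  qed
  then have "{\<sigma> \<in> ?G. d \<sigma> = n} \<subseteq> T" by blast
  then show ?case using fT by (rule finite_subset)
qed

lemma finite_transport_closure:
  assumes "finitely_aligned \<Lambda>" "finite E" "E \<subseteq> paths \<Lambda>"
  shows "finite (transport_closure E)"
proof -
  obtain N where N: "\<And>\<sigma>. \<sigma> \<in> transport_closure E \<Longrightarrow> d \<sigma> \<le> N"
    using transport_closure_deg_bounded assms(2,3) by metis
  then have "transport_closure E = (\<Union>n\<in>{n. n \<le> N}. {\<sigma> \<in> transport_closure E. d \<sigma> = n})" by auto
  moreover have "finite \<dots>"
    using finite_vec_nat_atMost[of N] finite_transport_closure_deg[OF assms] by auto
  ultimately show ?thesis by simp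
qed

end

section \<open>C*-algebras on carrier sets\<close>

context cstar_algebra
begin

lemma carrier_complex_field [simp]: "carrier complex_field = UNIV"
  by (simp add: complex_field_def)

lemma smult_add: "a \<in> carrier A \<Longrightarrow> (z + w) \<odot> a = z \<odot> a \<oplus> w \<odot> a"
  using smult_l_distr[of z w a] by (simp add: complex_field_def)

lemma smult_add_right: "a \<in> carrier A \<Longrightarrow> b \<in> carrier A \<Longrightarrow> z \<odot> (a \<oplus> b) = z \<odot> a \<oplus> z \<odot> b"
  by (simp add: smult_r_distr)

lemma smult_smult [simp]: "a \<in> carrier A \<Longrightarrow> z \<odot> (w \<odot> a) = (z * w) \<odot> a"
  using smult_assoc1[of z w a] by (simp add: complex_field_def)

lemma smult_1 [simp]: "a \<in> carrier A \<Longrightarrow> (1::complex) \<odot> a = a"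
  using smult_one[of a] by (simp add: complex_field_def)

lemma smult_0 [simp]: "a \<in> carrier A \<Longrightarrow> (0::complex) \<odot> a = \<zero>"
  using smult_add[of a 0 0] M.add.l_cancel_one'[of "0 \<odot> a" "0 \<odot> a"] by simp

lemma smult_zero [simp]: "z \<odot> \<zero> = \<zero>"
  using smult_smult[of "\<zero>" z 0] by simp

lemma uminus_eq_smult: "a \<in> carrier A \<Longrightarrow> \<ominus> a = (-1) \<odot> a"
  using smult_add[of a 1 "-1"] M.minus_equality[of "(-1) \<odot> a" a] by (simp add: M.a_comm)

lemma minus_eq_smult: "a \<in> carrier A \<Longrightarrow> b \<in> carrier A \<Longrightarrow> a \<ominus> b = a \<oplus> (-1) \<odot> b"
  by (simp add: a_minus_def uminus_eq_smult)

lemma smult_collect [simp]: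
  "a \<in> carrier A \<Longrightarrow> z \<odot> a \<oplus> w \<odot> a = (z + w) \<odot> a"
  "a \<in> carrier A \<Longrightarrow> b \<in> carrier A \<Longrightarrow> z \<odot> a \<oplus> (w \<odot> a \<oplus> b) = (z + w) \<odot> a \<oplus> b"
  "a \<in> carrier A \<Longrightarrow> z \<odot> a \<oplus> a = (z + 1) \<odot> a"
  "a \<in> carrier A \<Longrightarrow> a \<oplus> z \<odot> a = (1 + z) \<odot> a"
  "a \<in> carrier A \<Longrightarrow> b \<in> carrier A \<Longrightarrow> z \<odot> a \<oplus> (a \<oplus> b) = (z + 1) \<odot> a \<oplus> b"
  "a \<in> carrier A \<Longrightarrow> b \<in> carrier A \<Longrightarrow> a \<oplus> (z \<odot> a \<oplus> b) = (1 + z) \<odot> a \<oplus> b"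
  using smult_add[of a z w] smult_add[of a z 1] smult_add[of a 1 z] M.a_assoc[of "z \<odot> a" "w \<odot> a" b]
    M.a_assoc[of "z \<odot> a" a b] M.a_assoc[of a "z \<odot> a" b] by simp_all

declare mult_closed [simp] star_closed [simp] star_star [simp] cnorm_nonneg [simp]

lemma mult_zero [simp]: "a \<in> carrier A \<Longrightarrow> a \<otimes> \<zero> = \<zero>" "a \<in> carrier A \<Longrightarrow> \<zero> \<otimes> a = \<zero>"
  using smult_mult_right[of a "\<zero>" 0] smult_mult_left[of "\<zero>" a 0] by simp_all

lemma star_zero [simp]: "star A \<zero> = \<zero>"
  using star_smult[of "\<zero>" 0] by simp

lemma cnorm_zero [simp]: "cnorm A \<zero> = 0"
  by (simp add: cnorm_eq_zero)

lemmas linear_simps = minus_eq_smult uminus_eq_smult smult_add_right distrib_left distrib_right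
  smult_mult_left smult_mult_right star_add star_smult star_mult

lemma minus_eq_zero_iff: "a \<in> carrier A \<Longrightarrow> b \<in> carrier A \<Longrightarrow> a \<ominus> b = \<zero> \<longleftrightarrow> a = b"
  using M.minus_equality[of a "\<ominus> b"] by (auto simp: a_minus_def M.r_neg)

lemma minus_cancel [simp]:
  "a \<in> carrier A \<Longrightarrow> b \<in> carrier A \<Longrightarrow> a \<ominus> b \<oplus> b = a"
  "a \<in> carrier A \<Longrightarrow> b \<in> carrier A \<Longrightarrow> b \<oplus> (a \<ominus> b) = a"
  "a \<in> carrier A \<Longrightarrow> b \<in> carrier A \<Longrightarrow> a \<ominus> (a \<ominus> b) = b"
  by (simp_all add: a_minus_def M.a_assoc M.l_neg M.minus_add M.r_neg1 M.a_lcomm[of b a] M.r_neg M.r_neg2)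

lemma minus_zero [simp]: "a \<in> carrier A \<Longrightarrow> a \<ominus> \<zero> = a"
  by (simp add: minus_eq_smult)

lemma smult_minus: "a \<in> carrier A \<Longrightarrow> b \<in> carrier A \<Longrightarrow> z \<odot> (a \<ominus> b) = z \<odot> a \<ominus> z \<odot> b"
  by (simp add: minus_eq_smult smult_add_right)

lemma add_minus_add_left:
  "a \<in> carrier A \<Longrightarrow> b \<in> carrier A \<Longrightarrow> c \<in> carrier A \<Longrightarrow> (c \<oplus> a) \<ominus> (c \<oplus> b) = a \<ominus> b"
  by (simp add: a_minus_def M.minus_add M.a_comm[of c a] M.a_assoc M.r_neg2 M.r_neg1)

lemma minus_mult_distrib:
  assumes "a \<in> carrier A" "b \<in> carrier A" "c \<in> carrier A"
  shows "(a \<ominus> b) \<otimes> c = a \<otimes> c \<ominus> b \<otimes> c" "c \<otimes> (a \<ominus> b) = c \<otimes> a \<ominus> c \<otimes> b"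
  using assms by (simp_all add: linear_simps)

lemma star_minus: "a \<in> carrier A \<Longrightarrow> b \<in> carrier A \<Longrightarrow> star A (a \<ominus> b) = star A a \<ominus> star A b"
  by (simp add: linear_simps)

lemma cnorm_minus_commute: "a \<in> carrier A \<Longrightarrow> b \<in> carrier A \<Longrightarrow> cnorm A (a \<ominus> b) = cnorm A (b \<ominus> a)"
proof -
  assume "a \<in> carrier A" "b \<in> carrier A"
  then have "a \<ominus> b = (-1) \<odot> (b \<ominus> a)" by (simp add: linear_simps M.a_comm)
  then show ?thesis using \<open>a \<in> carrier A\<close> \<open>b \<in> carrier A\<close> by (simp add: cnorm_smult)
qed

lemma cnorm_triangle_minus:
  assumes "a \<in> carrier A" "b \<in> carrier A" "c \<in> carrier A"
  shows "cnorm A (a \<ominus> c) \<le> cnorm A (a \<ominus> b) + cnorm A (b \<ominus> c)"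
proof -
  have "a \<ominus> c = (a \<ominus> b) \<oplus> (b \<ominus> c)"
    using assms by (simp add: a_minus_def M.a_assoc M.r_neg1)
  then show ?thesis using assms cnorm_triangle by simp
qed

lemma cnorm_le_minus_add: "a \<in> carrier A \<Longrightarrow> b \<in> carrier A \<Longrightarrow> cnorm A a \<le> cnorm A (a \<ominus> b) + cnorm A b"
  using cnorm_triangle[of "a \<ominus> b" b] by simp

lemma cnorm_star [simp]: assumes "a \<in> carrier A" shows "cnorm A (star A a) = cnorm A a"
proof -
  have le: "cnorm A a \<le> cnorm A (star A a)" if "a \<in> carrier A" for a
  proof (cases "cnorm A a = 0")
    case False
    have "(cnorm A a)\<^sup>2 \<le> cnorm A (star A a) * cnorm A a"
      using cstar_identity[OF that] cnorm_mult[of "star A a" a] that by simp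
    then show ?thesis using False that cnorm_nonneg[OF that]
      by (simp add: power2_eq_square mult_le_cancel_right)
  qed (use that in simp)
  show ?thesis using le[OF assms] le[of "star A a"] assms by simp
qed

lemma cnorm_square: "a \<in> carrier A \<Longrightarrow> star A a = a \<Longrightarrow> cnorm A (a \<otimes> a) = (cnorm A a)\<^sup>2"
  using cstar_identity[of a] by simp

lemma cnorm_projection_le_1:
  assumes "p \<in> carrier A" "p \<otimes> p = p" "star A p = p" shows "cnorm A p \<le> 1"
proof -
  have "cnorm A p * cnorm A p = cnorm A p * 1"
    using cnorm_square[of p] assms by (simp add: power2_eq_square)
  then show ?thesis by (metis mult_cancel_left order_refl zero_le_one)
qed

lemma cnorm_partial_isometry_le_1:
  assumes "a \<in> carrier A" "p \<in> carrier A" "star A a \<otimes> a = p" "p \<otimes> p = p" "star A p = p"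
  shows "cnorm A a \<le> 1"
proof -
  have "(cnorm A a)\<^sup>2 \<le> 1"
    using cstar_identity[of a] cnorm_projection_le_1[of p] assms by simp
  then show ?thesis by (simp add: power_le_one_iff abs_square_le_1)
qed

lemma cnorm_eq_zeroI:
  assumes "a \<in> carrier A" "r < 1" "cnorm A a \<le> r * cnorm A a" shows "a = \<zero>"
proof (rule ccontr)
  assume "a \<noteq> \<zero>"
  then have "cnorm A a > 0" using assms(1) cnorm_eq_zero cnorm_nonneg by (metis less_eq_real_def)
  then show False using assms by simp
qed

lemma cnorm_mult_mono:
  assumes "a \<in> carrier A" "b \<in> carrier A" "cnorm A a \<le> r" "cnorm A b \<le> s"
  shows "cnorm A (a \<otimes> b) \<le> r * s"
  using cnorm_mult[of a b] mult_mono'[of "cnorm A a" r "cnorm A b" s] assms by simp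

subsection \<open>Finite sums\<close>

lemma mult_finsum_left:
  assumes "f \<in> I \<rightarrow> carrier A" "c \<in> carrier A"
  shows "c \<otimes> finsum A f I = finsum A (\<lambda>i. c \<otimes> f i) I"
  using assms by (induction I rule: infinite_finite_induct) (auto simp: distrib_left Pi_iff)

lemma mult_finsum_right:
  assumes "f \<in> I \<rightarrow> carrier A" "c \<in> carrier A"
  shows "finsum A f I \<otimes> c = finsum A (\<lambda>i. f i \<otimes> c) I"
  using assms by (induction I rule: infinite_finite_induct) (auto simp: distrib_right Pi_iff)

lemma smult_finsum:
  assumes "f \<in> I \<rightarrow> carrier A"
  shows "z \<odot> finsum A f I = finsum A (\<lambda>i. z \<odot> f i) I"
  using assms by (induction I rule: infinite_finite_induct) (auto simp: smult_add_right Pi_iff)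

lemma cnorm_finsum_le:
  assumes "f \<in> I \<rightarrow> carrier A"
  shows "cnorm A (finsum A f I) \<le> (\<Sum>i\<in>I. cnorm A (f i))"
  using assms
proof (induction I rule: infinite_finite_induct)
  case (insert i I)
  then show ?case
    using cnorm_triangle[of "f i" "finsum A f I"] by (auto simp: Pi_iff)
qed auto

lemma finsum_smult_const:
  assumes "a \<in> carrier A" shows "finsum A (\<lambda>i. z i \<odot> a) I = (\<Sum>i\<in>I. z i) \<odot> a"
  using assms by (induction I rule: infinite_finite_induct) auto

subsection \<open>Subspaces, ideals and closures\<close>

sublocale N: Metric_space "carrier A" "cdist A"
  by (rule Metric_space_cdist)

lemma cdist_eq [simp]: "a \<in> carrier A \<Longrightarrow> b \<in> carrier A \<Longrightarrow> cdist A a b = cnorm A (a \<ominus> b)"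
  by (simp add: cdist_def)

lemma cnorm_zero_minus [simp]: "a \<in> carrier A \<Longrightarrow> cnorm A (\<zero> \<ominus> a) = cnorm A a"
  using cnorm_minus_commute[of "\<zero>" a] by simp

lemma closedin_norm_topology_iff:
  "closedin (norm_topology A) S \<longleftrightarrow> S \<subseteq> carrier A \<and>
     (\<forall>a\<in>carrier A. (\<forall>e>0. \<exists>b\<in>S. cnorm A (a \<ominus> b) < e) \<longrightarrow> a \<in> S)"
proof -
  have "disjnt S (N.mball a r) \<longleftrightarrow> (\<forall>b\<in>S. \<not> cnorm A (a \<ominus> b) < r)"
    if "S \<subseteq> carrier A" "a \<in> carrier A" for a r
    using that by (auto simp: disjnt_def subset_iff)
  then show ?thesis
    unfolding norm_topology_def N.closedin_metric by (metis (no_types, lifting) DiffI DiffD1 DiffD2)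
qed

definition linear_subspace :: "'a set \<Rightarrow> bool" where
  "linear_subspace S \<longleftrightarrow> S \<subseteq> carrier A \<and> \<zero> \<in> S \<and> (\<forall>a\<in>S. \<forall>b\<in>S. a \<oplus> b \<in> S) \<and> (\<forall>a\<in>S. \<forall>z. z \<odot> a \<in> S)"

lemma linear_subspaceD:
  assumes "linear_subspace S"
  shows "\<And>a. a \<in> S \<Longrightarrow> a \<in> carrier A" "\<zero> \<in> S" "\<And>a b. a \<in> S \<Longrightarrow> b \<in> S \<Longrightarrow> a \<oplus> b \<in> S"
    "\<And>a z. a \<in> S \<Longrightarrow> z \<odot> a \<in> S" "\<And>a b. a \<in> S \<Longrightarrow> b \<in> S \<Longrightarrow> a \<ominus> b \<in> S"
  using assms unfolding linear_subspace_def by (auto simp: minus_eq_smult subset_iff)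

lemma linear_subspace_finsum:
  assumes "linear_subspace S" "\<And>i. i \<in> I \<Longrightarrow> f i \<in> S" shows "finsum A f I \<in> S"
  using assms(2)
proof (induction I rule: infinite_finite_induct)
  case (insert i I)
  then have "f \<in> I \<rightarrow> carrier A" "f i \<in> carrier A" using linear_subspaceD(1)[OF assms(1)] by auto
  then show ?case using insert linear_subspaceD(3)[OF assms(1)] by simp
qed (auto simp: linear_subspaceD(2)[OF assms(1)])

lemma linear_subspace_additive_subgroup: "linear_subspace S \<Longrightarrow> additive_subgroup S A"
  unfolding additive_subgroup_def
  by (rule M.add.subgroupI)
    (auto simp: linear_subspaceD a_inv_def[symmetric] uminus_eq_smult simp flip: a_inv_def
      dest: linear_subspaceD(2))

lemma additive_subgroup_linear_subspace:
  assumes "additive_subgroup S A" "\<And>a z. a \<in> S \<Longrightarrow> z \<odot> a \<in> S" shows "linear_subspace S"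
  using assms additive_subgroup.a_subset[OF assms(1)] additive_subgroup.zero_closed[OF assms(1)]
    additive_subgroup.a_closed[OF assms(1)] by (simp add: linear_subspace_def)

text \<open>Closedness is left out: a kernel is such an ideal by algebra alone, and closing it up
  adds no projections, by \<open>projection_mem_ideal\<close>.\<close>

definition algebra_ideal :: "'a set \<Rightarrow> bool" where
  "algebra_ideal I \<longleftrightarrow> linear_subspace I \<and> (\<forall>a\<in>I. \<forall>b\<in>carrier A. a \<otimes> b \<in> I \<and> b \<otimes> a \<in> I)"

lemma algebra_idealD:
  assumes "algebra_ideal I"
  shows "linear_subspace I" "\<And>a b. a \<in> I \<Longrightarrow> b \<in> carrier A \<Longrightarrow> a \<otimes> b \<in> I"
    "\<And>a b. a \<in> I \<Longrightarrow> b \<in> carrier A \<Longrightarrow> b \<otimes> a \<in> I"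
  using assms by (auto simp: algebra_ideal_def)

lemma cstar_ideal_iff: "cstar_ideal I A \<longleftrightarrow> algebra_ideal I \<and> closedin (norm_topology A) I"
  unfolding cstar_ideal_def algebra_ideal_def
  using linear_subspace_additive_subgroup additive_subgroup_linear_subspace linear_subspaceD(4)
  by blast

lemma cstar_subalgebraI:
  assumes "linear_subspace S" "\<And>a. a \<in> S \<Longrightarrow> star A a \<in> S" "\<And>a b. a \<in> S \<Longrightarrow> b \<in> S \<Longrightarrow> a \<otimes> b \<in> S"
    "closedin (norm_topology A) S"
  shows "cstar_subalgebra S A"
  using assms linear_subspace_additive_subgroup linear_subspaceD(4)
  unfolding cstar_subalgebra_def by blast

definition norm_closure :: "'a set \<Rightarrow> 'a set" where
  "norm_closure S = {a \<in> carrier A. \<forall>e>0. \<exists>b\<in>S. cnorm A (a \<ominus> b) < e}"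

lemma norm_closureD:
  assumes "a \<in> norm_closure S" shows "a \<in> carrier A" "\<And>e. e > 0 \<Longrightarrow> \<exists>b\<in>S. cnorm A (a \<ominus> b) < e"
  using assms by (auto simp: norm_closure_def)

lemma norm_closure_subset: "S \<subseteq> carrier A \<Longrightarrow> S \<subseteq> norm_closure S"
  by (auto simp: norm_closure_def subset_iff intro!: bexI)
    (metis M.r_neg a_minus_def cnorm_zero)

lemma closedin_norm_closure:
  assumes "S \<subseteq> carrier A" shows "closedin (norm_topology A) (norm_closure S)"
  unfolding closedin_norm_topology_iff
proof (intro conjI ballI impI)
  fix a assume a: "a \<in> carrier A" "\<forall>e>0. \<exists>b\<in>norm_closure S. cnorm A (a \<ominus> b) < e"
  have "\<exists>c\<in>S. cnorm A (a \<ominus> c) < e" if "e > 0" for e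
  proof -
    have e2: "e / 2 > 0" using that by simp
    obtain b where b: "b \<in> norm_closure S" "cnorm A (a \<ominus> b) < e / 2" using a(2) e2 by blast
    then obtain c where c: "c \<in> S" "cnorm A (b \<ominus> c) < e / 2" using norm_closureD(2) e2 by blast
    then have "cnorm A (a \<ominus> c) < e"
      using cnorm_triangle_minus[of a b c] a(1) b norm_closureD(1)[OF b(1)] subsetD[OF assms c(1)] by simp
    then show ?thesis using c by blast
  qed
  then show "a \<in> norm_closure S" using a(1) by (simp add: norm_closure_def)
qed (auto simp: norm_closure_def)

lemma linear_subspace_norm_closure:
  assumes S: "linear_subspace S" shows "linear_subspace (norm_closure S)"
  unfolding linear_subspace_def
proof (intro conjI ballI allI)
  note D = linear_subspaceD[OF S]
  show "norm_closure S \<subseteq> carrier A" by (auto simp: norm_closure_def)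
  show "\<zero> \<in> norm_closure S" using norm_closure_subset[of S] D by blast
  fix a assume a: "a \<in> norm_closure S"
  note ac = norm_closureD[OF a]
  show "a \<oplus> b \<in> norm_closure S" if b: "b \<in> norm_closure S" for b
    unfolding norm_closure_def
  proof (intro CollectI conjI allI impI)
    note bc = norm_closureD[OF b]
    show "a \<oplus> b \<in> carrier A" using ac bc by simp
    fix e :: real assume "e > 0"
    then obtain a' b' where ab: "a' \<in> S" "cnorm A (a \<ominus> a') < e / 2" "b' \<in> S" "cnorm A (b \<ominus> b') < e / 2"
      using ac(2)[of "e/2"] bc(2)[of "e/2"] by auto
    have "(a \<oplus> b) \<ominus> (a' \<oplus> b') = (a \<ominus> a') \<oplus> (b \<ominus> b')"
      using ac(1) bc(1) ab D(1) by (simp add: linear_simps M.a_ac)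
    then have "cnorm A ((a \<oplus> b) \<ominus> (a' \<oplus> b')) < e"
      using cnorm_triangle[of "a \<ominus> a'" "b \<ominus> b'"] ac(1) bc(1) ab D(1) by simp
    then show "\<exists>c\<in>S. cnorm A (a \<oplus> b \<ominus> c) < e" using ab D(3) by blast
  qed
  fix z
  show "z \<odot> a \<in> norm_closure S"
    unfolding norm_closure_def
  proof (intro CollectI conjI allI impI)
    show "z \<odot> a \<in> carrier A" using ac by simp
    fix e :: real assume e: "e > 0"
    then have "e / (cmod z + 1) > 0" by (simp add: add_nonneg_pos)
    then obtain a' where a': "a' \<in> S" "cnorm A (a \<ominus> a') < e / (cmod z + 1)" using ac(2) by blast
    have "z \<odot> a \<ominus> z \<odot> a' = z \<odot> (a \<ominus> a')" using ac(1) a' D(1) by (simp add: linear_simps)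
    then have "cnorm A (z \<odot> a \<ominus> z \<odot> a') = cmod z * cnorm A (a \<ominus> a')"
      using ac(1) a' D(1) by (simp add: cnorm_smult)
    also have "\<dots> \<le> (cmod z + 1) * cnorm A (a \<ominus> a')"
      using ac(1) a' D(1) by (intro mult_right_mono) auto
    also have "\<dots> < e" using a'(2) by (simp add: pos_less_divide_eq mult.commute add_nonneg_pos)
    finally show "\<exists>c\<in>S. cnorm A (z \<odot> a \<ominus> c) < e" using a' D(4) by blast
  qed
qed

text \<open>Hypothesis \<open>m\<close> allows products in the closure of \<open>T\<close>, so that
  this lemma and its left-hand counterpart can be chained to multiply two limits.\<close>

lemma norm_closure_mult_right:
  assumes T: "T \<subseteq> carrier A" and a: "a \<in> norm_closure S" and b: "b \<in> carrier A" and S: "S \<subseteq> carrier A"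
    and m: "\<And>c. c \<in> S \<Longrightarrow> c \<otimes> b \<in> norm_closure T"
  shows "a \<otimes> b \<in> norm_closure T"
proof -
  have "\<exists>c\<in>norm_closure T. cnorm A (a \<otimes> b \<ominus> c) < e" if e: "e > 0" for e
  proof -
    \<comment> \<open>The summand 1 keeps the divisor positive when \<open>b\<close> is
      zero.\<close>
    have pos: "cnorm A b + 1 > 0" using b by (simp add: add_nonneg_pos)
    then obtain c where c: "c \<in> S" "cnorm A (a \<ominus> c) < e / (cnorm A b + 1)"
      using norm_closureD(2)[OF a, of "e / (cnorm A b + 1)"] e by auto
    note car = norm_closureD(1)[OF a] b subsetD[OF S c(1)]
    have "cnorm A (a \<otimes> b \<ominus> c \<otimes> b) \<le> cnorm A (a \<ominus> c) * cnorm A b"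
      using car cnorm_mult[of "a \<ominus> c" b] by (simp add: minus_mult_distrib)
    also have "\<dots> \<le> cnorm A (a \<ominus> c) * (cnorm A b + 1)"
      using car by (intro mult_left_mono) auto
    also have "\<dots> < e" using c(2) pos by (simp add: pos_less_divide_eq)
    finally show ?thesis using m c by blast
  qed
  then show ?thesis
    using closedin_norm_closure[OF T] norm_closureD(1)[OF a] b by (simp add: closedin_norm_topology_iff)
qed

lemma norm_closure_star:
  assumes S: "S \<subseteq> carrier A" and a: "a \<in> norm_closure S" and m: "\<And>c. c \<in> S \<Longrightarrow> star A c \<in> S"
  shows "star A a \<in> norm_closure S"
  unfolding norm_closure_def
proof (intro CollectI conjI allI impI)
  note ac = norm_closureD[OF a]
  show "star A a \<in> carrier A" using ac by simp
  fix e :: real assume "e > 0"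
  then obtain c where c: "c \<in> S" "cnorm A (a \<ominus> c) < e" using ac(2) by blast
  have "cnorm A (star A a \<ominus> star A c) = cnorm A (a \<ominus> c)"
    using ac(1) subsetD[OF S c(1)] star_minus[of a c] cnorm_star[of "a \<ominus> c"] by simp
  then have "cnorm A (star A a \<ominus> star A c) < e" using c by simp
  then show "\<exists>c\<in>S. cnorm A (star A a \<ominus> c) < e" using c m by blast
qed

lemma norm_closure_mult_left:
  assumes T: "T \<subseteq> carrier A" and a: "a \<in> norm_closure S" and b: "b \<in> carrier A" and S: "S \<subseteq> carrier A"
    and m: "\<And>c. c \<in> S \<Longrightarrow> b \<otimes> c \<in> norm_closure T"
  shows "b \<otimes> a \<in> norm_closure T"
proof -
  have "\<exists>c\<in>norm_closure T. cnorm A (b \<otimes> a \<ominus> c) < e" if e: "e > 0" for e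
  proof -
    have pos: "cnorm A b + 1 > 0" using b by (simp add: add_nonneg_pos)
    then obtain c where c: "c \<in> S" "cnorm A (a \<ominus> c) < e / (cnorm A b + 1)"
      using norm_closureD(2)[OF a, of "e / (cnorm A b + 1)"] e by auto
    note car = norm_closureD(1)[OF a] b subsetD[OF S c(1)]
    have "cnorm A (b \<otimes> a \<ominus> b \<otimes> c) \<le> cnorm A b * cnorm A (a \<ominus> c)"
      using car cnorm_mult[of b "a \<ominus> c"] by (simp add: minus_mult_distrib)
    also have "\<dots> \<le> (cnorm A b + 1) * cnorm A (a \<ominus> c)"
      using car by (intro mult_right_mono) auto
    also have "\<dots> < e" using c(2) pos by (simp add: pos_less_divide_eq mult.commute)
    finally show ?thesis using m c by blast
  qed
  then show ?thesis
    using closedin_norm_closure[OF T] norm_closureD(1)[OF a] b by (simp add: closedin_norm_topology_iff)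
qed

lemma cstar_ideal_norm_closure:
  assumes I: "algebra_ideal I" shows "cstar_ideal (norm_closure I) A"
proof -
  note D = algebra_idealD[OF I] and S = linear_subspaceD(1)[OF algebra_idealD(1)[OF I]]
  have sub: "I \<subseteq> carrier A" using S by blast
  have "a \<otimes> b \<in> norm_closure I" "b \<otimes> a \<in> norm_closure I" if "a \<in> norm_closure I" "b \<in> carrier A" for a b
    using norm_closure_mult_left[OF sub that sub] norm_closure_mult_right[OF sub that sub]
      subsetD[OF norm_closure_subset[OF sub]] D(2,3) that(2) by simp_all
  then show ?thesis
    unfolding cstar_ideal_iff algebra_ideal_def
    using linear_subspace_norm_closure[OF D(1)] closedin_norm_closure[OF sub] by simp
qed

lemma cstar_subalgebra_norm_closure:
  assumes S: "linear_subspace S" and star: "\<And>a. a \<in> S \<Longrightarrow> star A a \<in> S"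
    and mult: "\<And>a b. a \<in> S \<Longrightarrow> b \<in> S \<Longrightarrow> a \<otimes> b \<in> S"
  shows "cstar_subalgebra (norm_closure S) A"
proof (rule cstar_subalgebraI)
  have sub: "S \<subseteq> carrier A" using linear_subspaceD(1)[OF S] by blast
  note C = closedin_norm_closure[OF sub] norm_closure_subset[OF sub]
  show "linear_subspace (norm_closure S)" "closedin (norm_topology A) (norm_closure S)"
    using linear_subspace_norm_closure[OF S] C by auto
  show "star A a \<in> norm_closure S" if "a \<in> norm_closure S" for a
    using norm_closure_star[OF sub that star] .
  have "a \<otimes> b \<in> norm_closure S" if "a \<in> norm_closure S" "b \<in> S" for a b
    using norm_closure_mult_right[OF sub that(1) _ sub] that(2) sub mult C(2) by blast
  then show "a \<otimes> b \<in> norm_closure S" if "a \<in> norm_closure S" "b \<in> norm_closure S" for a b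
    using norm_closure_mult_left[OF sub that(2) norm_closureD(1)[OF that(1)] sub] that(1) by blast
qed

lemma generates_dense:
  assumes "generates X A" "linear_subspace S" "\<And>a. a \<in> S \<Longrightarrow> star A a \<in> S"
    "\<And>a b. a \<in> S \<Longrightarrow> b \<in> S \<Longrightarrow> a \<otimes> b \<in> S" "X \<subseteq> S"
  shows "norm_closure S = carrier A"
proof -
  have "S \<subseteq> carrier A" using linear_subspaceD(1)[OF assms(2)] by blast
  then have "X \<subseteq> norm_closure S" using norm_closure_subset assms(5) by blast
  then show ?thesis
    using assms(1) cstar_subalgebra_norm_closure[OF assms(2-4)] by (auto simp: generates_def)
qed

text \<open>The hypotheses make \<open>I \<inter> I\<^sup>*\<close> a C*-subalgebra; closed ideals need not be known to be self-adjoint.\<close>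

lemma cstar_ideal_eq_carrier:
  assumes gen: "generates X A" and I: "cstar_ideal I A" and X: "\<And>a. a \<in> X \<Longrightarrow> a \<in> I \<and> star A a \<in> I"
  shows "I = carrier A"
proof -
  have I': "algebra_ideal I" "closedin (norm_topology A) I" using I by (auto simp: cstar_ideal_iff)
  note D = algebra_idealD[OF I'(1)] and L = linear_subspaceD[OF algebra_idealD(1)[OF I'(1)]]
  let ?S = "{a \<in> I. star A a \<in> I}"
  have "cstar_subalgebra ?S A"
  proof (rule cstar_subalgebraI)
    show "linear_subspace ?S"
      using L by (auto simp: linear_subspace_def star_add star_smult)
    show "closedin (norm_topology A) ?S"
      unfolding closedin_norm_topology_iff
    proof (intro conjI ballI impI)
      fix a assume a: "a \<in> carrier A" "\<forall>e>0. \<exists>b\<in>?S. cnorm A (a \<ominus> b) < e"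
      then have "a \<in> I" using I'(2) unfolding closedin_norm_topology_iff by blast
      moreover have "star A a \<in> norm_closure ?S"
        by (rule norm_closure_star) (use a L in \<open>auto simp: norm_closure_def\<close>)
      then have "star A a \<in> I"
        using I'(2) unfolding closedin_norm_topology_iff norm_closure_def by blast
      ultimately show "a \<in> ?S" by blast
    qed (use L in auto)
  qed (use D L in \<open>auto simp: star_mult\<close>)
  then have "?S = carrier A" using gen X by (auto simp: generates_def)
  then show ?thesis using L by blast
qed

subsection \<open>Quasi-inverses and contractivity of homomorphisms\<close>

text \<open>The map \<open>y \<mapsto> h + h y\<close> is a contraction. Its fixed point is the
  Neumann series without its constant term: formally \<open>1 + y\<close> inverts
  \<open>1 - h\<close>, but no unit is involved.\<close>

lemma quasi_inverse_exists:
  assumes h: "h \<in> carrier A" "cnorm A h < 1"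
  obtains y where "y \<in> carrier A" "y = h \<oplus> h \<otimes> y"
proof -
  have con: "cdist A (h \<oplus> h \<otimes> a) (h \<oplus> h \<otimes> b) \<le> cnorm A h * cdist A a b"
    if "a \<in> carrier A" "b \<in> carrier A" for a b
  proof -
    have "(h \<oplus> h \<otimes> a) \<ominus> (h \<oplus> h \<otimes> b) = h \<otimes> (a \<ominus> b)"
      using that h by (simp add: add_minus_add_left minus_mult_distrib)
    then show ?thesis using that h cnorm_mult by simp
  qed
  show ?thesis
    by (rule N.Banach_fixedpoint_thm[of "\<lambda>y. h \<oplus> h \<otimes> y" "cnorm A h"])
      (use that con complete h in auto)
qed

text \<open>With \<open>p\<close> in the role of a unit, \<open>p i = p - h\<close> where
  \<open>h = p (p - i)\<close> has norm below 1. For the quasi-inverse \<open>y\<close> of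
  \<open>h\<close> this gives \<open>p i y = h\<close>, so \<open>h\<close> and then
  \<open>p = h + p i\<close> lie in \<open>I\<close>. The ideal may fail to be closed.\<close>

lemma projection_mem_ideal:
  assumes I: "algebra_ideal I" and p: "p \<in> carrier A" "p \<otimes> p = p" "star A p = p"
    and i: "i \<in> I" "cnorm A (p \<ominus> i) < 1"
  shows "p \<in> I"
proof -
  note D = algebra_idealD[OF I] and L = linear_subspaceD[OF algebra_idealD(1)[OF I]]
  have ic: "i \<in> carrier A" using L i by blast
  define h where "h = p \<otimes> (p \<ominus> i)"
  have h: "h \<in> carrier A" "h = p \<ominus> p \<otimes> i" "p \<otimes> h = h"
    using p ic by (simp_all add: h_def minus_mult_distrib flip: mult_assoc)
  have "cnorm A h \<le> 1 * cnorm A (p \<ominus> i)"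
    unfolding h_def by (intro cnorm_mult_mono cnorm_projection_le_1) (use p ic in auto)
  then obtain y where y: "y \<in> carrier A" "y = h \<oplus> h \<otimes> y"
    using quasi_inverse_exists[OF h(1)] i by auto
  have "p \<otimes> y = p \<otimes> h \<oplus> (p \<otimes> h) \<otimes> y"
    using y h p by (metis distrib_left mult_assoc mult_closed)
  then have py: "p \<otimes> y = y" using h y by simp
  have "(p \<otimes> i) \<otimes> y = (p \<ominus> h) \<otimes> y" using h p ic by simp
  also have "\<dots> = y \<ominus> h \<otimes> y" using p h(1) y(1) py by (simp add: minus_mult_distrib)
  also have "\<dots> = (h \<oplus> h \<otimes> y) \<ominus> h \<otimes> y" using y(2) by simp
  also have "\<dots> = h" using h(1) y(1) by (simp add: a_minus_def M.a_assoc M.r_neg)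
  finally have "h \<in> I" using D i p y by metis
  moreover have "p = h \<oplus> p \<otimes> i" using h(2) p ic by simp
  ultimately show ?thesis using L D i p by metis
qed

text \<open>\<open>g\<close> plays the part of \<open>1 - sqrt(1 - h^2)\<close>, which solves
  \<open>g = (h^2 + g^2)/2\<close>. This equation needs no unit and no functional calculus: its
  right-hand side contracts the ball whose radius is the norm of \<open>h\<close>.\<close>

lemma square_root_fixpoint:
  assumes h: "h \<in> carrier A" "star A h = h" "cnorm A h < 1"
  obtains g where "g \<in> carrier A" "star A g = g" "g \<otimes> h = h \<otimes> g" "g \<oplus> g = h \<otimes> h \<oplus> g \<otimes> g"
proof -
  let ?r = "cnorm A h"
  define K where "K = {g \<in> carrier A. cnorm A g \<le> ?r}"
  define f where "f g = (1/2) \<odot> (h \<otimes> h \<oplus> g \<otimes> g)" for g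
  have K: "K = N.mcball \<zero> ?r"
    by (auto simp: K_def)
  have f: "f g \<in> K" if "g \<in> K" for g
  proof -
    have g: "g \<in> carrier A" "cnorm A g \<le> ?r" using that by (auto simp: K_def)
    have "cnorm A (h \<otimes> h \<oplus> g \<otimes> g) \<le> ?r * ?r + ?r * ?r"
      using cnorm_triangle[of "h \<otimes> h" "g \<otimes> g"] cnorm_mult[of h h] cnorm_mult_mono[of g g ?r ?r] g h
      by simp
    then have "cnorm A (f g) \<le> ?r * ?r" using g h by (simp add: f_def cnorm_smult)
    also have "\<dots> \<le> ?r" using h by (simp add: mult_left_le_one_le)
    finally show ?thesis using g h by (simp add: K_def f_def)
  qed
  have diff: "cnorm A (a \<otimes> a \<ominus> b \<otimes> b) \<le> 2 * ?r * cnorm A (a \<ominus> b)" if "a \<in> K" "b \<in> K" for a b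
  proof -
    have ab: "a \<in> carrier A" "b \<in> carrier A" "cnorm A a \<le> ?r" "cnorm A b \<le> ?r"
      using that by (auto simp: K_def)
    have "a \<otimes> a \<ominus> b \<otimes> b = a \<otimes> (a \<ominus> b) \<oplus> (a \<ominus> b) \<otimes> b"
      using ab by (simp add: linear_simps M.a_assoc)
    then show ?thesis
      using cnorm_triangle[of "a \<otimes> (a \<ominus> b)" "(a \<ominus> b) \<otimes> b"] ab
        cnorm_mult_mono[of a "a \<ominus> b" ?r "cnorm A (a \<ominus> b)"] cnorm_mult_mono[of "a \<ominus> b" b "cnorm A (a \<ominus> b)" ?r]
      by (simp add: algebra_simps)
  qed
  have KN: "K \<subseteq> carrier A" by (auto simp: K_def)
  interpret K: Submetric "carrier A" "cdist A" K by unfold_locales (rule KN)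
  have "K.sub.mcomplete"
    by (rule K.closedin_mcomplete_imp_mcomplete) (use complete N.closedin_mcball K in auto)
  moreover have "cdist A (f a) (f b) \<le> ?r * cdist A a b" if "a \<in> K" "b \<in> K" for a b
  proof -
    have ab: "a \<in> carrier A" "b \<in> carrier A" "f a \<in> carrier A" "f b \<in> carrier A"
      using that f by (auto simp: K_def)
    have "f a \<ominus> f b = (1/2) \<odot> (a \<otimes> a \<ominus> b \<otimes> b)"
      using ab h by (simp add: f_def add_minus_add_left flip: smult_minus)
    then show ?thesis using diff[OF that] ab by (simp add: cnorm_smult)
  qed
  moreover have "\<zero> \<in> K" using h by (simp add: K_def)
  ultimately obtain g where g: "g \<in> K" "f g = g"
    using K.sub.Banach_fixedpoint_thm[of f ?r] f h(3) by auto
  have gc: "g \<in> carrier A" "cnorm A g \<le> ?r" using g by (auto simp: K_def)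
  have gg: "g \<oplus> g = h \<otimes> h \<oplus> g \<otimes> g"
  proof -
    have "g \<oplus> g = f g \<oplus> f g" using g by simp
    then show ?thesis using gc h by (simp add: f_def)
  qed
  have half: "g = (1/2) \<odot> (h \<otimes> h \<oplus> g \<otimes> g)" using g by (simp add: f_def)
  \<comment> \<open>The adjoint of \<open>g\<close> solves the same equation in the same ball, so
    the contraction estimate forces it to equal \<open>g\<close>.\<close>
  have "star A g \<ominus> g = (1/2) \<odot> (star A g \<otimes> star A g \<ominus> g \<otimes> g)"
  proof -
    have "star A g = star A ((1/2) \<odot> (h \<otimes> h \<oplus> g \<otimes> g))" by (rule arg_cong[OF half])
    also have "\<dots> = (1/2) \<odot> (h \<otimes> h \<oplus> star A g \<otimes> star A g)"
      using gc h by (simp add: star_smult star_add star_mult)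
    finally have "star A g = (1/2) \<odot> (h \<otimes> h \<oplus> star A g \<otimes> star A g)" .
    then have "star A g \<ominus> g = (1/2) \<odot> (h \<otimes> h \<oplus> star A g \<otimes> star A g) \<ominus> (1/2) \<odot> (h \<otimes> h \<oplus> g \<otimes> g)"
      using half by simp
    also have "\<dots> = (1/2) \<odot> (star A g \<otimes> star A g \<ominus> g \<otimes> g)"
      using gc h by (simp add: add_minus_add_left flip: smult_minus)
    finally show ?thesis .
  qed
  then have "cnorm A (star A g \<ominus> g) \<le> ?r * cnorm A (star A g \<ominus> g)"
    using diff[of "star A g" g] g gc by (simp add: cnorm_smult K_def)
  then have "star A g \<ominus> g = \<zero>"
    by (rule cnorm_eq_zeroI[OF _ h(3), rotated]) (use gc in simp)
  then have sg: "star A g = g"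
    using gc minus_eq_zero_iff[of "star A g" g] by simp
  define c where "c = g \<otimes> h \<ominus> h \<otimes> g"
  have cc: "c \<in> carrier A" using gc h by (simp add: c_def)
  \<comment> \<open>The commutator \<open>c\<close> of \<open>g\<close> and \<open>h\<close>
    satisfies \<open>2 c = g c + c g\<close>, and \<open>g\<close> has norm below 1; hence
    \<open>c\<close> vanishes.\<close>
  have "c \<oplus> c = g \<otimes> c \<oplus> c \<otimes> g"
  proof -
    have "c \<oplus> c = (g \<oplus> g) \<otimes> h \<ominus> h \<otimes> (g \<oplus> g)"
      using gc h by (simp add: c_def linear_simps M.a_ac)
    also have "\<dots> = (h \<otimes> h \<oplus> g \<otimes> g) \<otimes> h \<ominus> h \<otimes> (h \<otimes> h \<oplus> g \<otimes> g)" by (simp add: gg)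
    also have "\<dots> = g \<otimes> c \<oplus> c \<otimes> g"
      using gc h by (simp add: c_def linear_simps M.a_ac mult_assoc)
    finally show ?thesis .
  qed
  moreover have "c = (1/2) \<odot> (c \<oplus> c)" using cc by (simp add: smult_add_right)
  ultimately have "c = (1/2) \<odot> (g \<otimes> c \<oplus> c \<otimes> g)" by simp
  then have "cnorm A c = (1/2) * cnorm A (g \<otimes> c \<oplus> c \<otimes> g)"
    using cc gc by (metis (no_types, lifting) cnorm_smult M.add.m_closed mult_closed norm_divide norm_numeral norm_one)
  also have "\<dots> \<le> (1/2) * (?r * cnorm A c + cnorm A c * ?r)"
    by (intro mult_left_mono order.trans[OF cnorm_triangle add_mono] cnorm_mult_mono) (use cc gc in auto)
  finally have "c = \<zero>" using cnorm_eq_zeroI[OF cc h(3)] by (simp add: mult.commute)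
  then have "g \<otimes> h = h \<otimes> g" using gc h minus_eq_zero_iff by (simp add: c_def)
  then show ?thesis using that gc sg gg by blast
qed

text \<open>Since \<open>P\<close> and \<open>Q\<close> commute, both \<open>P + i Q\<close> and
  \<open>P - i Q\<close> have \<open>P^2 + Q^2\<close> as the element in the C*-identity, and
  \<open>2 P\<close> is their sum.\<close>

lemma cnorm_le_sum_squares:
  assumes P: "P \<in> carrier A" "star A P = P" and Q: "Q \<in> carrier A" "star A Q = Q" and "P \<otimes> Q = Q \<otimes> P"
  shows "(cnorm A P)\<^sup>2 \<le> cnorm A (P \<otimes> P \<oplus> Q \<otimes> Q)"
proof -
  let ?R = "P \<otimes> P \<oplus> Q \<otimes> Q"
  have R: "?R \<in> carrier A" using P Q by simp
  have *: "(cnorm A (P \<oplus> z \<odot> Q))\<^sup>2 = cnorm A ?R" if "cnj z = - z" "z * z = -1" for z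
  proof -
    have "star A (P \<oplus> z \<odot> Q) \<otimes> (P \<oplus> z \<odot> Q) = ?R"
      using P Q that assms(5) by (simp add: linear_simps M.a_ac)
    then show ?thesis using cstar_identity[of "P \<oplus> z \<odot> Q"] P Q by simp
  qed
  have "P \<oplus> P = (P \<oplus> \<i> \<odot> Q) \<oplus> (P \<oplus> (-\<i>) \<odot> Q)"
    using P Q by (simp add: M.a_ac)
  then have "cnorm A (P \<oplus> P) \<le> cnorm A (P \<oplus> \<i> \<odot> Q) + cnorm A (P \<oplus> (-\<i>) \<odot> Q)"
    using cnorm_triangle P Q by simp
  moreover have "cnorm A (P \<oplus> P) = 2 * cnorm A P"
    using smult_collect(1)[of P 1 1] cnorm_smult[of P 2] P by simp
  moreover have "cnorm A (P \<oplus> \<i> \<odot> Q) = sqrt (cnorm A ?R)" "cnorm A (P \<oplus> (-\<i>) \<odot> Q) = sqrt (cnorm A ?R)"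
    using real_sqrt_unique[OF *[of \<i>]] real_sqrt_unique[OF *[of "-\<i>"]] P Q by simp_all
  ultimately have "cnorm A P \<le> sqrt (cnorm A ?R)" by simp
  then show ?thesis
    using P R by (metis cnorm_nonneg power_mono real_sqrt_pow2)
qed

text \<open>The relation \<open>2g = k\<^sup>2 + g\<^sup>2\<close> says that \<open>k + i(1 - g)\<close> is unitary.\<close>

lemma cnorm_le_1_of_unitary_part:
  assumes k: "k \<in> carrier A" "star A k = k" and g: "g \<in> carrier A" "star A g = g"
    and gk: "g \<otimes> k = k \<otimes> g" and gg: "g \<oplus> g = k \<otimes> k \<oplus> g \<otimes> g"
  shows "cnorm A k \<le> 1"
proof -
  \<comment> \<open>\<open>P\<close> and \<open>Q\<close> are the self-adjoint parts of
    \<open>k u\<close> with \<open>u = k + i(1 - g)\<close>. The factor \<open>u\<close> needs a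
    unit, the product does not, and unitarity of \<open>u\<close> becomes
    \<open>P^2 + Q^2 = P\<close>.\<close>
  define P where "P = k \<otimes> k"
  define Q where "Q = k \<ominus> g \<otimes> k"
  have gkk: "g \<otimes> (k \<otimes> k) = (k \<otimes> k) \<otimes> g"
    using gk k g by (metis mult_assoc)
  have P: "P \<in> carrier A" "star A P = P" using k by (simp_all add: P_def star_mult)
  have Q: "Q \<in> carrier A" "star A Q = Q" using k g gk by (simp_all add: Q_def star_minus star_mult)
  have PQ: "P \<otimes> Q = Q \<otimes> P"
    using k g gk gkk by (simp add: P_def Q_def minus_mult_distrib) (metis mult_assoc mult_closed)
  have QQ: "Q \<otimes> Q = P \<ominus> (g \<oplus> g) \<otimes> P \<oplus> g \<otimes> g \<otimes> P"
  proof -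
    have 1: "(g \<otimes> k) \<otimes> k = g \<otimes> P" using k g by (simp add: P_def mult_assoc)
    have 2: "k \<otimes> (g \<otimes> k) = g \<otimes> P" using k g gk 1 by (metis mult_assoc)
    have "(g \<otimes> k) \<otimes> (g \<otimes> k) = g \<otimes> g \<otimes> P" using 2 k g P by (simp add: mult_assoc)
    with 1 2 show ?thesis
      using k g P by (simp add: Q_def linear_simps M.a_ac flip: P_def)
  qed
  have "P \<otimes> P \<oplus> Q \<otimes> Q = P"
  proof -
    define V where "V = g \<otimes> g \<otimes> P"
    have V: "V \<in> carrier A" using g P by (simp add: V_def)
    have "(g \<oplus> g) \<otimes> P = P \<otimes> P \<oplus> V"
      unfolding gg V_def using k g P by (simp add: distrib_right flip: P_def)
    then have "P \<otimes> P \<oplus> Q \<otimes> Q = P \<otimes> P \<oplus> (P \<ominus> (P \<otimes> P \<oplus> V) \<oplus> V)" by (simp add: QQ V_def)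
    also have "\<dots> = P \<ominus> (P \<otimes> P \<oplus> V) \<oplus> (P \<otimes> P \<oplus> V)" using P V by (intro M.a_lcomm) auto
    finally show ?thesis using P V by simp
  qed
  then have "(cnorm A P)\<^sup>2 \<le> cnorm A P"
    using cnorm_le_sum_squares[OF P Q PQ] by simp
  then have "cnorm A P \<le> 1"
  proof (rule contrapos_pp)
    assume "\<not> cnorm A P \<le> 1"
    then show "\<not> (cnorm A P)\<^sup>2 \<le> cnorm A P"
      using mult_strict_left_mono[of 1 "cnorm A P" "cnorm A P"] by (simp add: power2_eq_square)
  qed
  then have "(cnorm A k)\<^sup>2 \<le> 1" using cnorm_square[OF k] by (simp add: P_def)
  then show ?thesis by (simp add: power_le_one_iff abs_square_le_1)
qed

end

section \<open>Homomorphisms of C*-algebras\<close>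

lemma cstar_homD:
  assumes "\<pi> \<in> cstar_hom A B" "a \<in> carrier A"
  shows "\<pi> a \<in> carrier B" "\<And>b. b \<in> carrier A \<Longrightarrow> \<pi> (a \<oplus>\<^bsub>A\<^esub> b) = \<pi> a \<oplus>\<^bsub>B\<^esub> \<pi> b"
    "\<And>b. b \<in> carrier A \<Longrightarrow> \<pi> (a \<otimes>\<^bsub>A\<^esub> b) = \<pi> a \<otimes>\<^bsub>B\<^esub> \<pi> b"
    "\<pi> (star A a) = star B (\<pi> a)" "\<And>z. \<pi> (z \<odot>\<^bsub>A\<^esub> a) = z \<odot>\<^bsub>B\<^esub> \<pi> a"
  using assms by (auto simp: cstar_hom_def Pi_iff)

text \<open>A homomorphism preserves the algebraic relation between \<open>h\<close> and
  \<open>g\<close>, so the image of a self-adjoint element of norm below 1 is again the real part of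
  a unitary. Scaling and the C*-identity give the general case. It is applied to the gauge
  automorphisms, to bound averages.\<close>

theorem cstar_hom_contractive:
  assumes A: "cstar_algebra A" and B: "cstar_algebra B" and \<pi>: "\<pi> \<in> cstar_hom A B" and a: "a \<in> carrier A"
  shows "cnorm B (\<pi> a) \<le> cnorm A a"
proof -
  interpret A: cstar_algebra A by fact
  interpret B: cstar_algebra B by fact
  note hom = cstar_homD[OF \<pi>]
  have le1: "cnorm B (\<pi> h) \<le> 1" if h: "h \<in> carrier A" "star A h = h" "cnorm A h < 1" for h
  proof -
    obtain g where g: "g \<in> carrier A" "star A g = g" "g \<otimes>\<^bsub>A\<^esub> h = h \<otimes>\<^bsub>A\<^esub> g"
      "g \<oplus>\<^bsub>A\<^esub> g = h \<otimes>\<^bsub>A\<^esub> h \<oplus>\<^bsub>A\<^esub> g \<otimes>\<^bsub>A\<^esub> g"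
      using A.square_root_fixpoint[OF h] by metis
    show ?thesis
    proof (rule B.cnorm_le_1_of_unitary_part[of _ "\<pi> g"])
      show "\<pi> h \<in> carrier B" "star B (\<pi> h) = \<pi> h" "\<pi> g \<in> carrier B" "star B (\<pi> g) = \<pi> g"
        using g h hom by (metis, metis, metis, metis)
      show "\<pi> g \<otimes>\<^bsub>B\<^esub> \<pi> h = \<pi> h \<otimes>\<^bsub>B\<^esub> \<pi> g" using g h hom(3) by metis
      show "\<pi> g \<oplus>\<^bsub>B\<^esub> \<pi> g = \<pi> h \<otimes>\<^bsub>B\<^esub> \<pi> h \<oplus>\<^bsub>B\<^esub> \<pi> g \<otimes>\<^bsub>B\<^esub> \<pi> g"
        using g h hom(2,3) A.mult_closed by metis
    qed
  qed
  have sa: "cnorm B (\<pi> h) \<le> cnorm A h" if h: "h \<in> carrier A" "star A h = h" for h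
  proof (rule field_le_epsilon)
    fix e :: real assume e: "e > 0"
    \<comment> \<open>The fixed point \<open>g\<close> requires norm strictly below 1, so
      \<open>h\<close> is divided by slightly more than its norm.\<close>
    define r where "r = cnorm A h + e"
    have r: "r > 0" "cnorm A h < r" using e h A.cnorm_nonneg[OF h(1)] by (auto simp: r_def intro: add_nonneg_pos)
    let ?z = "complex_of_real (inverse r)"
    have "cnorm B (\<pi> (?z \<odot>\<^bsub>A\<^esub> h)) \<le> 1"
      by (rule le1) (use h r in \<open>simp_all add: A.star_smult A.cnorm_smult field_simps norm_divide\<close>)
    then have "cnorm B (\<pi> h) \<le> r"
      using h r by (simp add: hom B.cnorm_smult field_simps norm_divide)
    then show "cnorm B (\<pi> h) \<le> cnorm A h + e" by (simp add: r_def)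
  qed
  have "(cnorm B (\<pi> a))\<^sup>2 = cnorm B (\<pi> (star A a \<otimes>\<^bsub>A\<^esub> a))"
    using a by (simp add: hom B.cstar_identity)
  also have "\<dots> \<le> cnorm A (star A a \<otimes>\<^bsub>A\<^esub> a)"
    using a by (intro sa) (simp_all add: A.star_mult)
  also have "\<dots> = (cnorm A a)\<^sup>2" using a by (simp add: A.cstar_identity)
  finally show ?thesis using a by (metis A.cnorm_nonneg power2_le_imp_le)
qed

lemma algebra_ideal_kernel:
  assumes A: "cstar_algebra A" and B: "cstar_algebra B" and \<pi>: "\<pi> \<in> cstar_hom A B"
  shows "cstar_algebra.algebra_ideal A {a \<in> carrier A. \<pi> a = \<zero>\<^bsub>B\<^esub>}"
proof -
  interpret A: cstar_algebra A by fact
  interpret B: cstar_algebra B by fact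
  note hom = cstar_homD[OF \<pi>]
  have "\<pi> \<zero>\<^bsub>A\<^esub> = \<zero>\<^bsub>B\<^esub>"
    using hom(5)[of "\<zero>\<^bsub>A\<^esub>" 0] hom(1)[of "\<zero>\<^bsub>A\<^esub>"] by simp
  then show ?thesis
    by (auto simp: A.algebra_ideal_def A.linear_subspace_def hom)
qed

section \<open>The Hilbert space of square-summable families\<close>

typedef 'i ell2 = "{f :: 'i \<Rightarrow> complex. (\<lambda>i. (cmod (f i))\<^sup>2) summable_on UNIV}"
  morphisms coord Ell2
  by (intro exI[of _ "\<lambda>_. 0"]) simp

setup_lifting type_definition_ell2

lemma coord_summable: "(\<lambda>i. (cmod (coord x i))\<^sup>2) summable_on UNIV"
  using coord[of x] by simp

lemma ell2_eqI: "(\<And>i. coord x i = coord y i) \<Longrightarrow> x = y"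
  by (metis coord_inject ext)

lemma square_summable_comparison:
  fixes f :: "'i \<Rightarrow> complex"
  assumes "g summable_on UNIV" "\<And>i. (cmod (f i))\<^sup>2 \<le> g i"
  shows "(\<lambda>i. (cmod (f i))\<^sup>2) summable_on UNIV"
  by (rule abs_summable_summable, rule Infinite_Sum.abs_summable_on_comparison_test'[OF assms(1)]) (use assms(2) in simp)

lemma square_summable_add:
  fixes f g :: "'i \<Rightarrow> complex"
  assumes "(\<lambda>i. (cmod (f i))\<^sup>2) summable_on UNIV" "(\<lambda>i. (cmod (g i))\<^sup>2) summable_on UNIV"
  shows "(\<lambda>i. (cmod (f i + g i))\<^sup>2) summable_on UNIV"
proof (rule square_summable_comparison)
  show "(\<lambda>i. 2 * ((cmod (f i))\<^sup>2 + (cmod (g i))\<^sup>2)) summable_on UNIV"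
    by (intro summable_on_cmult_right summable_on_add assms)
  show "(cmod (f i + g i))\<^sup>2 \<le> 2 * ((cmod (f i))\<^sup>2 + (cmod (g i))\<^sup>2)" for i
  proof -
    have "(cmod (f i + g i))\<^sup>2 \<le> (cmod (f i) + cmod (g i))\<^sup>2"
      by (intro power_mono norm_triangle_ineq) auto
    also have "\<dots> \<le> 2 * ((cmod (f i))\<^sup>2 + (cmod (g i))\<^sup>2)"
      using sum_squares_bound[of "cmod (f i)" "cmod (g i)"] by (simp add: power2_sum)
    finally show ?thesis .
  qed
qed

lemma square_summable_mult:
  fixes f :: "'i \<Rightarrow> complex"
  assumes "(\<lambda>i. (cmod (f i))\<^sup>2) summable_on UNIV"
  shows "(\<lambda>i. (cmod (c * f i))\<^sup>2) summable_on UNIV"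
  using summable_on_cmult_right[OF assms, of "(cmod c)\<^sup>2"] by (simp add: norm_mult power_mult_distrib)

lemma inner_summable: "(\<lambda>i. coord x i \<bullet> coord y i) summable_on UNIV"
proof -
  have "(\<lambda>i. (cmod (coord x i))\<^sup>2 + (cmod (coord y i))\<^sup>2) summable_on UNIV"
    by (intro summable_on_add coord_summable)
  moreover have "norm (coord x i \<bullet> coord y i) \<le> (cmod (coord x i))\<^sup>2 + (cmod (coord y i))\<^sup>2" for i
  proof -
    have "norm (coord x i \<bullet> coord y i) \<le> cmod (coord x i) * cmod (coord y i)"
      by (simp add: Cauchy_Schwarz_ineq2)
    also have "\<dots> \<le> (cmod (coord x i))\<^sup>2 + (cmod (coord y i))\<^sup>2"
    proof -
      have "0 \<le> cmod (coord x i) * cmod (coord y i)" by simp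
      moreover have "2 * (cmod (coord x i) * cmod (coord y i)) \<le> (cmod (coord x i))\<^sup>2 + (cmod (coord y i))\<^sup>2"
        using sum_squares_bound[of "cmod (coord x i)" "cmod (coord y i)"] by (simp add: mult.assoc)
      ultimately show ?thesis by linarith
    qed
    finally show ?thesis .
  qed
  ultimately have "(\<lambda>i. norm (coord x i \<bullet> coord y i)) summable_on UNIV"
    by (rule Infinite_Sum.abs_summable_on_comparison_test')
  then show ?thesis by (rule abs_summable_summable)
qed

instantiation ell2 :: (type) real_inner
begin

lift_definition zero_ell2 :: "'i ell2" is "\<lambda>_. 0" by simp

lift_definition plus_ell2 :: "'i ell2 \<Rightarrow> 'i ell2 \<Rightarrow> 'i ell2" is "\<lambda>f g i. f i + g i"
  by (rule square_summable_add)

lift_definition uminus_ell2 :: "'i ell2 \<Rightarrow> 'i ell2" is "\<lambda>f i. - f i" by simp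

lift_definition minus_ell2 :: "'i ell2 \<Rightarrow> 'i ell2 \<Rightarrow> 'i ell2" is "\<lambda>f g i. f i - g i"
  subgoal for f g using square_summable_add[of f "\<lambda>i. - g i"] by simp
  done

lift_definition scaleR_ell2 :: "real \<Rightarrow> 'i ell2 \<Rightarrow> 'i ell2" is "\<lambda>r f i. r *\<^sub>R f i"
  subgoal for r f using square_summable_mult[of f "complex_of_real r"] by (simp add: scaleR_conv_of_real)
  done

text \<open>The inner product of complex numbers as plane vectors, so this is the real part of the
  usual complex inner product. For complex-linear operators, adjoints with respect to it are
  complex-linear again, by \<open>is_adjoint_clinear\<close>.\<close>

definition inner_ell2 :: "'i ell2 \<Rightarrow> 'i ell2 \<Rightarrow> real" where
  "inner_ell2 x y = (\<Sum>\<^sub>\<infinity>i. coord x i \<bullet> coord y i)"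

definition norm_ell2 :: "'i ell2 \<Rightarrow> real" where "norm_ell2 x = sqrt (inner x x)"

definition sgn_ell2 :: "'i ell2 \<Rightarrow> 'i ell2" where "sgn_ell2 x = inverse (norm x) *\<^sub>R x"

definition dist_ell2 :: "'i ell2 \<Rightarrow> 'i ell2 \<Rightarrow> real" where "dist_ell2 x y = norm (x - y)"

definition uniformity_ell2 :: "('i ell2 \<times> 'i ell2) filter" where
  "uniformity_ell2 = (INF e\<in>{0<..}. principal {(x, y). dist x y < e})"

definition open_ell2 :: "'i ell2 set \<Rightarrow> bool" where
  "open_ell2 U \<longleftrightarrow> (\<forall>x\<in>U. eventually (\<lambda>(x', y). x' = x \<longrightarrow> y \<in> U) uniformity)"

instance
proof
  fix x y z :: "'i ell2" and r q :: real
  show "x + y + z = x + (y + z)" "x + y = y + x" "0 + x = x" "- x + x = 0" "x - y = x + - y"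
    "r *\<^sub>R (x + y) = r *\<^sub>R x + r *\<^sub>R y" "(r + q) *\<^sub>R x = r *\<^sub>R x + q *\<^sub>R x"
    "r *\<^sub>R q *\<^sub>R x = (r * q) *\<^sub>R x" "1 *\<^sub>R x = x"
    by (transfer; simp add: algebra_simps)+
  show "sgn x = inverse (norm x) *\<^sub>R x" by (simp add: sgn_ell2_def)
  show "dist x y = norm (x - y)" by (simp add: dist_ell2_def)
  show "(uniformity :: ('i ell2 \<times> 'i ell2) filter) = (INF e\<in>{0<..}. principal {(x, y). dist x y < e})"
    by (simp add: uniformity_ell2_def)
  show "open U \<longleftrightarrow> (\<forall>x\<in>U. eventually (\<lambda>(x', y). x' = x \<longrightarrow> y \<in> U) uniformity)" for U :: "'i ell2 set"
    by (simp add: open_ell2_def)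
  show "inner x y = inner y x" by (simp add: inner_ell2_def inner_commute)
  show "inner (x + y) z = inner x z + inner y z"
    unfolding inner_ell2_def
    by (subst infsum_add[symmetric, OF inner_summable inner_summable])
      (simp add: plus_ell2.rep_eq inner_add_left)
  show "inner (r *\<^sub>R x) y = r * inner x y"
    unfolding inner_ell2_def
    by (subst infsum_cmult_right[symmetric, OF inner_summable]) (simp add: scaleR_ell2.rep_eq)
  show "0 \<le> inner x x" by (simp add: inner_ell2_def infsum_nonneg)
  show "inner x x = 0 \<longleftrightarrow> x = 0"
  proof
    assume "inner x x = 0"
    then have "coord x i \<bullet> coord x i = 0" for i
      using nonneg_infsum_le_0D[OF _ inner_summable[of x x], where x = i] by (simp add: inner_ell2_def)
    then show "x = 0" by (intro ell2_eqI) (simp add: zero_ell2.rep_eq)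
  qed (simp add: inner_ell2_def zero_ell2.rep_eq)
  show "norm x = sqrt (inner x x)" by (simp add: norm_ell2_def)
qed

end

lemmas coord_simps [simp] = zero_ell2.rep_eq plus_ell2.rep_eq minus_ell2.rep_eq uminus_ell2.rep_eq
  scaleR_ell2.rep_eq

lemma norm_ell2_square: "(norm x)\<^sup>2 = (\<Sum>\<^sub>\<infinity>i. (cmod (coord x i))\<^sup>2)"
  by (simp add: norm_eq_sqrt_inner inner_ell2_def infsum_nonneg power2_norm_eq_inner)

lemma sum_coord_le: "finite F \<Longrightarrow> (\<Sum>i\<in>F. (cmod (coord x i))\<^sup>2) \<le> (norm x)\<^sup>2"
  unfolding norm_ell2_square by (rule finite_sum_le_infsum) (auto intro: coord_summable)

lemma cmod_coord_le: "cmod (coord x i) \<le> norm x"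
  using sum_coord_le[of "{i}" x] by (simp add: power2_le_iff_abs_le)

lemma ell2_of_bounded_sums:
  assumes "\<And>F. finite F \<Longrightarrow> (\<Sum>i\<in>F. (cmod (f i))\<^sup>2) \<le> C\<^sup>2" "C \<ge> 0"
  obtains x where "coord x = f" "norm x \<le> C"
proof -
  have s: "(\<lambda>i. (cmod (f i))\<^sup>2) summable_on UNIV"
    by (rule nonneg_bdd_above_summable_on) (use assms(1) in \<open>auto intro!: bdd_aboveI\<close>)
  then have c: "coord (Ell2 f) = f" by (simp add: Ell2_inverse)
  have "(norm (Ell2 f))\<^sup>2 \<le> C\<^sup>2"
    unfolding norm_ell2_square c by (rule infsum_le_finite_sums[OF s]) (use assms in auto)
  then have "norm (Ell2 f) \<le> C" using assms(2) by (rule power2_le_imp_le)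
  then show ?thesis using that c by blast
qed

text \<open>The limit exists in each coordinate; bounds on finite partial sums pass to the limit and
  show both that it is square-summable and that it is approached in norm.\<close>

lemma ell2_Cauchy_convergent:
  fixes X :: "nat \<Rightarrow> 'i ell2"
  assumes X: "Cauchy X" shows "convergent X"
proof -
  have le: "cmod (coord (X m) i - coord (X n) i) \<le> norm (X m - X n)" for m n i
    using cmod_coord_le[of "X m - X n" i] by simp
  have "Cauchy (\<lambda>n. coord (X n) i)" for i
  proof (rule CauchyI)
    fix e :: real assume "e > 0"
    then obtain M where "\<forall>m\<ge>M. \<forall>n\<ge>M. norm (X m - X n) < e" using CauchyD[OF X] by blast
    then show "\<exists>M. \<forall>m\<ge>M. \<forall>n\<ge>M. cmod (coord (X m) i - coord (X n) i) < e"
      using le by (meson le_less_trans)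
  qed
  then have "\<exists>l. (\<lambda>n. coord (X n) i) \<longlonglongrightarrow> l" for i
    by (simp add: Cauchy_convergent_iff convergent_def)
  then obtain f where f: "\<And>i. (\<lambda>n. coord (X n) i) \<longlonglongrightarrow> f i" by metis
  have bound: "(\<Sum>i\<in>F. (cmod (f i - coord (X n) i))\<^sup>2) \<le> e\<^sup>2"
    if e: "e > 0" and n: "\<forall>m\<ge>n. norm (X m - X n) < e" and F: "finite F" for e n F
  proof (rule LIMSEQ_le_const2)
    show "(\<lambda>m. \<Sum>i\<in>F. (cmod (coord (X m) i - coord (X n) i))\<^sup>2) \<longlonglongrightarrow> (\<Sum>i\<in>F. (cmod (f i - coord (X n) i))\<^sup>2)"
      by (intro tendsto_intros f)
    have "(\<Sum>i\<in>F. (cmod (coord (X m) i - coord (X n) i))\<^sup>2) \<le> e\<^sup>2" if "m \<ge> n" for m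
    proof -
      have "(\<Sum>i\<in>F. (cmod (coord (X m) i - coord (X n) i))\<^sup>2) \<le> (norm (X m - X n))\<^sup>2"
        using sum_coord_le[OF F, of "X m - X n"] by simp
      also have "\<dots> \<le> e\<^sup>2" using n that by (intro power_mono) (auto intro: less_imp_le)
      finally show ?thesis .
    qed
    then show "\<exists>N. \<forall>m\<ge>N. (\<Sum>i\<in>F. (cmod (coord (X m) i - coord (X n) i))\<^sup>2) \<le> e\<^sup>2" by blast
  qed
  have near: "\<exists>y. coord y = (\<lambda>i. f i - coord (X n) i) \<and> norm y \<le> e"
    if "e > 0" "\<forall>m\<ge>n. norm (X m - X n) < e" for e n
    by (rule ell2_of_bounded_sums[of "\<lambda>i. f i - coord (X n) i" e]) (use bound[OF that] that(1) in auto)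
  obtain N where "\<forall>m\<ge>N. norm (X m - X N) < 1"
    using CauchyD[OF X, of 1] by auto
  then obtain y where y: "coord y = (\<lambda>i. f i - coord (X N) i)" using near[of 1 N] by auto
  define x where "x = X N + y"
  have x: "coord x = f" by (simp add: x_def y)
  have "X \<longlonglongrightarrow> x"
  proof (rule LIMSEQ_I)
    fix r :: real assume r: "r > 0"
    then obtain M where M: "\<forall>m\<ge>M. \<forall>n\<ge>M. norm (X m - X n) < r / 2" using CauchyD[OF X, of "r/2"] by auto
    have "norm (X n - x) < r" if "n \<ge> M" for n
    proof -
      have "\<forall>m\<ge>n. norm (X m - X n) < r / 2" using M that by (meson order.trans)
      from near[OF half_gt_zero[OF r] this]
      obtain y where y: "coord y = (\<lambda>i. f i - coord (X n) i)" "norm y \<le> r / 2" by blast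
      have "x - X n = y" by (rule ell2_eqI) (simp add: x y)
      then show ?thesis using y(2) r by (simp add: norm_minus_commute)
    qed
    then show "\<exists>no. \<forall>n\<ge>no. norm (X n - x) < r" by blast
  qed
  then show ?thesis by (auto simp: convergent_def)
qed

instance ell2 :: (type) complete_space
  by standard (rule ell2_Cauchy_convergent)

instance ell2 :: (type) banach ..

text \<open>The type carries only a real vector space structure; complex scalars act as
  operators.\<close>

lift_definition cscale :: "complex \<Rightarrow> 'i ell2 \<Rightarrow> 'i ell2" is "\<lambda>c f i. c * f i"
  by (rule square_summable_mult)

declare cscale.rep_eq [simp]

text \<open>The entry \<open>c\<close> is a parameter because the inner product is real: to recover
  a complex coordinate one has to test with multiples of both 1 and the imaginary unit.\<close>

lift_definition delta :: "'i \<Rightarrow> complex \<Rightarrow> 'i ell2" is "\<lambda>j c i. if i = j then c else 0"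
  subgoal for j c
    by (rule finite_nonzero_values_imp_summable_on) (rule finite_subset[of _ "{j}"], auto)
  done

declare delta.rep_eq [simp]

lemma inner_delta: "inner (delta j c) x = c \<bullet> coord x j"
proof -
  have "inner (delta j c) x = infsum (\<lambda>i. c \<bullet> coord x i) {j}"
    unfolding inner_ell2_def by (rule infsum_cong_neutral) auto
  then show ?thesis by simp
qed

lemma ell2_eqI_inner: "(\<And>j c. inner (delta j c) x = inner (delta j c) y) \<Longrightarrow> x = y"
proof (rule ell2_eqI)
  fix i assume "\<And>j c. inner (delta j c) x = inner (delta j c) y"
  then have "c \<bullet> (coord x i - coord y i) = 0" for c
    by (simp add: inner_delta inner_diff_right)
  then show "coord x i = coord y i" using inner_eq_zero_iff[of "coord x i - coord y i"] by auto
qed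

lemma inner_cscale_left: "inner (cscale c x) y = inner x (cscale (cnj c) y)"
  unfolding inner_ell2_def by (rule infsum_cong) (simp add: inner_complex_def algebra_simps)

lemma norm_cscale: "norm (cscale c x) = cmod c * norm x"
proof -
  have "(norm (cscale c x))\<^sup>2 = (cmod c * norm x)\<^sup>2"
    unfolding norm_ell2_square power_mult_distrib
    by (subst infsum_cmult_right[symmetric, OF coord_summable]) (simp add: norm_mult power_mult_distrib)
  then show ?thesis by (simp add: power2_eq_iff_nonneg)
qed

lemma bounded_linear_cscale: "bounded_linear (cscale c)"
  by (rule bounded_linear_intro[of _ "cmod c"])
    (auto intro: ell2_eqI simp: algebra_simps norm_cscale)

lift_definition cscale_op :: "complex \<Rightarrow> 'i ell2 \<Rightarrow>\<^sub>L 'i ell2" is cscale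
  by (rule bounded_linear_cscale)

declare cscale_op.rep_eq [simp]

subsection \<open>Adjointable operators\<close>

definition is_adjoint :: "('i ell2 \<Rightarrow>\<^sub>L 'i ell2) \<Rightarrow> ('i ell2 \<Rightarrow>\<^sub>L 'i ell2) \<Rightarrow> bool" where
  "is_adjoint T S \<longleftrightarrow> (\<forall>x y. inner (T x) y = inner x (S y))"

definition adjoint_op :: "('i ell2 \<Rightarrow>\<^sub>L 'i ell2) \<Rightarrow> 'i ell2 \<Rightarrow>\<^sub>L 'i ell2" where
  "adjoint_op T = (THE S. is_adjoint T S)"

text \<open>Existence of an adjoint is built in. It survives norm limits by
  \<open>operators_limit\<close>, and for the operators used later the adjoint is explicit.\<close>

definition operators :: "('i ell2 \<Rightarrow>\<^sub>L 'i ell2) set" where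
  "operators = {T. (\<forall>c x. blinfun_apply T (cscale c x) = cscale c (blinfun_apply T x)) \<and> (\<exists>S. is_adjoint T S)}"

lemma is_adjoint_unique: "is_adjoint T S \<Longrightarrow> is_adjoint T S' \<Longrightarrow> S = S'"
  by (rule blinfun_eqI, rule ell2_eqI_inner) (metis is_adjoint_def)

lemma adjoint_op_eqI: "is_adjoint T S \<Longrightarrow> adjoint_op T = S"
  unfolding adjoint_op_def using is_adjoint_unique by blast

lemma is_adjoint_sym: "is_adjoint T S \<Longrightarrow> is_adjoint S T"
  unfolding is_adjoint_def by (metis inner_commute)

lemma operatorsI:
  fixes T :: "'i ell2 \<Rightarrow>\<^sub>L 'i ell2"
  shows "(\<And>c x. T (cscale c x) = cscale c (T x)) \<Longrightarrow> is_adjoint T S \<Longrightarrow> T \<in> operators"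
  by (auto simp: operators_def)

lemma operatorsD:
  fixes T :: "'i ell2 \<Rightarrow>\<^sub>L 'i ell2"
  shows "T \<in> operators \<Longrightarrow> T (cscale c x) = cscale c (T x)"
  "T \<in> operators \<Longrightarrow> is_adjoint T (adjoint_op T)"
  unfolding operators_def using adjoint_op_eqI by fastforce+

lemma is_adjoint_clinear:
  fixes T S :: "'i ell2 \<Rightarrow>\<^sub>L 'i ell2"
  assumes "T \<in> operators" "is_adjoint T S" shows "S (cscale c y) = cscale c (S y)"
proof (rule ell2_eqI_inner)
  fix j :: 'i and b
  let ?x = "delta j b"
  have "inner ?x (S (cscale c y)) = inner (T ?x) (cscale c y)"
    using assms(2) by (simp add: is_adjoint_def)
  also have "\<dots> = inner (T (cscale (cnj c) ?x)) y"
    using operatorsD(1)[OF assms(1)] by (simp add: inner_cscale_left)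
  also have "\<dots> = inner ?x (cscale c (S y))"
    using assms(2) by (simp add: is_adjoint_def inner_cscale_left)
  finally show "inner ?x (S (cscale c y)) = inner ?x (cscale c (S y))" .
qed

lemma adjoint_op_in: "T \<in> operators \<Longrightarrow> adjoint_op T \<in> operators"
  using operatorsI is_adjoint_clinear is_adjoint_sym operatorsD(2) by metis

lemma adjoint_op_adjoint_op: "T \<in> operators \<Longrightarrow> adjoint_op (adjoint_op T) = T"
  using adjoint_op_eqI is_adjoint_sym operatorsD(2) by blast

lemma is_adjoint_add: "is_adjoint T S \<Longrightarrow> is_adjoint T' S' \<Longrightarrow> is_adjoint (T + T') (S + S')"
  by (simp add: is_adjoint_def blinfun.add_left inner_add_left inner_add_right)

lemma is_adjoint_diff: "is_adjoint T S \<Longrightarrow> is_adjoint T' S' \<Longrightarrow> is_adjoint (T - T') (S - S')"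
  by (simp add: is_adjoint_def blinfun.diff_left inner_diff_left inner_diff_right)

lemma is_adjoint_compose: "is_adjoint T S \<Longrightarrow> is_adjoint T' S' \<Longrightarrow> is_adjoint (T o\<^sub>L T') (S' o\<^sub>L S)"
  by (simp add: is_adjoint_def)

lemma is_adjoint_cscale: "is_adjoint (cscale_op c) (cscale_op (cnj c))"
  by (simp add: is_adjoint_def inner_cscale_left)

lemma cscale_add: "cscale c (x + y) = cscale c x + cscale c y"
  "cscale c (x - y) = cscale c x - cscale c y" "cscale b (cscale c x) = cscale (b * c) x"
  "cscale (b + c) x = cscale b x + cscale c x" "cscale 1 x = x" "cscale c 0 = 0"
  by (auto intro!: ell2_eqI simp: algebra_simps)

lemma operators_zero: "0 \<in> operators"
  by (rule operatorsI[of _ 0]) (auto simp: is_adjoint_def cscale_add)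

lemma operators_add: "T \<in> operators \<Longrightarrow> T' \<in> operators \<Longrightarrow> T + T' \<in> operators"
  by (rule operatorsI[OF _ is_adjoint_add[OF operatorsD(2) operatorsD(2)]])
    (auto simp: blinfun.add_left cscale_add operatorsD(1))

lemma operators_diff: "T \<in> operators \<Longrightarrow> T' \<in> operators \<Longrightarrow> T - T' \<in> operators"
  by (rule operatorsI[OF _ is_adjoint_diff[OF operatorsD(2) operatorsD(2)]])
    (auto simp: blinfun.diff_left cscale_add operatorsD(1))

lemma operators_compose: "T \<in> operators \<Longrightarrow> T' \<in> operators \<Longrightarrow> T o\<^sub>L T' \<in> operators"
  by (rule operatorsI[OF _ is_adjoint_compose[OF operatorsD(2) operatorsD(2)]]) (auto simp: operatorsD(1))

lemma operators_cscale: "cscale_op c \<in> operators"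
  using is_adjoint_cscale by (intro operatorsI) (auto simp: cscale_add mult.commute)

lemma operators_commute_cscale: "T \<in> operators \<Longrightarrow> T o\<^sub>L cscale_op c = cscale_op c o\<^sub>L T"
  by (rule blinfun_eqI) (simp add: operatorsD)

lemma adjoint_op_add: "T \<in> operators \<Longrightarrow> T' \<in> operators \<Longrightarrow> adjoint_op (T + T') = adjoint_op T + adjoint_op T'"
  by (intro adjoint_op_eqI is_adjoint_add operatorsD)

lemma adjoint_op_compose:
  "T \<in> operators \<Longrightarrow> T' \<in> operators \<Longrightarrow> adjoint_op (T o\<^sub>L T') = adjoint_op T' o\<^sub>L adjoint_op T"
  by (intro adjoint_op_eqI is_adjoint_compose operatorsD)

text \<open>By Cauchy-Schwarz, the square of the norm of \<open>T x\<close> is the inner product of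
  \<open>x\<close> with \<open>S T x\<close>, hence at most the norm of \<open>S T\<close> times the
  square of the norm of \<open>x\<close>.\<close>

lemma norm_is_adjoint_compose:
  assumes "is_adjoint T S" shows "norm (S o\<^sub>L T) = (norm T)\<^sup>2" "norm S = norm T"
proof -
  have le: "(norm T)\<^sup>2 \<le> norm (S o\<^sub>L T)" if "is_adjoint T S" for T S :: "'a ell2 \<Rightarrow>\<^sub>L 'a ell2"
  proof -
    have "norm (T x) \<le> sqrt (norm (S o\<^sub>L T)) * norm x" for x
    proof -
      have "(norm (T x))\<^sup>2 = inner x ((S o\<^sub>L T) x)"
        using that by (simp add: is_adjoint_def power2_norm_eq_inner)
      also have "\<dots> \<le> norm x * norm ((S o\<^sub>L T) x)" by (rule norm_cauchy_schwarz)
      also have "\<dots> \<le> norm x * (norm (S o\<^sub>L T) * norm x)"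
        by (intro mult_left_mono norm_blinfun) auto
      also have "\<dots> = (sqrt (norm (S o\<^sub>L T)) * norm x)\<^sup>2"
        by (simp add: power_mult_distrib power2_eq_square)
      finally show ?thesis by (rule power2_le_imp_le) auto
    qed
    then have "norm T \<le> sqrt (norm (S o\<^sub>L T))" by (intro norm_blinfun_bound) auto
    then have "(norm T)\<^sup>2 \<le> (sqrt (norm (S o\<^sub>L T)))\<^sup>2" by (intro power_mono) auto
    then show ?thesis by simp
  qed
  have le2: "norm T \<le> norm S" if "is_adjoint T S" for T S :: "'a ell2 \<Rightarrow>\<^sub>L 'a ell2"
  proof (cases "norm T = 0")
    case False
    have "norm T * norm T \<le> norm S * norm T"
      using le[OF that] norm_blinfun_compose[of S T] by (simp add: power2_eq_square)
    then show ?thesis using False by simp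
  qed simp
  show "norm S = norm T" using le2[OF assms] le2[OF is_adjoint_sym[OF assms]] by simp
  then show "norm (S o\<^sub>L T) = (norm T)\<^sup>2"
    using le[OF assms] norm_blinfun_compose[of S T] by (simp add: power2_eq_square)
qed

lemma norm_adjoint_op_diff:
  assumes "T \<in> operators" "T' \<in> operators" shows "norm (adjoint_op T - adjoint_op T') = norm (T - T')"
  using norm_is_adjoint_compose(2)[OF is_adjoint_diff[OF operatorsD(2) operatorsD(2)]] assms by blast

lemma norm_cscale_op_compose:
  fixes T :: "'a ell2 \<Rightarrow>\<^sub>L 'a ell2"
  shows "norm (cscale_op c o\<^sub>L T) = cmod c * norm T"
proof -
  have le: "norm (cscale_op c o\<^sub>L T) \<le> cmod c * norm T" for c and T :: "'a ell2 \<Rightarrow>\<^sub>L 'a ell2"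
  proof (rule norm_blinfun_bound)
    fix x
    have "norm ((cscale_op c o\<^sub>L T) x) = cmod c * norm (T x)" by (simp add: norm_cscale)
    also have "\<dots> \<le> cmod c * (norm T * norm x)" by (intro mult_left_mono norm_blinfun) auto
    finally show "norm ((cscale_op c o\<^sub>L T) x) \<le> cmod c * norm T * norm x" by (simp add: mult.assoc)
  qed simp
  show ?thesis
  proof (cases "c = 0")
    case False
    have "T = cscale_op (inverse c) o\<^sub>L (cscale_op c o\<^sub>L T)"
      using False by (intro blinfun_eqI) (simp add: cscale_add)
    then have "norm T \<le> inverse (cmod c) * norm (cscale_op c o\<^sub>L T)"
      using le[of "inverse c" "cscale_op c o\<^sub>L T"] by (simp add: norm_inverse)
    then show ?thesis using le[of c T] False by (simp add: field_simps)
  qed (use le[of 0 T] in simp)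
qed

text \<open>The adjoint is isometric, so the adjoints form a Cauchy sequence as well, and their
  limit is adjoint to \<open>L\<close>.\<close>

lemma operators_limit:
  fixes T :: "nat \<Rightarrow> 'i ell2 \<Rightarrow>\<^sub>L 'i ell2"
  assumes T: "\<And>n. T n \<in> operators" and lim: "T \<longlonglongrightarrow> L" shows "L \<in> operators"
proof -
  have "Cauchy (\<lambda>n. adjoint_op (T n))"
    using LIMSEQ_imp_Cauchy[OF lim] unfolding Cauchy_iff by (simp add: norm_adjoint_op_diff T)
  then obtain S where S: "(\<lambda>n. adjoint_op (T n)) \<longlonglongrightarrow> S"
    by (auto simp: Cauchy_convergent_iff convergent_def)
  have ap: "(\<lambda>n. T n x) \<longlonglongrightarrow> L x" for x by (intro tendsto_intros lim)
  show ?thesis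
  proof (rule operatorsI)
    fix c x
    have "(\<lambda>n. T n (cscale c x)) \<longlonglongrightarrow> cscale c (L x)"
      unfolding operatorsD(1)[OF T] by (intro bounded_linear.tendsto[OF bounded_linear_cscale] ap)
    then show "L (cscale c x) = cscale c (L x)" using ap LIMSEQ_unique by blast
  next
    have "inner (L x) y = inner x (S y)" for x y
    proof (rule LIMSEQ_unique)
      show "(\<lambda>n. inner (T n x) y) \<longlonglongrightarrow> inner (L x) y" by (intro tendsto_intros ap)
      have "(\<lambda>n. inner x (adjoint_op (T n) y)) \<longlonglongrightarrow> inner x (S y)" by (intro tendsto_intros S)
      then show "(\<lambda>n. inner (T n x) y) \<longlonglongrightarrow> inner x (S y)"
        using operatorsD(2)[OF T] by (simp add: is_adjoint_def)
    qed
    then show "is_adjoint L S" by (simp add: is_adjoint_def)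
  qed
qed

subsection \<open>Operators of partial bijections\<close>

text \<open>The operator has matrix entry 1 at the pairs of \<open>R\<close>: row \<open>i\<close>
  reads coordinate \<open>j\<close>. With this orientation the composite of operators belongs to the
  relational product in the same order, and the adjoint to the converse.\<close>

definition pullback :: "('i \<times> 'i) set \<Rightarrow> 'i ell2 \<Rightarrow> 'i \<Rightarrow> complex" where
  "pullback R x i = (if \<exists>j. (i, j) \<in> R then coord x (THE j. (i, j) \<in> R) else 0)"

definition partial_bij :: "('i \<times> 'i) set \<Rightarrow> bool" where
  "partial_bij R \<longleftrightarrow> single_valued R \<and> single_valued (R\<inverse>)"

lemma pullback_eq: "single_valued R \<Longrightarrow> (i, j) \<in> R \<Longrightarrow> pullback R x i = coord x j"
  unfolding pullback_def single_valued_def by (metis (no_types, lifting) the_equality)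

lemma pullback_eq_0: "i \<notin> Domain R \<Longrightarrow> pullback R x i = 0"
  by (auto simp: pullback_def)

lemma pullback_bounded:
  assumes R: "partial_bij R" and F: "finite F"
  shows "(\<Sum>i\<in>F. (cmod (pullback R x i))\<^sup>2) \<le> (norm x)\<^sup>2"
proof -
  have sv: "single_valued R" using R by (simp add: partial_bij_def)
  define f where "f i = (THE j. (i, j) \<in> R)" for i
  have f: "(i, f i) \<in> R" if "i \<in> Domain R" for i
    using that sv unfolding f_def single_valued_def by (metis (no_types, lifting) Domain.cases the_equality)
  have fu: "f i = j" if "(i, j) \<in> R" for i j
    using that f sv unfolding single_valued_def by blast
  have inj: "inj_on f (F \<inter> Domain R)"
    using f R unfolding inj_on_def partial_bij_def single_valued_def by (metis IntE converse.intros)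
  have "(\<Sum>i\<in>F. (cmod (pullback R x i))\<^sup>2) = (\<Sum>i\<in>F \<inter> Domain R. (cmod (coord x (f i)))\<^sup>2)"
    using F f sv by (intro sum.mono_neutral_cong_right) (auto simp: pullback_eq_0 pullback_eq fu)
  also have "\<dots> = (\<Sum>j\<in>f ` (F \<inter> Domain R). (cmod (coord x j))\<^sup>2)"
    by (simp add: sum.reindex[OF inj])
  also have "\<dots> \<le> (norm x)\<^sup>2" using F by (intro sum_coord_le) auto
  finally show ?thesis .
qed

definition bij_op :: "('i \<times> 'i) set \<Rightarrow> 'i ell2 \<Rightarrow>\<^sub>L 'i ell2" where
  "bij_op R = Blinfun (\<lambda>x. Ell2 (pullback R x))"

lemma coord_bij_op:
  assumes R: "partial_bij R" shows "coord (bij_op R x) i = pullback R x i"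
proof -
  have ex: "\<exists>y. coord y = pullback R x \<and> norm y \<le> norm x" for x
    using ell2_of_bounded_sums[of "pullback R x" "norm x"] pullback_bounded[OF R] by (metis norm_ge_zero)
  then have c: "coord (Ell2 (pullback R x)) = pullback R x" "norm (Ell2 (pullback R x)) \<le> norm x" for x
    by (metis coord_inverse)+
  have "bounded_linear (\<lambda>x. Ell2 (pullback R x))"
  proof (rule bounded_linear_intro[of _ 1])
    show "Ell2 (pullback R (x + y)) = Ell2 (pullback R x) + Ell2 (pullback R y)" for x y
      by (rule ell2_eqI) (simp add: c, simp add: pullback_def)
    show "Ell2 (pullback R (r *\<^sub>R x)) = r *\<^sub>R Ell2 (pullback R x)" for r x
      by (rule ell2_eqI) (simp add: c, simp add: pullback_def)
  qed (simp add: c)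
  then show ?thesis by (simp add: bij_op_def bounded_linear_Blinfun_apply c)
qed

lemma bij_op_eqI:
  fixes T :: "'i ell2 \<Rightarrow>\<^sub>L 'i ell2"
  assumes "partial_bij R" "\<And>x i j. (i, j) \<in> R \<Longrightarrow> coord (T x) i = coord x j"
    "\<And>x i. i \<notin> Domain R \<Longrightarrow> coord (T x) i = 0"
  shows "bij_op R = T"
proof (rule blinfun_eqI, rule ell2_eqI)
  fix x i
  show "coord (bij_op R x) i = coord (T x) i"
    using assms by (cases "i \<in> Domain R") (auto simp: coord_bij_op pullback_eq_0 pullback_eq partial_bij_def)
qed

lemma coord_bij_op_eq:
  "partial_bij R \<Longrightarrow> (i, j) \<in> R \<Longrightarrow> coord (bij_op R x) i = coord x j"
  "partial_bij R \<Longrightarrow> i \<notin> Domain R \<Longrightarrow> coord (bij_op R x) i = 0"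
  by (auto simp: coord_bij_op pullback_eq pullback_eq_0 partial_bij_def)

lemma partial_bij_converse: "partial_bij R \<Longrightarrow> partial_bij (R\<inverse>)"
  by (simp add: partial_bij_def)

lemma partial_bij_comp: "partial_bij R \<Longrightarrow> partial_bij S \<Longrightarrow> partial_bij (R O S)"
  by (simp add: partial_bij_def converse_relcomp single_valued_relcomp)

lemma partial_bij_Id_on: "partial_bij (Id_on V)"
  by (auto simp: partial_bij_def single_valued_def)

lemma bij_op_compose:
  assumes R: "partial_bij R" and S: "partial_bij S" shows "bij_op R o\<^sub>L bij_op S = bij_op (R O S)"
proof (rule bij_op_eqI[symmetric])
  show "partial_bij (R O S)" using R S by (rule partial_bij_comp)
  show "coord ((bij_op R o\<^sub>L bij_op S) x) i = coord x j" if "(i, j) \<in> R O S" for x i j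
    using that R S by (auto simp: coord_bij_op_eq)
  show "coord ((bij_op R o\<^sub>L bij_op S) x) i = 0" if "i \<notin> Domain (R O S)" for x i
  proof (cases "i \<in> Domain R")
    case True
    then obtain j where "(i, j) \<in> R" by blast
    moreover from this that have "j \<notin> Domain S" by blast
    ultimately show ?thesis using R S by (simp add: coord_bij_op_eq)
  qed (simp add: R coord_bij_op_eq)
qed

lemma bij_op_empty: "bij_op {} = 0"
  by (rule bij_op_eqI) (auto simp: partial_bij_def)

lemma bij_op_Un:
  assumes RS: "partial_bij (R \<union> S)" and "R \<inter> S = {}" shows "bij_op (R \<union> S) = bij_op R + bij_op S"
proof (rule bij_op_eqI[OF RS])
  have R: "partial_bij R" and S: "partial_bij S"
    using RS by (auto simp: partial_bij_def single_valued_def)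
  have disj: "Domain R \<inter> Domain S = {}"
    using RS assms(2) unfolding partial_bij_def single_valued_def by blast
  show "coord ((bij_op R + bij_op S) x) i = coord x j" if "(i, j) \<in> R \<union> S" for x i j
  proof (cases "(i, j) \<in> R")
    case True
    then have "i \<notin> Domain S" using disj by blast
    then show ?thesis using True R S by (simp add: blinfun.add_left coord_bij_op_eq)
  next
    case False
    then have "(i, j) \<in> S" using that by blast
    then have "i \<notin> Domain R" using disj by blast
    then show ?thesis using \<open>(i, j) \<in> S\<close> R S by (simp add: blinfun.add_left coord_bij_op_eq)
  qed
  show "coord ((bij_op R + bij_op S) x) i = 0" if "i \<notin> Domain (R \<union> S)" for x i
    using that R S by (simp add: blinfun.add_left coord_bij_op_eq Domain_Un_eq)
qed

lemma bij_op_eq_0_iff: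
  assumes "partial_bij R" shows "bij_op R = 0 \<longleftrightarrow> R = {}"
proof
  assume 0: "bij_op R = 0"
  show "R = {}"
  proof (rule ccontr)
    assume "R \<noteq> {}"
    then obtain i j where "(i, j) \<in> R" by auto
    then have "coord (bij_op R (delta j 1)) i = 1" using assms by (simp add: coord_bij_op_eq)
    then show False by (simp add: 0)
  qed
qed (simp add: bij_op_empty)

lemma is_adjoint_bij_op:
  assumes R: "partial_bij R" shows "is_adjoint (bij_op R) (bij_op (R\<inverse>))"
  unfolding is_adjoint_def
proof (intro allI)
  fix x y
  have sv: "single_valued R" "single_valued (R\<inverse>)" using R by (auto simp: partial_bij_def)
  define f where "f i = (THE j. (i, j) \<in> R)" for i
  have f: "(i, f i) \<in> R" if "i \<in> Domain R" for i
    using that sv(1) unfolding f_def single_valued_def by (metis (no_types, lifting) Domain.cases the_equality)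
  have fu: "f i = j" if "(i, j) \<in> R" for i j
    using that f sv(1) unfolding single_valued_def by blast
  have bij: "bij_betw f (Domain R) (Range R)"
    unfolding bij_betw_def inj_on_def
  proof (intro conjI ballI impI)
    show "i = i'" if "i \<in> Domain R" "i' \<in> Domain R" "f i = f i'" for i i'
      using f[OF that(1)] f[OF that(2)] that(3) sv(2) unfolding single_valued_def by (metis converse.intros)
    show "f ` Domain R = Range R"
      using f sv(1) unfolding single_valued_def by (auto simp: image_iff) (metis Domain.DomainI)
  qed
  note C = coord_bij_op_eq[OF R] coord_bij_op_eq[OF partial_bij_converse[OF R]]
  have "inner (bij_op R x) y = (\<Sum>\<^sub>\<infinity>i\<in>Domain R. coord x (f i) \<bullet> coord y i)"
    unfolding inner_ell2_def by (rule infsum_cong_neutral) (auto simp: C(1,2) fu)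
  also have "\<dots> = (\<Sum>\<^sub>\<infinity>i\<in>Domain R. coord x (f i) \<bullet> coord (bij_op (R\<inverse>) y) (f i))"
    by (intro infsum_cong) (simp add: C(3)[OF converseI[OF f]])
  also have "\<dots> = (\<Sum>\<^sub>\<infinity>j\<in>Range R. coord x j \<bullet> coord (bij_op (R\<inverse>) y) j)"
    by (rule infsum_reindex_bij_betw[OF bij])
  also have "\<dots> = inner x (bij_op (R\<inverse>) y)"
    unfolding inner_ell2_def by (rule infsum_cong_neutral) (use C(4) in auto)
  finally show "inner (bij_op R x) y = inner x (bij_op (R\<inverse>) y)" .
qed

lemma bij_op_in_operators: "partial_bij R \<Longrightarrow> bij_op R \<in> operators"
proof (rule operatorsI[OF _ is_adjoint_bij_op])
  fix c x assume R: "partial_bij R"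
  show "bij_op R (cscale c x) = cscale c (bij_op R x)"
    by (rule ell2_eqI) (simp add: coord_bij_op[OF R], simp add: pullback_def)
qed

lemma adjoint_op_bij_op: "partial_bij R \<Longrightarrow> adjoint_op (bij_op R) = bij_op (R\<inverse>)"
  by (intro adjoint_op_eqI is_adjoint_bij_op)

section \<open>Linear spans, and scalar multiples of projections modulo an ideal\<close>

context cstar_algebra
begin

definition lin_span :: "'a set \<Rightarrow> 'a set" where
  "lin_span X = \<Inter> {S. linear_subspace S \<and> X \<subseteq> S}"

lemma linear_subspace_lin_span:
  assumes "X \<subseteq> carrier A" shows "linear_subspace (lin_span X)"
proof -
  have "linear_subspace (carrier A)" by (simp add: linear_subspace_def)
  then show ?thesis
    using assms unfolding lin_span_def linear_subspace_def by (auto 0 3)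
qed

lemma lin_span_base: "x \<in> X \<Longrightarrow> x \<in> lin_span X"
  by (auto simp: lin_span_def)

lemma lin_span_minimal: "linear_subspace S \<Longrightarrow> X \<subseteq> S \<Longrightarrow> lin_span X \<subseteq> S"
  by (auto simp: lin_span_def)

lemma lin_span_mono: "X \<subseteq> Y \<Longrightarrow> lin_span X \<subseteq> lin_span Y"
  by (auto simp: lin_span_def)

lemma lin_span_carrier: "X \<subseteq> carrier A \<Longrightarrow> lin_span X \<subseteq> carrier A"
  by (rule lin_span_minimal) (simp_all add: linear_subspace_def)

lemma lin_span_induct [consumes 2, case_names base zero add smult]:
  assumes "x \<in> lin_span X" "X \<subseteq> carrier A"
    and "\<And>x. x \<in> X \<Longrightarrow> P x" "P \<zero>"
    and "\<And>x y. x \<in> carrier A \<Longrightarrow> y \<in> carrier A \<Longrightarrow> P x \<Longrightarrow> P y \<Longrightarrow> P (x \<oplus> y)"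
    and "\<And>z x. x \<in> carrier A \<Longrightarrow> P x \<Longrightarrow> P (z \<odot> x)"
  shows "P x"
proof -
  have "linear_subspace {x \<in> carrier A. P x}"
    using assms by (auto simp: linear_subspace_def)
  then show ?thesis
    using lin_span_minimal[of "{x \<in> carrier A. P x}" X] assms by blast
qed

lemma lin_span_mult:
  assumes X: "X \<subseteq> carrier A" and Y: "Y \<subseteq> carrier A" and S: "linear_subspace S"
    and m: "\<And>x y. x \<in> X \<Longrightarrow> y \<in> Y \<Longrightarrow> x \<otimes> y \<in> S"
    and x: "x \<in> lin_span X" and y: "y \<in> lin_span Y"
  shows "x \<otimes> y \<in> S"
proof -
  note D = linear_subspaceD[OF S]
  have 1: "a \<otimes> y \<in> S" if "a \<in> X" for a
    using y Y
  proof (induction rule: lin_span_induct)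
    case (base b) then show ?case using m that by blast
  qed (use that X D in \<open>auto simp: distrib_left smult_mult_right subset_iff\<close>)
  have yc: "y \<in> carrier A" using y lin_span_carrier[OF Y] by blast
  show ?thesis
    using x X
  proof (induction rule: lin_span_induct)
    case (base b) then show ?case using 1 by blast
  qed (use yc D in \<open>auto simp: distrib_right smult_mult_left\<close>)
qed

lemma lin_span_finite_combination:
  assumes fin: "finite I" and f: "f \<in> I \<rightarrow> carrier A" and x: "x \<in> lin_span (f ` I)"
  shows "\<exists>c. x = finsum A (\<lambda>i. c i \<odot> f i) I"
proof -
  have X: "f ` I \<subseteq> carrier A" and fc: "\<And>i. i \<in> I \<Longrightarrow> f i \<in> carrier A" using f by auto
  show ?thesis
    using x X
  proof (induction rule: lin_span_induct)
    case (base y)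
    then obtain j where j: "j \<in> I" "y = f j" by blast
    have "finsum A (\<lambda>i. (if i = j then 1 else 0) \<odot> f i) I = finsum A (\<lambda>i. if i = j then f i else \<zero>) I"
      using fc by (intro M.finsum_cong') auto
    also have "\<dots> = f j"
      using M.finsum_singleton[of j I f] j fin f by (auto simp: eq_commute)
    finally show ?case using j(2) by (intro exI[of _ "\<lambda>i. if i = j then 1 else 0"]) simp
  next
    case zero
    have "finsum A (\<lambda>i. 0 \<odot> f i) I = \<zero>"
    proof -
      have "finsum A (\<lambda>i. 0 \<odot> f i) I = finsum A (\<lambda>i. \<zero>) I"
        using fc by (intro M.finsum_cong') auto
      then show ?thesis by simp
    qed
    then show ?case by (intro exI[of _ "\<lambda>_. 0"]) simp
  next
    case (add x y)
    then obtain b c where "x = finsum A (\<lambda>i. b i \<odot> f i) I" "y = finsum A (\<lambda>i. c i \<odot> f i) I" by blast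
    then have "x \<oplus> y = finsum A (\<lambda>i. b i \<odot> f i \<oplus> c i \<odot> f i) I"
      using f by (subst M.finsum_addf) auto
    also have "\<dots> = finsum A (\<lambda>i. (b i + c i) \<odot> f i) I"
      using fc by (intro M.finsum_cong') auto
    finally show ?case by (intro exI[of _ "\<lambda>i. b i + c i"]) simp
  next
    case (smult z x)
    then obtain b where "x = finsum A (\<lambda>i. b i \<odot> f i) I" by blast
    then have "z \<odot> x = finsum A (\<lambda>i. z \<odot> (b i \<odot> f i)) I"
      using f by (simp add: smult_finsum Pi_iff)
    also have "\<dots> = finsum A (\<lambda>i. (z * b i) \<odot> f i) I"
      using fc by (intro M.finsum_cong') auto
    finally show ?case by (intro exI[of _ "\<lambda>i. z * b i"]) simp
  qed
qed

text \<open>Otherwise division by \<open>z\<close> would put \<open>p\<close> at distance less than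
  1 from \<open>I\<close>, hence into \<open>I\<close>. This says that \<open>z p\<close> has norm
  at least the modulus of \<open>z\<close> modulo \<open>I\<close>.\<close>

lemma ideal_scalar_projection:
  assumes I: "algebra_ideal I" and p: "p \<in> carrier A" "p \<otimes> p = p" "star A p = p" "p \<notin> I"
    and i: "i \<in> I" "cnorm A (z \<odot> p \<ominus> i) \<le> \<epsilon>" 
  shows "cmod z \<le> \<epsilon>"
proof (rule ccontr)
  assume *: "\<not> ?thesis"
  have ic: "i \<in> carrier A" using i(1) linear_subspaceD(1)[OF algebra_idealD(1)[OF I]] by blast
  have "0 \<le> \<epsilon>" using order.trans[OF cnorm_nonneg i(2)] p ic by simp
  then have z: "z \<noteq> 0" "cmod z > 0" using * by auto
  have "p \<ominus> inverse z \<odot> i = inverse z \<odot> (z \<odot> p \<ominus> i)"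
    using p ic z by (simp add: smult_minus)
  then have "cnorm A (p \<ominus> inverse z \<odot> i) = inverse (cmod z) * cnorm A (z \<odot> p \<ominus> i)"
    using p ic by (simp add: cnorm_smult norm_inverse)
  also have "\<dots> \<le> inverse (cmod z) * \<epsilon>" using i(2) z by (intro mult_left_mono) auto
  also have "\<dots> < 1" using * z by (simp add: field_simps)
  finally have "p \<in> I"
    using projection_mem_ideal[OF I p(1-3)] linear_subspaceD(4)[OF algebra_idealD(1)[OF I] i(1)] by blast
  then show False using p(4) by simp
qed

end

section \<open>Cuntz-Krieger families\<close>

locale graph_algebra = kgraph \<Lambda> + cstar_algebra A + CK_family \<Lambda> A s
  for \<Lambda> :: "('l, 'k::finite) kgraph" and A :: "'a cstar_struct" (structure) and s :: "'l \<Rightarrow> 'a" +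
  assumes fa: "finitely_aligned \<Lambda>"
begin

declare closed [simp]

abbreviation unit_elem :: "'l \<Rightarrow> 'l \<Rightarrow> 'a" (\<open>\<Theta>\<close>) where "\<Theta> \<mu> \<nu> \<equiv> s \<mu> \<otimes> star A (s \<nu>)"

lemma s_vertex:
  assumes "v \<in> vertices \<Lambda>"
  shows "s v \<in> carrier A" "s v \<otimes> s v = s v" "star A (s v) = s v"
  using assms CK1_projection vertexD(1) by auto

lemma s_comp: "composable \<mu> \<nu> \<Longrightarrow> s \<mu> \<otimes> s \<nu> = s (\<mu> \<cdot> \<nu>)"
  by (simp add: composable_def CK2)

lemma s_absorb:
  assumes "\<mu> \<in> paths \<Lambda>"
  shows "s \<mu> \<otimes> s (src \<Lambda> \<mu>) = s \<mu>" "s (rng \<Lambda> \<mu>) \<otimes> s \<mu> = s \<mu>"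
    "s (src \<Lambda> \<mu>) \<otimes> star A (s \<mu>) = star A (s \<mu>)" "star A (s \<mu>) \<otimes> s (rng \<Lambda> \<mu>) = star A (s \<mu>)"
proof -
  show 1: "s \<mu> \<otimes> s (src \<Lambda> \<mu>) = s \<mu>" "s (rng \<Lambda> \<mu>) \<otimes> s \<mu> = s \<mu>"
    using assms by (simp_all add: s_comp composable_src composable_rng cmp_src cmp_rng)
  show "s (src \<Lambda> \<mu>) \<otimes> star A (s \<mu>) = star A (s \<mu>)" "star A (s \<mu>) \<otimes> s (rng \<Lambda> \<mu>) = star A (s \<mu>)"
    using assms 1 by (metis star_mult closed s_vertex(3) src_vertex src_closed)
      (metis assms 1 star_mult closed s_vertex(3) rng_vertex rng_closed)
qed

lemma s_star_s:
  assumes "\<mu> \<in> paths \<Lambda>" "\<nu> \<in> paths \<Lambda>"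
  shows "star A (s \<mu>) \<otimes> s \<nu> = (\<Oplus>p\<in>mce_pairs \<mu> \<nu>. \<Theta> (fst p) (snd p))"
  using CK3[OF assms] by (simp add: mce_pairs_eq[OF assms])

lemma s_star_s_eq_zero:
  assumes "\<mu> \<in> paths \<Lambda>" "\<nu> \<in> paths \<Lambda>" "\<And>\<kappa>. \<mu> \<preceq> \<kappa> \<Longrightarrow> \<nu> \<preceq> \<kappa> \<Longrightarrow> False"
  shows "star A (s \<mu>) \<otimes> s \<nu> = \<zero>"
proof -
  have "mce_pairs \<mu> \<nu> = {}" using assms(3) by (auto simp: mce_pairs_def MCE_iff)
  then show ?thesis using s_star_s[OF assms(1,2)] by simp
qed

text \<open>A path has no other minimal common extension with itself than itself, so the sum in
  (CK3) reduces to one term.\<close>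

lemma s_star_s_same:
  assumes m: "\<mu> \<in> paths \<Lambda>" shows "star A (s \<mu>) \<otimes> s \<mu> = s (src \<Lambda> \<mu>)"
proof -
  have "mce_pairs \<mu> \<mu> = {(src \<Lambda> \<mu>, src \<Lambda> \<mu>)}"
  proof (intro equalityI subsetI)
    fix p assume p: "p \<in> mce_pairs \<mu> \<mu>"
    note D = mce_pairsD[OF p]
    have "\<mu> \<cdot> fst p = \<mu>"
      using D(1,4) m initial_unique[of "\<mu> \<cdot> fst p" "\<mu> \<cdot> fst p" \<mu>] initial_cmp initial_refl composableD(4)
        vjoin_absorb(1)[of "d \<mu>" "d \<mu>"] by (auto simp: MCE_iff)
    then have "fst p = src \<Lambda> \<mu>" "snd p = src \<Lambda> \<mu>"
      using D(1,2,3) m cmp_left_cancel composable_src cmp_src by metis+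
    then show "p \<in> {(src \<Lambda> \<mu>, src \<Lambda> \<mu>)}" by (cases p) simp
  next
    fix p assume "p \<in> {(src \<Lambda> \<mu>, src \<Lambda> \<mu>)}"
    then show "p \<in> mce_pairs \<mu> \<mu>"
      using m initial_refl vjoin_absorb(1)[of "d \<mu>" "d \<mu>"]
      by (auto simp: mce_pairs_def composable_src cmp_src MCE_iff)
  qed
  then show ?thesis
    using s_star_s[OF m m] s_vertex[OF src_vertex[OF m]] by simp
qed

lemma s_star_s_initial:
  assumes "composable \<mu> \<delta>" shows "star A (s \<mu>) \<otimes> s (\<mu> \<cdot> \<delta>) = s \<delta>" "star A (s (\<mu> \<cdot> \<delta>)) \<otimes> s \<mu> = star A (s \<delta>)"
proof -
  note D = composableD[OF assms]
  have "star A (s \<mu>) \<otimes> s (\<mu> \<cdot> \<delta>) = (star A (s \<mu>) \<otimes> s \<mu>) \<otimes> s \<delta>"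
    using s_comp[OF assms] D by (simp add: mult_assoc)
  then show 1: "star A (s \<mu>) \<otimes> s (\<mu> \<cdot> \<delta>) = s \<delta>"
    using D s_star_s_same s_absorb(2) by metis
  have "star A (star A (s \<mu>) \<otimes> s (\<mu> \<cdot> \<delta>)) = star A (s (\<mu> \<cdot> \<delta>)) \<otimes> s \<mu>"
    using D by (simp add: star_mult)
  then show "star A (s (\<mu> \<cdot> \<delta>)) \<otimes> s \<mu> = star A (s \<delta>)" using 1 by simp
qed

lemma s_star_s_orthogonal:
  assumes "\<mu> \<in> paths \<Lambda>" "\<nu> \<in> paths \<Lambda>" "d \<mu> = d \<nu>" "\<mu> \<noteq> \<nu>" shows "star A (s \<mu>) \<otimes> s \<nu> = \<zero>"
  by (rule s_star_s_eq_zero) (use assms initial_unique in blast)+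

lemma cnorm_s_le_1: "\<mu> \<in> paths \<Lambda> \<Longrightarrow> cnorm A (s \<mu>) \<le> 1"
  using cnorm_partial_isometry_le_1[OF _ _ s_star_s_same] s_vertex[OF src_vertex] by simp

text \<open>(CK3) expands the two middle factors; the tails found there are absorbed by the outer
  paths. So spans of such elements are subalgebras as soon as their index set is closed under this
  operation.\<close>

lemma unit_elem_mult:
  assumes m: "\<mu> \<in> paths \<Lambda>" "\<nu> \<in> paths \<Lambda>" "src \<Lambda> \<mu> = src \<Lambda> \<nu>"
    and r: "\<sigma> \<in> paths \<Lambda>" "\<rho> \<in> paths \<Lambda>" "src \<Lambda> \<sigma> = src \<Lambda> \<rho>"
  shows "\<Theta> \<mu> \<nu> \<otimes> \<Theta> \<sigma> \<rho> = (\<Oplus>p\<in>mce_pairs \<nu> \<sigma>. \<Theta> (\<mu> \<cdot> fst p) (\<rho> \<cdot> snd p))"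
proof -
  have cl: "(\<lambda>p. \<Theta> (fst p) (snd p)) \<in> mce_pairs \<nu> \<sigma> \<rightarrow> carrier A"
    using mce_pairsD by auto
  have c: "composable \<mu> (fst p)" "composable \<rho> (snd p)" if "p \<in> mce_pairs \<nu> \<sigma>" for p
    using mce_pairsD[OF that] m r by (auto simp: composable_def)
  have "\<Theta> \<mu> \<nu> \<otimes> \<Theta> \<sigma> \<rho> = s \<mu> \<otimes> (star A (s \<nu>) \<otimes> s \<sigma>) \<otimes> star A (s \<rho>)"
    using m r by (simp add: mult_assoc)
  also have "\<dots> = (\<Oplus>p\<in>mce_pairs \<nu> \<sigma>. s \<mu> \<otimes> \<Theta> (fst p) (snd p) \<otimes> star A (s \<rho>))"
  proof -
    have "(\<lambda>p. s \<mu> \<otimes> \<Theta> (fst p) (snd p)) \<in> mce_pairs \<nu> \<sigma> \<rightarrow> carrier A"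
      by (rule Pi_I) (use mce_pairsD(6,7) m(1) in simp)
    then show ?thesis
      using m(1) r(2) by (simp add: s_star_s[OF m(2) r(1)] mult_finsum_left[OF cl] mult_finsum_right)
  qed
  also have "\<dots> = (\<Oplus>p\<in>mce_pairs \<nu> \<sigma>. \<Theta> (\<mu> \<cdot> fst p) (\<rho> \<cdot> snd p))"
  proof (rule M.finsum_cong')
    fix p assume p: "p \<in> mce_pairs \<nu> \<sigma>"
    have "s (\<mu> \<cdot> fst p) = s \<mu> \<otimes> s (fst p)" "star A (s (\<rho> \<cdot> snd p)) = star A (s (snd p)) \<otimes> star A (s \<rho>)"
      using c[OF p] mce_pairsD[OF p] r by (simp_all add: s_comp star_mult flip: s_comp)
    then show "s \<mu> \<otimes> \<Theta> (fst p) (snd p) \<otimes> star A (s \<rho>) = \<Theta> (\<mu> \<cdot> fst p) (\<rho> \<cdot> snd p)"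
      using mce_pairsD(6,7)[OF p] m r by (simp add: mult_assoc)
  qed (use c composableD in auto)
  finally show ?thesis .
qed

lemma star_unit_elem: "\<mu> \<in> paths \<Lambda> \<Longrightarrow> \<nu> \<in> paths \<Lambda> \<Longrightarrow> star A (\<Theta> \<mu> \<nu>) = \<Theta> \<nu> \<mu>"
  by (simp add: star_mult)

subsection \<open>Spans of the products \<open>s\<^sub>\<mu> s\<^sub>\<nu>\<^sup>*\<close>\<close>

text \<open>The relation \<open>R\<close> covers all spans in use: the dense subalgebra (always
  true), the core (equal degrees), the intermediate stages of averaging (equal degrees in some
  coordinates), and the finite-dimensional pieces of the core.\<close>

definition unit_span :: "('l \<Rightarrow> 'l \<Rightarrow> bool) \<Rightarrow> 'a set" where
  "unit_span R = lin_span {\<Theta> \<mu> \<nu> |\<mu> \<nu>. \<mu> \<in> paths \<Lambda> \<and> \<nu> \<in> paths \<Lambda> \<and> src \<Lambda> \<mu> = src \<Lambda> \<nu> \<and> R \<mu> \<nu>}"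

lemma unit_span_gens_carrier:
  "{\<Theta> \<mu> \<nu> |\<mu> \<nu>. \<mu> \<in> paths \<Lambda> \<and> \<nu> \<in> paths \<Lambda> \<and> src \<Lambda> \<mu> = src \<Lambda> \<nu> \<and> R \<mu> \<nu>} \<subseteq> carrier A"
  by auto

lemma unit_span_base:
  "\<mu> \<in> paths \<Lambda> \<Longrightarrow> \<nu> \<in> paths \<Lambda> \<Longrightarrow> src \<Lambda> \<mu> = src \<Lambda> \<nu> \<Longrightarrow> R \<mu> \<nu> \<Longrightarrow> \<Theta> \<mu> \<nu> \<in> unit_span R"
  unfolding unit_span_def by (rule lin_span_base) auto

lemma linear_subspace_unit_span: "linear_subspace (unit_span R)"
  unfolding unit_span_def by (rule linear_subspace_lin_span[OF unit_span_gens_carrier])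

lemma unit_span_carrier: "x \<in> unit_span R \<Longrightarrow> x \<in> carrier A"
  using linear_subspaceD(1)[OF linear_subspace_unit_span] .

lemma unit_span_mono: "(\<And>\<mu> \<nu>. R \<mu> \<nu> \<Longrightarrow> R' \<mu> \<nu>) \<Longrightarrow> unit_span R \<subseteq> unit_span R'"
  unfolding unit_span_def by (rule lin_span_mono) blast

lemma unit_span_induct [consumes 1, case_names base zero add smult]:
  assumes "x \<in> unit_span R"
    "\<And>\<mu> \<nu>. \<mu> \<in> paths \<Lambda> \<Longrightarrow> \<nu> \<in> paths \<Lambda> \<Longrightarrow> src \<Lambda> \<mu> = src \<Lambda> \<nu> \<Longrightarrow> R \<mu> \<nu> \<Longrightarrow> P (\<Theta> \<mu> \<nu>)" "P \<zero>"
    "\<And>x y. x \<in> carrier A \<Longrightarrow> y \<in> carrier A \<Longrightarrow> P x \<Longrightarrow> P y \<Longrightarrow> P (x \<oplus> y)"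
    "\<And>z x. x \<in> carrier A \<Longrightarrow> P x \<Longrightarrow> P (z \<odot> x)"
  shows "P x"
  using assms(1) unit_span_gens_carrier[of R] unfolding unit_span_def
  by (induction rule: lin_span_induct) (use assms(2-) in blast)+

lemma unit_span_star:
  assumes "\<And>\<mu> \<nu>. R \<mu> \<nu> \<Longrightarrow> R \<nu> \<mu>" "x \<in> unit_span R" shows "star A x \<in> unit_span R"
  using assms(2)
  by (induction rule: unit_span_induct)
    (auto simp: star_unit_elem star_add star_smult linear_subspaceD[OF linear_subspace_unit_span]
      intro!: unit_span_base assms(1))

lemma unit_span_mult:
  assumes R: "\<And>\<mu> \<nu> \<sigma> \<rho> \<alpha> \<beta>. R \<mu> \<nu> \<Longrightarrow> R \<sigma> \<rho> \<Longrightarrow> src \<Lambda> \<mu> = src \<Lambda> \<nu> \<Longrightarrow> src \<Lambda> \<sigma> = src \<Lambda> \<rho> \<Longrightarrow>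
      composable \<nu> \<alpha> \<Longrightarrow> composable \<sigma> \<beta> \<Longrightarrow> \<nu> \<cdot> \<alpha> = \<sigma> \<cdot> \<beta> \<Longrightarrow>
      \<nu> \<cdot> \<alpha> \<in> MCE \<Lambda> \<nu> \<sigma> \<Longrightarrow> composable \<mu> \<alpha> \<Longrightarrow> composable \<rho> \<beta> \<Longrightarrow> R (\<mu> \<cdot> \<alpha>) (\<rho> \<cdot> \<beta>)"
    and x: "x \<in> unit_span R" and y: "y \<in> unit_span R"
  shows "x \<otimes> y \<in> unit_span R"
proof (rule lin_span_mult[OF unit_span_gens_carrier[of R] unit_span_gens_carrier[of R] linear_subspace_unit_span])
  fix x y
  assume "x \<in> {\<Theta> \<mu> \<nu> |\<mu> \<nu>. \<mu> \<in> paths \<Lambda> \<and> \<nu> \<in> paths \<Lambda> \<and> src \<Lambda> \<mu> = src \<Lambda> \<nu> \<and> R \<mu> \<nu>}"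
    "y \<in> {\<Theta> \<mu> \<nu> |\<mu> \<nu>. \<mu> \<in> paths \<Lambda> \<and> \<nu> \<in> paths \<Lambda> \<and> src \<Lambda> \<mu> = src \<Lambda> \<nu> \<and> R \<mu> \<nu>}"
  then obtain \<mu> \<nu> \<sigma> \<rho> where m: "x = \<Theta> \<mu> \<nu>" "\<mu> \<in> paths \<Lambda>" "\<nu> \<in> paths \<Lambda>" "src \<Lambda> \<mu> = src \<Lambda> \<nu>" "R \<mu> \<nu>"
    and r: "y = \<Theta> \<sigma> \<rho>" "\<sigma> \<in> paths \<Lambda>" "\<rho> \<in> paths \<Lambda>" "src \<Lambda> \<sigma> = src \<Lambda> \<rho>" "R \<sigma> \<rho>" by blast
  have "\<Theta> (\<mu> \<cdot> fst p) (\<rho> \<cdot> snd p) \<in> unit_span R" if p: "p \<in> mce_pairs \<nu> \<sigma>" for p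
  proof -
    note D = mce_pairsD[OF p]
    have c: "composable \<mu> (fst p)" "composable \<rho> (snd p)"
      using D m r by (auto simp: composable_def)
    show ?thesis
      using R[OF m(5) r(5) m(4) r(4) D(1,2,3,4) c] D(5) composableD[OF c(1)] composableD[OF c(2)]
      by (intro unit_span_base) auto
  qed
  then show "x \<otimes> y \<in> unit_span R"
    using unit_elem_mult[OF m(2-4) r(2-4)] m(1) r(1)
    by (simp add: linear_subspace_finsum[OF linear_subspace_unit_span])
qed (use x y in \<open>auto simp: unit_span_def\<close>)

lemma unit_span_dense:
  assumes "generates (s ` paths \<Lambda>) A" shows "norm_closure (unit_span (\<lambda>_ _. True)) = carrier A"
proof (rule generates_dense[OF assms linear_subspace_unit_span])
  show "s ` paths \<Lambda> \<subseteq> unit_span (\<lambda>_ _. True)"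
  proof
    fix x assume "x \<in> s ` paths \<Lambda>"
    then obtain \<mu> where m: "\<mu> \<in> paths \<Lambda>" "x = s \<mu>" by blast
    then have "x = \<Theta> \<mu> (src \<Lambda> \<mu>)"
      using s_vertex[OF src_vertex] s_absorb(1) by simp
    then show "x \<in> unit_span (\<lambda>_ _. True)"
      using m src_closed src_src unit_span_base[of \<mu> "src \<Lambda> \<mu>"] by simp
  qed
qed (simp_all add: unit_span_star unit_span_mult)

subsection \<open>Averaging over the gauge action\<close>

definition axis_torus :: "'k \<Rightarrow> complex \<Rightarrow> complex ^ 'k" where
  "axis_torus i z = (\<chi> j. if j = i then z else 1)"

lemma multi_power_axis: "multi_power (axis_torus i z) n = z ^ (n $ i)"
proof -
  have "multi_power (axis_torus i z) n = (\<Prod>j\<in>UNIV. if j = i then z ^ (n $ i) else 1)"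
    unfolding multi_power_def axis_torus_def by (intro prod.cong) auto
  then show ?thesis by (simp add: prod.delta)
qed

lemma sum_roots_of_unity:
  assumes "m < N" "n < N" "m \<noteq> n"
  shows "(\<Sum>k<N. cis (2 * pi * real k / real N) ^ m * cnj (cis (2 * pi * real k / real N) ^ n)) = 0"
proof -
  define z where "z = cis (2 * pi * (real m - real n) / real N)"
  have N: "real N > 0" using assms by simp
  have powers: "cis (2 * pi * real k / real N) ^ m * cnj (cis (2 * pi * real k / real N) ^ n) = z ^ k" for k
  proof -
    have "cis x ^ m * cnj (cis x ^ n) = cis (real m * x - real n * x)" for x
      by (simp add: Complex.DeMoivre cis_cnj cis_mult del: complex_cnj_power)
    moreover have "real m * (2 * pi * real k / real N) - real n * (2 * pi * real k / real N) =
        real k * (2 * pi * (real m - real n) / real N)"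
      by (simp add: algebra_simps diff_divide_distrib)
    ultimately show ?thesis by (simp only: z_def Complex.DeMoivre)
  qed
  have "z ^ N = cis (2 * pi * (real m - real n))" using N by (simp add: z_def Complex.DeMoivre)
  also have "\<dots> = 1" using cis_multiple_2pi[of "real m - real n"] by simp
  finally have zN: "z ^ N = 1" .
  \<comment> \<open>If \<open>z\<close> were 1, \<open>N\<close> would divide \<open>m - n\<close>,
    which is nonzero and smaller than \<open>N\<close> in absolute value.\<close>
  have "z \<noteq> 1"
  proof
    assume "z = 1"
    then have "cos (2 * pi * (real m - real n) / real N) = 1" by (simp add: z_def complex_eq_iff)
    then obtain j :: int where "2 * pi * (real m - real n) / real N = of_int j * 2 * pi"
      using cos_one_2pi_int by blast
    then have "(2 * pi) * (real m - real n) = (2 * pi) * (of_int j * real N)"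
      using N by (simp add: field_simps)
    then have "real m - real n = of_int j * real N" by (simp only: mult_cancel_left) simp
    then have "of_int (int m - int n) = (of_int (j * int N) :: real)" by simp
    then have *: "int m - int n = j * int N" by (simp only: of_int_eq_iff)
    have "\<bar>int m - int n\<bar> < int N" using assms by linarith
    then have "\<bar>j\<bar> * int N < 1 * int N" using * by (simp add: abs_mult)
    then have "j = 0" by (simp only: mult_less_cancel_right) simp
    then show False using * assms by simp
  qed
  then show ?thesis using zN by (simp add: powers geometric_sum del: complex_cnj_power)
qed

text \<open>Averages over roots of unity fix \<open>a\<close> and do not increase norms, so
  averaging an approximant keeps it within the same \<open>e\<close>. Each round treats one
  coordinate and annihilates the terms whose two degrees differ there.\<close>

lemma fixed_point_core_approx:
  assumes gen: "generates (s ` paths \<Lambda>) A" and \<gamma>: "is_gauge_action \<Lambda> A s \<gamma>"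
    and a: "a \<in> fixed_point_algebra A \<gamma>" and e: "e > 0"
  shows "\<exists>b\<in>unit_span (\<lambda>\<mu> \<nu>. d \<mu> = d \<nu>). cnorm A (a \<ominus> b) < e"
proof -
  have ac: "a \<in> carrier A" and afix: "\<And>z. z \<in> torus \<Longrightarrow> \<gamma> z a = a"
    using a by (auto simp: fixed_point_algebra_def)
  have hom: "\<gamma> z \<in> cstar_hom A A" if "z \<in> torus" for z
    using \<gamma> that by (auto simp: is_gauge_action_def cstar_auto_def)
  note H = cstar_homD[OF hom]
  have gs: "\<gamma> z (s \<mu>) = multi_power z (d \<mu>) \<odot> s \<mu>" if "z \<in> torus" "\<mu> \<in> paths \<Lambda>" for z \<mu>
    using \<gamma> that by (auto simp: is_gauge_action_def)
  have gu: "\<gamma> z (\<Theta> \<mu> \<nu>) = (multi_power z (d \<mu>) * cnj (multi_power z (d \<nu>))) \<odot> \<Theta> \<mu> \<nu>"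
    if "z \<in> torus" "\<mu> \<in> paths \<Lambda>" "\<nu> \<in> paths \<Lambda>" for z \<mu> \<nu>
    using that by (simp add: H gs star_smult smult_mult_left smult_mult_right mult.commute)
  have contr: "cnorm A (\<gamma> z x) \<le> cnorm A x" if "z \<in> torus" "x \<in> carrier A" for z x
    using cstar_hom_contractive[OF cstar_algebra_axioms cstar_algebra_axioms hom] that by blast
  define E where "E T = unit_span (\<lambda>\<mu> \<nu>. \<forall>i\<in>T. d \<mu> $ i = d \<nu> $ i)" for T
  have E: "linear_subspace (E T)" for T unfolding E_def by (rule linear_subspace_unit_span)
  have "\<exists>b\<in>E T. cnorm A (a \<ominus> b) < e" if "finite T" for T
    using that
  proof (induction T)
    case empty
    have "a \<in> norm_closure (unit_span (\<lambda>_ _. True))" using unit_span_dense[OF gen] ac by simp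
    then show ?case using norm_closureD(2) e by (simp add: E_def)
  next
    case (insert i T)
    then obtain b where b: "b \<in> E T" "cnorm A (a \<ominus> b) < e" by blast
    define \<omega> where "\<omega> N k = axis_torus i (cis (2 * pi * real k / real N))" for N k :: nat
    have \<omega>: "\<omega> N k \<in> torus" for N k by (auto simp: \<omega>_def torus_def axis_torus_def)
    define av where "av N x = (1 / of_nat N) \<odot> (\<Oplus>k\<in>{..<N}. \<gamma> (\<omega> N k) x)" for N x
    have cl: "(\<lambda>k. \<gamma> (\<omega> N k) x) \<in> {..<N} \<rightarrow> carrier A" if "x \<in> carrier A" for N x
      using H(1)[OF \<omega> that] by auto
    have av_add: "av N (x \<oplus> y) = av N x \<oplus> av N y" if "x \<in> carrier A" "y \<in> carrier A" for N x y
    proof -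
      have "(\<Oplus>k\<in>{..<N}. \<gamma> (\<omega> N k) (x \<oplus> y)) = (\<Oplus>k\<in>{..<N}. \<gamma> (\<omega> N k) x \<oplus> \<gamma> (\<omega> N k) y)"
        using H(1,2)[OF \<omega>] that by (intro M.finsum_cong') auto
      also have "\<dots> = (\<Oplus>k\<in>{..<N}. \<gamma> (\<omega> N k) x) \<oplus> (\<Oplus>k\<in>{..<N}. \<gamma> (\<omega> N k) y)"
        using cl that by (intro M.finsum_addf) auto
      finally show ?thesis using cl that by (simp add: av_def smult_add_right)
    qed
    have av_smult: "av N (z \<odot> x) = z \<odot> av N x" if "x \<in> carrier A" for N x z
    proof -
      have "(\<Oplus>k\<in>{..<N}. \<gamma> (\<omega> N k) (z \<odot> x)) = (\<Oplus>k\<in>{..<N}. z \<odot> \<gamma> (\<omega> N k) x)"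
        using H(1,5)[OF \<omega>] that by (intro M.finsum_cong') auto
      also have "\<dots> = z \<odot> (\<Oplus>k\<in>{..<N}. \<gamma> (\<omega> N k) x)"
        using cl that by (simp add: smult_finsum)
      finally show ?thesis using cl[OF that] by (simp add: av_def mult.commute)
    qed
    have av_car: "av N x \<in> carrier A" if "x \<in> carrier A" for N x
      using cl[OF that] by (simp add: av_def)
    have av_le: "cnorm A (av N x) \<le> cnorm A x" if "x \<in> carrier A" "N > 0" for N x
    proof -
      have "cnorm A (\<Oplus>k\<in>{..<N}. \<gamma> (\<omega> N k) x) \<le> (\<Sum>k<N. cnorm A (\<gamma> (\<omega> N k) x))"
        by (rule cnorm_finsum_le[OF cl[OF that(1)]])
      also have "\<dots> \<le> (\<Sum>k<N. cnorm A x)" by (intro sum_mono contr \<omega> that)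
      finally show ?thesis
        using that cl[OF that(1)] by (simp add: av_def cnorm_smult norm_divide field_simps)
    qed
    have av_fix: "av N a = a" if "N > 0" for N
    proof -
      have "(\<Oplus>k\<in>{..<N}. \<gamma> (\<omega> N k) a) = (\<Oplus>k\<in>{..<N}. 1 \<odot> a)"
        using afix[OF \<omega>] ac by (intro M.finsum_cong') auto
      then show ?thesis using that ac by (simp add: av_def finsum_smult_const del: smult_1) simp
    qed
    \<comment> \<open>A single large \<open>N\<close> works for the whole finite combination
      \<open>b\<close>: it only has to exceed the degrees of the terms in coordinate
      \<open>i\<close>, and then the unwanted terms vanish exactly.\<close>
    have "\<exists>N0. \<forall>N>N0. av N b \<in> E (insert i T)"
      using b(1) unfolding E_def
    proof (induction rule: unit_span_induct)
      case (base \<mu> \<nu>)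
      have "av N (\<Theta> \<mu> \<nu>) \<in> unit_span (\<lambda>\<mu> \<nu>. \<forall>i\<in>insert i T. d \<mu> $ i = d \<nu> $ i)"
        if N: "N > max (d \<mu> $ i) (d \<nu> $ i)" for N
      proof -
        let ?c = "\<Sum>k<N. cis (2 * pi * real k / real N) ^ (d \<mu> $ i) * cnj (cis (2 * pi * real k / real N) ^ (d \<nu> $ i))"
        have "(\<Oplus>k\<in>{..<N}. \<gamma> (\<omega> N k) (\<Theta> \<mu> \<nu>)) = (\<Oplus>k\<in>{..<N}.
          (cis (2 * pi * real k / real N) ^ (d \<mu> $ i) * cnj (cis (2 * pi * real k / real N) ^ (d \<nu> $ i))) \<odot> \<Theta> \<mu> \<nu>)"
          using gu[OF \<omega> base(1,2)] base(1,2) by (intro M.finsum_cong') (auto simp: \<omega>_def multi_power_axis)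
        also have "\<dots> = ?c \<odot> \<Theta> \<mu> \<nu>" using base(1,2) by (simp add: finsum_smult_const)
        finally have av: "av N (\<Theta> \<mu> \<nu>) = (1 / of_nat N * ?c) \<odot> \<Theta> \<mu> \<nu>" using base(1,2) by (simp add: av_def)
        show ?thesis
        proof (cases "d \<mu> $ i = d \<nu> $ i")
          case True
          then show ?thesis
            unfolding av using base by (intro linear_subspaceD(4)[OF linear_subspace_unit_span] unit_span_base) auto
        next
          case False
          then have "?c = 0" using N by (intro sum_roots_of_unity) auto
          then show ?thesis
            unfolding av using base linear_subspaceD(2)[OF linear_subspace_unit_span] by simp
        qed
      qed
      then show ?case by blast
    next
      case zero
      have "av N \<zero> = \<zero>" for N using av_smult[of "\<zero>" N 0] av_car[of "\<zero>" N] by simp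
      then show ?case using linear_subspaceD(2)[OF linear_subspace_unit_span] by simp
    next
      case (add x y)
      then obtain N1 N2 where
        "\<forall>N>N1. av N x \<in> unit_span (\<lambda>\<mu> \<nu>. \<forall>i\<in>insert i T. d \<mu> $ i = d \<nu> $ i)"
        "\<forall>N>N2. av N y \<in> unit_span (\<lambda>\<mu> \<nu>. \<forall>i\<in>insert i T. d \<mu> $ i = d \<nu> $ i)" by blast
      then show ?case
        using add(1,2) linear_subspaceD(3)[OF linear_subspace_unit_span]
        by (intro exI[of _ "max N1 N2"]) (simp add: av_add)
    next
      case (smult z x)
      then obtain N1 where "\<forall>N>N1. av N x \<in> unit_span (\<lambda>\<mu> \<nu>. \<forall>i\<in>insert i T. d \<mu> $ i = d \<nu> $ i)" by blast
      then show ?case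
        using smult(1) linear_subspaceD(4)[OF linear_subspace_unit_span]
        by (intro exI[of _ N1]) (simp add: av_smult)
    qed
    then obtain N0 where N0: "\<forall>N>N0. av N b \<in> E (insert i T)" by blast
    define N where "N = Suc N0"
    have bc: "b \<in> carrier A" using b(1) linear_subspaceD(1)[OF E] by blast
    have "av N (a \<ominus> b) = a \<ominus> av N b"
      using ac bc av_fix[of N] av_car by (simp add: minus_eq_smult av_add av_smult N_def)
    then have "cnorm A (a \<ominus> av N b) < e"
      using av_le[of "a \<ominus> b" N] ac bc b(2) by (simp add: N_def)
    then show ?case using N0 by (auto simp: N_def)
  qed
  then obtain b where "b \<in> E UNIV" "cnorm A (a \<ominus> b) < e" by (meson finite)
  moreover have "E UNIV \<subseteq> unit_span (\<lambda>\<mu> \<nu>. d \<mu> = d \<nu>)"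
    unfolding E_def by (rule unit_span_mono) (simp add: vec_eq_iff)
  ultimately show ?thesis by blast
qed

subsection \<open>Expanding (CK4)\<close>

text \<open>Multiplied out, the product is \<open>s v\<close> minus terms containing some range
  projection. The subspace \<open>J\<close> is abstract because it is an ideal in one application
  and the span of the projections of tails in the other.\<close>

lemma list_mult_expand:
  assumes J: "linear_subspace J" and v: "v \<in> vertices \<Lambda>"
    and ls: "ls \<noteq> []" "\<And>\<alpha>. \<alpha> \<in> set ls \<Longrightarrow> \<alpha> \<in> paths \<Lambda> \<and> rng \<Lambda> \<alpha> = v"
    and p: "\<And>\<alpha>. \<alpha> \<in> set ls \<Longrightarrow> \<Theta> \<alpha> \<alpha> \<in> J" "\<And>\<alpha> y. \<alpha> \<in> set ls \<Longrightarrow> y \<in> J \<Longrightarrow> \<Theta> \<alpha> \<alpha> \<otimes> y \<in> J"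
    and vJ: "\<And>y. y \<in> J \<Longrightarrow> s v \<otimes> y \<in> J"
  shows "\<exists>y\<in>J. list_mult A (map (\<lambda>\<alpha>. s v \<ominus> \<Theta> \<alpha> \<alpha>) ls) = s v \<ominus> y"
  using ls p
proof (induction ls rule: induct_list012)
  case 1
  then show ?case by simp
next
  case (2 \<alpha>)
  then show ?case by auto
next
  case (3 \<alpha> \<beta> ls)
  note D = linear_subspaceD[OF J] and vc = s_vertex[OF v]
  obtain y where y: "y \<in> J" "list_mult A (map (\<lambda>\<alpha>. s v \<ominus> \<Theta> \<alpha> \<alpha>) (\<beta> # ls)) = s v \<ominus> y"
    using 3 by auto
  have yc: "y \<in> carrier A" using D(1) y(1) .
  have a: "\<alpha> \<in> paths \<Lambda>" "rng \<Lambda> \<alpha> = v" using 3 by auto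
  let ?p = "\<Theta> \<alpha> \<alpha>"
  have pc: "?p \<in> carrier A" using a by simp
  have pv: "?p \<otimes> s v = ?p" using a s_absorb(4)[OF a(1)] vc by (simp add: mult_assoc)
  have "(s v \<ominus> ?p) \<otimes> (s v \<ominus> y) = (s v \<ominus> ?p) \<ominus> (s v \<otimes> y \<ominus> ?p \<otimes> y)"
    using vc pc yc pv by (simp add: minus_mult_distrib)
  also have "\<dots> = s v \<ominus> (s v \<otimes> y \<oplus> (?p \<ominus> ?p \<otimes> y))"
    using vc(1) pc yc by (simp add: minus_eq_smult smult_add_right M.a_ac)
  finally have "list_mult A (map (\<lambda>\<alpha>. s v \<ominus> \<Theta> \<alpha> \<alpha>) (\<alpha> # \<beta> # ls)) = s v \<ominus> (s v \<otimes> y \<oplus> (?p \<ominus> ?p \<otimes> y))"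
    using y(2) by simp
  moreover have "s v \<otimes> y \<oplus> (?p \<ominus> ?p \<otimes> y) \<in> J"
    using D vJ y(1) 3 by simp
  ultimately show ?case by blast
qed

text \<open>(CK4) makes the product in \<open>list_mult_expand\<close> zero, so \<open>s v\<close>
  equals the subtracted element of \<open>J\<close>.\<close>

lemma vertex_mem_of_FE:
  assumes J: "linear_subspace J" and v: "v \<in> vertices \<Lambda>" and E: "E \<in> FE \<Lambda> v"
    and p: "\<And>\<alpha>. \<alpha> \<in> E \<Longrightarrow> \<Theta> \<alpha> \<alpha> \<in> J" "\<And>\<alpha> y. \<alpha> \<in> E \<Longrightarrow> y \<in> J \<Longrightarrow> \<Theta> \<alpha> \<alpha> \<otimes> y \<in> J"
    and vJ: "\<And>y. y \<in> J \<Longrightarrow> s v \<otimes> y \<in> J"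
  shows "s v \<in> J"
proof -
  obtain ls where ls: "set ls = E" "distinct ls"
    using finite_distinct_list[of E] E by (metis FE_iff)
  have "ls \<noteq> []" using ls FE_nonempty[OF E v] by auto
  then obtain y where "y \<in> J" "list_mult A (map (\<lambda>\<alpha>. s v \<ominus> \<Theta> \<alpha> \<alpha>) ls) = s v \<ominus> y"
    using list_mult_expand[OF J v, of ls] FE_D[OF E] p vJ ls(1) by blast
  then have "s v \<ominus> y = \<zero>" using CK4[OF v E ls] by simp
  then have "s v = y"
    using minus_eq_zero_iff s_vertex(1)[OF v] linear_subspaceD(1)[OF J \<open>y \<in> J\<close>] by blast
  then show ?thesis using \<open>y \<in> J\<close> by simp
qed

text \<open>A path \<open>\<sigma>\<close> from \<open>v\<close> to the source of
  \<open>\<alpha>\<close> carries membership in \<open>I\<close> from \<open>s v\<close> to that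
  source, since the source projection is \<open>s v\<close> compressed by \<open>s \<sigma>\<close>.
  Thus \<open>I\<close> contains the range projections of an exhaustive set at every vertex
  \<open>w\<close>.\<close>

lemma ideal_eq_carrier_of_cofinal:
  assumes gen: "generates (s ` paths \<Lambda>) A" and cof: "cofinal_kgraph \<Lambda>"
    and I: "cstar_ideal I A" and v: "v \<in> vertices \<Lambda>" "s v \<in> I"
  shows "I = carrier A"
proof (rule cstar_ideal_eq_carrier[OF gen I])
  have I': "algebra_ideal I" using I by (simp add: cstar_ideal_iff)
  note D = algebra_idealD[OF I'] and L = linear_subspaceD[OF algebra_idealD(1)[OF I']]
  have vert: "s w \<in> I" if w: "w \<in> vertices \<Lambda>" for w
  proof -
    obtain E where E: "E \<in> FE \<Lambda> w" "\<And>\<alpha>. \<alpha> \<in> E \<Longrightarrow> paths_between \<Lambda> v (src \<Lambda> \<alpha>) \<noteq> {}"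
      using cof v(1) w unfolding cofinal_kgraph_def by meson
    have "\<Theta> \<alpha> \<alpha> \<in> I" if a: "\<alpha> \<in> E" for \<alpha>
    proof -
      have ap: "\<alpha> \<in> paths \<Lambda>" using FE_D[OF E(1) a] by simp
      obtain \<sigma> where "\<sigma> \<in> paths_between \<Lambda> v (src \<Lambda> \<alpha>)" using E(2)[OF a] by blast
      then have s: "\<sigma> \<in> paths \<Lambda>" "rng \<Lambda> \<sigma> = v" "src \<Lambda> \<sigma> = src \<Lambda> \<alpha>" by (auto simp: paths_between_def)
      have "s (src \<Lambda> \<alpha>) = star A (s \<sigma>) \<otimes> (s v \<otimes> s \<sigma>)"
        using s s_star_s_same s_absorb(2) by metis
      then have "s (src \<Lambda> \<alpha>) \<in> I" using D(2,3) v(2) s by simp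
      moreover have "\<Theta> \<alpha> \<alpha> = s \<alpha> \<otimes> s (src \<Lambda> \<alpha>) \<otimes> star A (s \<alpha>)" using s_absorb(1)[OF ap] by simp
      ultimately show ?thesis using D(2,3) ap by simp
    qed
    then show ?thesis
      using D w s_vertex(1) FE_D[OF E(1)] L(1) by (intro vertex_mem_of_FE[OF D(1) w E(1)]) auto
  qed
  fix a assume "a \<in> s ` paths \<Lambda>"
  then obtain \<mu> where m: "\<mu> \<in> paths \<Lambda>" "a = s \<mu>" by blast
  have "s \<mu> = s (rng \<Lambda> \<mu>) \<otimes> s \<mu>" "star A (s \<mu>) = star A (s \<mu>) \<otimes> s (rng \<Lambda> \<mu>)"
    using s_absorb m by auto
  then show "a \<in> I \<and> star A a \<in> I" using vert[OF rng_vertex[OF m(1)]] D(2,3) m by (metis closed star_closed)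
qed

end

context graph_algebra
begin

section \<open>Ideals meeting the core contain a vertex projection\<close>

text \<open>Indices of the spanning elements of the finite-dimensional algebra generated from
  \<open>E\<close>; closure under transport makes their span closed under products, see
  \<open>pairs_mult\<close>.\<close>

definition pairs :: "'l set \<Rightarrow> 'l \<Rightarrow> 'l \<Rightarrow> bool" where
  "pairs E \<mu> \<nu> \<longleftrightarrow> \<mu> \<in> transport_closure E \<and> \<nu> \<in> transport_closure E \<and> d \<mu> = d \<nu> \<and> src \<Lambda> \<mu> = src \<Lambda> \<nu>"

definition proper_tails :: "'l set \<Rightarrow> 'l \<Rightarrow> 'l set" where
  "proper_tails E \<mu> = {\<alpha>. composable \<mu> \<alpha> \<and> \<mu> \<cdot> \<alpha> \<in> transport_closure E \<and> d \<alpha> \<noteq> 0}"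

text \<open>The pairs that (CK4) does not express through longer ones. They still span, and
  \<open>coefficient_bound\<close> shows that they are linearly independent modulo an ideal without
  vertex projections.\<close>

definition normal_pairs :: "'l set \<Rightarrow> 'l \<Rightarrow> 'l \<Rightarrow> bool" where
  "normal_pairs E \<mu> \<nu> \<longleftrightarrow> pairs E \<mu> \<nu> \<and> proper_tails E \<mu> \<notin> FE \<Lambda> (src \<Lambda> \<mu>)"

lemma transport_closure_mono: "E \<subseteq> E' \<Longrightarrow> transport_closure E \<subseteq> transport_closure E'"
proof
  fix \<sigma> assume "E \<subseteq> E'" "\<sigma> \<in> transport_closure E"
  from this(2) show "\<sigma> \<in> transport_closure E'"
    by induction (use \<open>E \<subseteq> E'\<close> transport_closure.base transport_closure.transport in blast)+
qed

lemma pairsD: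
  assumes "pairs E \<mu> \<nu>" "E \<subseteq> paths \<Lambda>"
  shows "\<mu> \<in> paths \<Lambda>" "\<nu> \<in> paths \<Lambda>" "d \<mu> = d \<nu>" "src \<Lambda> \<mu> = src \<Lambda> \<nu>"
    "\<mu> \<in> transport_closure E" "\<nu> \<in> transport_closure E" "pairs E \<nu> \<mu>"
  using assms transport_closure_paths unfolding pairs_def by auto

lemma pairs_extend:
  assumes "pairs E \<mu> \<nu>" "E \<subseteq> paths \<Lambda>" "composable \<mu> \<alpha>" "\<mu> \<cdot> \<alpha> \<in> transport_closure E"
  shows "composable \<nu> \<alpha>" "\<nu> \<cdot> \<alpha> \<in> transport_closure E" "pairs E (\<mu> \<cdot> \<alpha>) (\<nu> \<cdot> \<alpha>)"
proof -
  note P = pairsD[OF assms(1,2)]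
  show c: "composable \<nu> \<alpha>" using assms(3) P by (simp add: composable_def)
  show n: "\<nu> \<cdot> \<alpha> \<in> transport_closure E"
    using transport_closure_extend[of \<nu> E \<mu> \<alpha>] P assms by simp
  show "pairs E (\<mu> \<cdot> \<alpha>) (\<nu> \<cdot> \<alpha>)"
    using c n assms(3,4) P by (simp add: pairs_def deg_comp composableD)
qed

text \<open>Tails can be moved between the two paths of a pair; hence one path \<open>\<tau>\<close>
  can avoid the tails of both at once.\<close>

lemma proper_tails_pairs:
  assumes "pairs E \<mu> \<nu>" "E \<subseteq> paths \<Lambda>" shows "proper_tails E \<mu> = proper_tails E \<nu>"
proof -
  have "proper_tails E \<mu> \<subseteq> proper_tails E \<nu>" if "pairs E \<mu> \<nu>" for \<mu> \<nu>
    using pairs_extend[OF that assms(2)] by (auto simp: proper_tails_def)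
  then show ?thesis using assms pairsD(7) by blast
qed

lemma proper_tails_finite:
  assumes "finite E" "E \<subseteq> paths \<Lambda>" shows "finite (proper_tails E \<mu>)"
  by (rule finite_subset[OF _ finite_tails[OF finite_transport_closure[OF fa assms], of \<mu>]])
    (auto simp: proper_tails_def)

lemma pairs_mult:
  assumes E: "E \<subseteq> paths \<Lambda>" and x: "x \<in> unit_span (pairs E)" and y: "y \<in> unit_span (pairs E)"
  shows "x \<otimes> y \<in> unit_span (pairs E)"
proof (rule unit_span_mult[OF _ x y])
  fix \<mu> \<nu> \<sigma> \<rho> \<alpha> \<beta>
  assume mn: "pairs E \<mu> \<nu>" and sr: "pairs E \<sigma> \<rho>"
    and c: "composable \<nu> \<alpha>" "composable \<sigma> \<beta>" "composable \<mu> \<alpha>" "composable \<rho> \<beta>"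
    and eq: "\<nu> \<cdot> \<alpha> = \<sigma> \<cdot> \<beta>" and m: "\<nu> \<cdot> \<alpha> \<in> MCE \<Lambda> \<nu> \<sigma>"
  note P = pairsD[OF mn E] and Q = pairsD[OF sr E]
  have k: "\<nu> \<cdot> \<alpha> \<in> transport_closure E"
    using transport_closure_MCE[OF E P(6) Q(5) m] .
  have "\<mu> \<cdot> \<alpha> \<in> transport_closure E" "\<rho> \<cdot> \<beta> \<in> transport_closure E"
    using pairs_extend(2)[OF P(7) E c(1) k] pairs_extend(2)[OF sr E c(2)] k eq by auto
  moreover have "d (\<mu> \<cdot> \<alpha>) = d (\<rho> \<cdot> \<beta>)"
    using deg_comp[OF c(1)] deg_comp[OF c(2)] deg_comp[OF c(3)] deg_comp[OF c(4)] eq P(3) Q(3) by simp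
  moreover have "src \<Lambda> (\<mu> \<cdot> \<alpha>) = src \<Lambda> (\<rho> \<cdot> \<beta>)"
    using composableD(6)[OF c(1)] composableD(6)[OF c(2)] composableD(6)[OF c(3)] composableD(6)[OF c(4)] eq by simp
  ultimately show "pairs E (\<mu> \<cdot> \<alpha>) (\<rho> \<cdot> \<beta>)" by (simp add: pairs_def)
qed

text \<open>
  A pair whose tails form an exhaustive set is redundant: by (CK4) its source projection is a
  linear combination of the projections of the tails.
\<close>

lemma unit_span_normal_pairs:
  assumes fin: "finite E" and E: "E \<subseteq> paths \<Lambda>"
  shows "unit_span (pairs E) = unit_span (normal_pairs E)"
proof
  let ?S = "unit_span (normal_pairs E)"
  note S = linear_subspaceD[OF linear_subspace_unit_span[of "normal_pairs E"]]
  obtain N where N: "\<And>\<sigma>. \<sigma> \<in> transport_closure E \<Longrightarrow> d \<sigma> \<le> N"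
    using transport_closure_deg_bounded[OF fin E] by metis
  have vle: "vsum (d \<sigma>) \<le> vsum N" if "\<sigma> \<in> transport_closure E" for \<sigma>
    using N[OF that] vsum_strict_mono[of "d \<sigma>" N] by (cases "d \<sigma> = N") auto
  have mem: "\<Theta> \<mu> \<nu> \<in> ?S" if "pairs E \<mu> \<nu>" for \<mu> \<nu>
    using that
  \<comment> \<open>Longer pairs come first: degrees in the closure are bounded by \<open>N\<close>,
    so the distance of the total length to that of \<open>N\<close> decreases.\<close>
  proof (induction "vsum N - vsum (d \<mu>)" arbitrary: \<mu> \<nu> rule: less_induct)
    case less
    note P = pairsD[OF less.prems E]
    show ?case
    proof (cases "proper_tails E \<mu> \<in> FE \<Lambda> (src \<Lambda> \<mu>)")
      case False
      then have "normal_pairs E \<mu> \<nu>" using less.prems by (simp add: normal_pairs_def)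
      then show ?thesis using P unit_span_base by blast
    next
      case True
      let ?v = "src \<Lambda> \<mu>" and ?T = "proper_tails E \<mu>"
      define X where "X = (\<lambda>\<alpha>. \<Theta> \<alpha> \<alpha>) ` ?T"
      have T: "\<alpha> \<in> paths \<Lambda>" "rng \<Lambda> \<alpha> = ?v" if "\<alpha> \<in> ?T" for \<alpha>
        using that by (auto simp: proper_tails_def composable_def)
      have X: "X \<subseteq> carrier A" using T by (auto simp: X_def)
      note J = linear_subspace_lin_span[OF X]
      have v: "?v \<in> vertices \<Lambda>" using P src_vertex by blast
      \<comment> \<open>Minimal common extensions of two tails are tails again, so the span of their
        range projections is closed under multiplication, as \<open>vertex_mem_of_FE\<close>
        demands.\<close>
      have prod: "\<Theta> \<alpha> \<alpha> \<otimes> \<Theta> \<beta> \<beta> \<in> lin_span X" if ab: "\<alpha> \<in> ?T" "\<beta> \<in> ?T" for \<alpha> \<beta>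
      proof -
        have "\<Theta> (\<alpha> \<cdot> fst p) (\<beta> \<cdot> snd p) \<in> lin_span X" if p: "p \<in> mce_pairs \<alpha> \<beta>" for p
        proof -
          note D = mce_pairsD[OF p]
          let ?\<kappa> = "\<alpha> \<cdot> fst p"
          have ca: "composable \<mu> \<alpha>" "composable \<mu> \<beta>" "\<mu> \<cdot> \<alpha> \<in> transport_closure E" "\<mu> \<cdot> \<beta> \<in> transport_closure E"
            using ab by (auto simp: proper_tails_def)
          have ck: "composable \<mu> ?\<kappa>" using ca(1) D(1) composable_assoc(2) by blast
          then have "\<mu> \<cdot> ?\<kappa> \<in> MCE \<Lambda> (\<mu> \<cdot> \<alpha>) (\<mu> \<cdot> \<beta>)" using MCE_cmp_iff[OF ca(1,2) ck] D(4) by simp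
          then have "\<mu> \<cdot> ?\<kappa> \<in> transport_closure E" using transport_closure_MCE[OF E ca(3,4)] by blast
          moreover have "d ?\<kappa> \<noteq> 0"
            using ab(1) deg_comp[OF D(1)] by (auto simp: proper_tails_def vec_eq_iff)
          ultimately have "?\<kappa> \<in> ?T" using ck by (simp add: proper_tails_def)
          then show ?thesis using D(3) by (auto simp: X_def intro!: lin_span_base)
        qed
        then show ?thesis
          using unit_elem_mult[of \<alpha> \<alpha> \<beta> \<beta>] T ab by (simp add: linear_subspace_finsum[OF J])
      qed
      have "s ?v \<in> lin_span X"
      proof (rule vertex_mem_of_FE[OF J v True])
        show "\<Theta> \<alpha> \<alpha> \<in> lin_span X" if "\<alpha> \<in> ?T" for \<alpha>
          using that by (auto simp: X_def intro: lin_span_base)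
        show "\<Theta> \<alpha> \<alpha> \<otimes> y \<in> lin_span X" if "\<alpha> \<in> ?T" "y \<in> lin_span X" for \<alpha> y
          by (rule lin_span_mult[of "{\<Theta> \<alpha> \<alpha>}" X]) (use that X T J prod in \<open>auto simp: X_def intro: lin_span_base\<close>)
        show "s ?v \<otimes> y \<in> lin_span X" if "y \<in> lin_span X" for y
        proof (rule lin_span_mult[of "{s ?v}" X])
          fix x y assume "x \<in> {s ?v}" "y \<in> X"
          then obtain \<alpha> where a: "x = s ?v" "\<alpha> \<in> ?T" "y = \<Theta> \<alpha> \<alpha>" by (auto simp: X_def)
          then have "x \<otimes> y = \<Theta> \<alpha> \<alpha>"
            using T[OF a(2)] s_absorb(2)[of \<alpha>] s_vertex(1)[OF v] by (simp flip: mult_assoc)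
          then show "x \<otimes> y \<in> lin_span X" using a by (auto simp: X_def intro: lin_span_base)
        qed (use that X J s_vertex(1)[OF v] in \<open>auto intro: lin_span_base\<close>)
      qed
      then have "s \<mu> \<otimes> s ?v \<otimes> star A (s \<nu>) \<in> ?S" using X
      proof (induction rule: lin_span_induct)
        case (base x)
        then obtain \<alpha> where a: "\<alpha> \<in> ?T" "x = \<Theta> \<alpha> \<alpha>" by (auto simp: X_def)
        have ca: "composable \<mu> \<alpha>" "\<mu> \<cdot> \<alpha> \<in> transport_closure E" "d \<alpha> \<noteq> 0"
          using a by (auto simp: proper_tails_def)
        note N = pairs_extend[OF less.prems E ca(1,2)]
        have "d \<mu> \<noteq> d (\<mu> \<cdot> \<alpha>)" using deg_comp[OF ca(1)] ca(3) by (auto simp: vec_eq_iff)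
        then have "vsum (d \<mu>) < vsum (d (\<mu> \<cdot> \<alpha>))"
          by (rule vsum_strict_mono[OF initial_deg[OF initial_cmp[OF ca(1)]]])
        then have "\<Theta> (\<mu> \<cdot> \<alpha>) (\<nu> \<cdot> \<alpha>) \<in> ?S"
          using less.hyps[OF _ N(3)] vle[OF ca(2)] by simp
        moreover have "\<Theta> (\<mu> \<cdot> \<alpha>) (\<nu> \<cdot> \<alpha>) = s \<mu> \<otimes> x \<otimes> star A (s \<nu>)"
          unfolding s_comp[OF ca(1), symmetric] s_comp[OF N(1), symmetric] a(2)
          using T[OF a(1)] P by (simp add: star_mult mult_assoc)
        ultimately show ?case by simp
      qed (use P S in \<open>auto simp: distrib_left distrib_right smult_mult_left smult_mult_right\<close>)
      then show ?thesis using s_absorb(1)[OF P(1)] by simp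
    qed
  qed
  show "unit_span (pairs E) \<subseteq> ?S"
  proof
    fix x assume "x \<in> unit_span (pairs E)"
    then show "x \<in> ?S" by (induction rule: unit_span_induct) (use S mem in auto)
  qed
  show "?S \<subseteq> unit_span (pairs E)" by (rule unit_span_mono) (simp add: normal_pairs_def)
qed

text \<open>
  The path \<open>\<tau>\<close> avoids all proper tails of \<open>\<mu>\<close>, so compressing with \<open>s\<^bsub>\<mu>\<tau>\<^esub>\<close> and \<open>s\<^bsub>\<nu>\<tau>\<^esub>\<close> sees only the
  pairs that are initial segments of \<open>(\<mu>, \<nu>)\<close> with a common tail.
\<close>

lemma compress_unit_elem:
  assumes E: "E \<subseteq> paths \<Lambda>" and mn: "pairs E \<mu> \<nu>" and mn': "pairs E \<mu>' \<nu>'"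
    and t: "\<tau> \<in> paths \<Lambda>" "rng \<Lambda> \<tau> = src \<Lambda> \<mu>"
    and avoid: "\<And>\<alpha> \<kappa>. \<alpha> \<in> proper_tails E \<mu> \<Longrightarrow> \<tau> \<preceq> \<kappa> \<Longrightarrow> \<alpha> \<preceq> \<kappa> \<Longrightarrow> False"
  shows "star A (s (\<mu> \<cdot> \<tau>)) \<otimes> \<Theta> \<mu>' \<nu>' \<otimes> s (\<nu> \<cdot> \<tau>) =
    (if \<exists>\<delta>. composable \<mu>' \<delta> \<and> composable \<nu>' \<delta> \<and> \<mu> = \<mu>' \<cdot> \<delta> \<and> \<nu> = \<nu>' \<cdot> \<delta> then s (src \<Lambda> \<tau>) else \<zero>)"
    (is "?L = (if ?C then _ else _)")
proof -
  note P = pairsD[OF mn E] and P' = pairsD[OF mn' E]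
  \<comment> \<open>If \<open>\<mu> \<cdot> \<tau>\<close> and \<open>\<sigma>\<close> have a common
    extension, a minimal common extension of \<open>\<mu>\<close> and \<open>\<sigma>\<close> below
    it belongs to the closure and has the form \<open>\<mu> \<cdot> \<alpha>\<close>. As
    \<open>\<tau>\<close> avoids proper tails, \<open>\<alpha>\<close> is trivial and
    \<open>\<sigma>\<close> is a prefix of \<open>\<mu>\<close>.\<close>
  have key: "star A (s (\<mu> \<cdot> \<tau>)) \<otimes> s \<sigma> = \<zero> \<or> \<sigma> \<preceq> \<mu>"
    if mn: "pairs E \<mu> \<nu>" and s: "\<sigma> \<in> transport_closure E" and ct: "composable \<mu> \<tau>"
      and av: "\<And>\<alpha> \<kappa>. \<alpha> \<in> proper_tails E \<mu> \<Longrightarrow> \<tau> \<preceq> \<kappa> \<Longrightarrow> \<alpha> \<preceq> \<kappa> \<Longrightarrow> False" for \<mu> \<nu> \<sigma>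
  proof (cases "\<exists>\<kappa>. \<mu> \<cdot> \<tau> \<preceq> \<kappa> \<and> \<sigma> \<preceq> \<kappa>")
    case False
    then show ?thesis
      using s_star_s_eq_zero[of "\<mu> \<cdot> \<tau>" \<sigma>] composableD(4)[OF ct] s transport_closure_paths[OF E] by blast
  next
    case True
    then obtain \<kappa> where k: "\<mu> \<cdot> \<tau> \<preceq> \<kappa>" "\<sigma> \<preceq> \<kappa>" by blast
    then have mk: "\<mu> \<preceq> \<kappa>" using ct initial_cmp initial_trans by blast
    obtain \<rho> where r: "\<rho> \<in> MCE \<Lambda> \<mu> \<sigma>" "\<rho> \<preceq> \<kappa>" using MCE_initial[OF mk k(2)] by metis
    have rG: "\<rho> \<in> transport_closure E"
      using transport_closure_MCE[OF E pairsD(5)[OF mn E] s r(1)] .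
    obtain \<alpha> where a: "composable \<mu> \<alpha>" "\<rho> = \<mu> \<cdot> \<alpha>" using r(1) by (auto simp: MCE_iff initial_def)
    obtain \<eta> where e: "composable \<mu> \<eta>" "\<kappa> = \<mu> \<cdot> \<eta>" using mk by (auto simp: initial_def)
    have "\<tau> \<preceq> \<eta>" "\<alpha> \<preceq> \<eta>"
      using k(1) r(2) unfolding a(2) e(2) using initial_cmp_cancel[OF ct e(1)] initial_cmp_cancel[OF a(1) e(1)] by auto
    then have "\<alpha> \<notin> proper_tails E \<mu>" using av by blast
    then have "d \<alpha> = 0" using a rG by (simp add: proper_tails_def)
    then have "\<rho> = \<mu>"
      using a deg_zero_iff composableD(1-3)[OF a(1)] cmp_src by metis
    then show ?thesis using r(1) by (simp add: MCE_iff)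
  qed
  have ct: "composable \<mu> \<tau>" "composable \<nu> \<tau>" using t P by (auto simp: composable_def)
  note cp = composableD(4)[OF ct(1)] composableD(4)[OF ct(2)]
  have L: "?L = (star A (s (\<mu> \<cdot> \<tau>)) \<otimes> s \<mu>') \<otimes> (star A (s \<nu>') \<otimes> s (\<nu> \<cdot> \<tau>))"
    using cp P' by (simp add: mult_assoc)
  have swap: "star A (s \<nu>') \<otimes> s (\<nu> \<cdot> \<tau>) = star A (star A (s (\<nu> \<cdot> \<tau>)) \<otimes> s \<nu>')"
    using cp P' by (simp add: star_mult)
  show ?thesis
  proof (cases "\<mu>' \<preceq> \<mu> \<and> \<nu>' \<preceq> \<nu>")
    case False
    have "?L = \<zero>"
    proof (cases "\<mu>' \<preceq> \<mu>")
      case True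
      then have "\<not> \<nu>' \<preceq> \<nu>" using False by blast
      then have "star A (s (\<nu> \<cdot> \<tau>)) \<otimes> s \<nu>' = \<zero>"
        using key[OF P(7) P'(6) ct(2)] avoid proper_tails_pairs[OF mn E] by blast
      then show ?thesis using cp P' by (simp add: L swap)
    next
      case False
      then have "star A (s (\<mu> \<cdot> \<tau>)) \<otimes> s \<mu>' = \<zero>" using key[OF mn P'(5) ct(1)] avoid by blast
      then show ?thesis using cp P' by (simp add: L)
    qed
    moreover have "\<not> ?C" using False initial_cmp by blast
    ultimately show ?thesis by (simp only: if_False)
  next
    case True
    then obtain \<delta> \<delta>' where dl: "composable \<mu>' \<delta>" "\<mu> = \<mu>' \<cdot> \<delta>" "composable \<nu>' \<delta>'" "\<nu> = \<nu>' \<cdot> \<delta>'"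
      by (auto simp: initial_def)
    have cd: "composable \<delta> \<tau>" "composable \<delta>' \<tau>" using ct dl composable_cmp_left by metis+
    have "star A (s (\<mu> \<cdot> \<tau>)) \<otimes> s \<mu>' = star A (s (\<delta> \<cdot> \<tau>))" "star A (s \<nu>') \<otimes> s (\<nu> \<cdot> \<tau>) = s (\<delta>' \<cdot> \<tau>)"
      using s_star_s_initial(2)[of \<mu>' "\<delta> \<cdot> \<tau>"] s_star_s_initial(1)[of \<nu>' "\<delta>' \<cdot> \<tau>"] dl cd
        composable_assoc[OF dl(1) cd(1)] composable_assoc[OF dl(3) cd(2)] by auto
    then have L': "?L = star A (s (\<delta> \<cdot> \<tau>)) \<otimes> s (\<delta>' \<cdot> \<tau>)" by (simp add: L)
    \<comment> \<open>The two tails have the same degree, so what remains of the compression is a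
      vertex projection if they coincide and zero if they differ.\<close>
    have "d \<mu>' + d \<delta> = d \<mu>' + d \<delta>'" using dl deg_comp P(3) P'(3) by metis
    then have dd: "d \<delta> = d \<delta>'" by simp
    show ?thesis
    proof (cases "\<delta> = \<delta>'")
      case True
      then have "?L = s (src \<Lambda> \<tau>)"
        using L' s_star_s_same[of "\<delta> \<cdot> \<tau>"] composableD[OF cd(1)] by simp
      then show ?thesis using True dl by auto
    next
      case False
      then have "\<delta> \<cdot> \<tau> \<noteq> \<delta>' \<cdot> \<tau>" using factor_unique(1)[OF cd _ dd] by blast
      moreover have "d (\<delta> \<cdot> \<tau>) = d (\<delta>' \<cdot> \<tau>)" using cd dd deg_comp by simp
      ultimately have "?L = \<zero>"
        using L' s_star_s_orthogonal composableD(4)[OF cd(1)] composableD(4)[OF cd(2)] by simp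
      moreover have "\<not> ?C" using False dl cmp_left_cancel by metis
      ultimately show ?thesis by (simp only: if_False)
    qed
  qed
qed

text \<open>Compression at a pair \<open>(\<mu>, \<nu>)\<close> turns the sum into a scalar multiple
  of a vertex projection outside \<open>I\<close>. The scalar is the sum of the coefficients over
  all pairs from which \<open>(\<mu>, \<nu>)\<close> arises by a common tail, so its modulus is at
  most \<open>\<epsilon>\<close>. All of these pairs but \<open>(\<mu>, \<nu>)\<close> itself have
  smaller degree: a triangular system, solved by induction on the length.\<close>

lemma coefficient_bound:
  assumes fin: "finite E" and E: "E \<subseteq> paths \<Lambda>" and I: "algebra_ideal I"
    and nI: "\<And>v. v \<in> vertices \<Lambda> \<Longrightarrow> s v \<notin> I"
    and N: "N = {(\<mu>, \<nu>). normal_pairs E \<mu> \<nu>}"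
    and i: "i \<in> I" and le: "cnorm A ((\<Oplus>p\<in>N. c p \<odot> \<Theta> (fst p) (snd p)) \<ominus> i) \<le> \<epsilon>" and q: "q \<in> N"
  shows "cmod (c q) \<le> (1 + real (card N)) ^ Suc (vsum (d (fst q))) * \<epsilon>"
  using q
proof (induction "vsum (d (fst q))" arbitrary: q rule: less_induct)
  case less
  let ?x = "\<Oplus>p\<in>N. c p \<odot> \<Theta> (fst p) (snd p)"
  obtain \<mu> \<nu> where q: "q = (\<mu>, \<nu>)" by (cases q)
  have nm: "normal_pairs E \<mu> \<nu>" and mn: "pairs E \<mu> \<nu>"
    using less.prems N q by (auto simp: normal_pairs_def)
  note P = pairsD[OF mn E]
  have NP: "pairs E (fst p) (snd p)" if "p \<in> N" for p
    using that N by (auto simp: normal_pairs_def)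
  have "N \<subseteq> transport_closure E \<times> transport_closure E"
    using N by (auto simp: normal_pairs_def pairs_def)
  then have fN: "finite N" using finite_transport_closure[OF fa fin E] finite_subset by blast
  have f: "\<Theta> (fst p) (snd p) \<in> carrier A" if "p \<in> N" for p
    using pairsD(1,2)[OF NP[OF that] E] by simp
  have fc: "(\<lambda>p. c p \<odot> \<Theta> (fst p) (snd p)) \<in> N \<rightarrow> carrier A" using f by auto
  have ic: "i \<in> carrier A" using linear_subspaceD(1)[OF algebra_idealD(1)[OF I] i] .
  have xc: "?x \<in> carrier A" using fc by simp
  have e0: "0 \<le> \<epsilon>" using order.trans[OF cnorm_nonneg le] xc ic by simp
  \<comment> \<open>For a normal pair the finite set of proper tails is not exhaustive, so some path
    has no common extension with any of them.\<close>
  obtain \<tau> where t: "\<tau> \<in> paths \<Lambda>" "rng \<Lambda> \<tau> = src \<Lambda> \<mu>"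
    and av: "\<And>\<alpha> \<kappa>. \<alpha> \<in> proper_tails E \<mu> \<Longrightarrow> \<tau> \<preceq> \<kappa> \<Longrightarrow> \<alpha> \<preceq> \<kappa> \<Longrightarrow> False"
  proof -
    have "finite (proper_tails E \<mu>)" "\<forall>\<alpha>\<in>proper_tails E \<mu>. \<alpha> \<in> paths \<Lambda> \<and> rng \<Lambda> \<alpha> = src \<Lambda> \<mu>"
      using proper_tails_finite[OF fin E] by (auto simp: proper_tails_def composable_def)
    then show ?thesis using nm that unfolding normal_pairs_def FE_iff by blast
  qed
  have ct: "composable \<mu> \<tau>" "composable \<nu> \<tau>" using t P by (auto simp: composable_def)
  note cp = composableD(4)[OF ct(1)] composableD(4)[OF ct(2)]
  define C where "C = {p \<in> N. \<exists>\<delta>. composable (fst p) \<delta> \<and> composable (snd p) \<delta> \<and>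
    \<mu> = fst p \<cdot> \<delta> \<and> \<nu> = snd p \<cdot> \<delta>}"
  have "star A (s (\<mu> \<cdot> \<tau>)) \<otimes> ?x \<otimes> s (\<nu> \<cdot> \<tau>) =
      (\<Oplus>p\<in>N. star A (s (\<mu> \<cdot> \<tau>)) \<otimes> (c p \<odot> \<Theta> (fst p) (snd p)) \<otimes> s (\<nu> \<cdot> \<tau>))"
  proof -
    have "(\<lambda>p. star A (s (\<mu> \<cdot> \<tau>)) \<otimes> (c p \<odot> \<Theta> (fst p) (snd p))) \<in> N \<rightarrow> carrier A"
      by (rule Pi_I) (use f cp in simp)
    then show ?thesis using cp by (simp add: mult_finsum_left[OF fc] mult_finsum_right)
  qed
  also have "\<dots> = (\<Oplus>p\<in>N. (if p \<in> C then c p else 0) \<odot> s (src \<Lambda> \<tau>))"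
  proof (rule M.finsum_cong')
    fix p assume p: "p \<in> N"
    have "star A (s (\<mu> \<cdot> \<tau>)) \<otimes> (c p \<odot> \<Theta> (fst p) (snd p)) \<otimes> s (\<nu> \<cdot> \<tau>) =
        c p \<odot> (star A (s (\<mu> \<cdot> \<tau>)) \<otimes> \<Theta> (fst p) (snd p) \<otimes> s (\<nu> \<cdot> \<tau>))"
      using f[OF p] cp by (simp add: smult_mult_left smult_mult_right)
    also have "star A (s (\<mu> \<cdot> \<tau>)) \<otimes> \<Theta> (fst p) (snd p) \<otimes> s (\<nu> \<cdot> \<tau>) = (if p \<in> C then s (src \<Lambda> \<tau>) else \<zero>)"
      using compress_unit_elem[OF E mn NP[OF p] t av] p unfolding C_def mem_Collect_eq by (simp only: simp_thms)
    finally show "star A (s (\<mu> \<cdot> \<tau>)) \<otimes> (c p \<odot> \<Theta> (fst p) (snd p)) \<otimes> s (\<nu> \<cdot> \<tau>) =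
        (if p \<in> C then c p else 0) \<odot> s (src \<Lambda> \<tau>)"
      using t src_closed by simp
  qed (use t src_closed in auto)
  also have "\<dots> = (\<Sum>p\<in>C. c p) \<odot> s (src \<Lambda> \<tau>)"
    using t src_closed fN by (simp add: finsum_smult_const C_def sum.inter_filter)
  finally have comp: "star A (s (\<mu> \<cdot> \<tau>)) \<otimes> ?x \<otimes> s (\<nu> \<cdot> \<tau>) = (\<Sum>p\<in>C. c p) \<odot> s (src \<Lambda> \<tau>)" .
  let ?i = "star A (s (\<mu> \<cdot> \<tau>)) \<otimes> i \<otimes> s (\<nu> \<cdot> \<tau>)"
  have iI: "?i \<in> I" using algebra_idealD(2,3)[OF I] i cp by simp
  have "(\<Sum>p\<in>C. c p) \<odot> s (src \<Lambda> \<tau>) \<ominus> ?i = star A (s (\<mu> \<cdot> \<tau>)) \<otimes> (?x \<ominus> i) \<otimes> s (\<nu> \<cdot> \<tau>)"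
    unfolding comp[symmetric] using cp xc ic by (simp add: minus_mult_distrib)
  also have "cnorm A \<dots> \<le> (1 * \<epsilon>) * 1"
    using cp xc ic le by (intro cnorm_mult_mono) (auto simp: cnorm_s_le_1)
  finally have "cnorm A ((\<Sum>p\<in>C. c p) \<odot> s (src \<Lambda> \<tau>) \<ominus> ?i) \<le> \<epsilon>" by simp
  then have sum: "cmod (\<Sum>p\<in>C. c p) \<le> \<epsilon>"
    using ideal_scalar_projection[OF I] s_vertex[OF src_vertex[OF t(1)]] nI[OF src_vertex[OF t(1)]] iI by blast
  have fC: "finite C" using fN by (simp add: C_def)
  have qC: "q \<in> C"
    using less.prems composable_src[OF P(1)] cmp_src[OF P(1)] composable_src[OF P(2)] cmp_src[OF P(2)] P(4)
    by (auto simp: C_def q intro!: exI[of _ "src \<Lambda> \<mu>"])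
  let ?K = "1 + real (card N)"
  have small: "cmod (c p) \<le> ?K ^ vsum (d \<mu>) * \<epsilon>" if p: "p \<in> C - {q}" for p
  proof -
    obtain \<delta> where dl: "composable (fst p) \<delta>" "composable (snd p) \<delta>" "\<mu> = fst p \<cdot> \<delta>" "\<nu> = snd p \<cdot> \<delta>"
      using p by (auto simp: C_def)
    have "d \<delta> \<noteq> 0"
    proof
      assume "d \<delta> = 0"
      then have "rng \<Lambda> \<delta> = \<delta>" using deg_zero_iff composableD(2)[OF dl(1)] by blast
      then have "\<mu> = fst p" "\<nu> = snd p" using dl composableD(1,3) cmp_src by metis+
      then show False using p q by simp
    qed
    then have "d (fst p) \<noteq> d \<mu>" using deg_comp[OF dl(1)] dl(3) by (auto simp: vec_eq_iff)
    then have lt: "vsum (d (fst p)) < vsum (d \<mu>)"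
      using vsum_strict_mono[OF initial_deg[OF initial_cmp[OF dl(1)]]] dl(3) by simp
    then have "cmod (c p) \<le> ?K ^ Suc (vsum (d (fst p))) * \<epsilon>"
      using less.hyps[of p] p q by (simp add: C_def)
    also have "\<dots> \<le> ?K ^ vsum (d \<mu>) * \<epsilon>"
      using lt e0 by (intro mult_right_mono power_increasing) auto
    finally show ?thesis .
  qed
  have "c q = (\<Sum>p\<in>C. c p) - (\<Sum>p\<in>C - {q}. c p)"
    using sum.remove[OF fC qC, of c] by simp
  then have "cmod (c q) \<le> cmod (\<Sum>p\<in>C. c p) + cmod (\<Sum>p\<in>C - {q}. c p)"
    by (simp add: norm_triangle_ineq4)
  \<comment> \<open>With \<open>K = 1 + card N\<close> and length \<open>l\<close>, the bound
    \<open>\<epsilon>\<close> for the full sum and \<open>K^l \<epsilon>\<close> for each of at most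
    \<open>card N\<close> shorter pairs add up to at most \<open>K^(l+1) \<epsilon>\<close>.\<close>
  also have "\<dots> \<le> \<epsilon> + (\<Sum>p\<in>C - {q}. ?K ^ vsum (d \<mu>) * \<epsilon>)"
    by (rule add_mono[OF sum order.trans[OF norm_sum sum_mono[OF small]]])
  also have "\<dots> \<le> ?K ^ vsum (d \<mu>) * \<epsilon> + real (card N) * (?K ^ vsum (d \<mu>) * \<epsilon>)"
  proof (intro add_mono)
    show "\<epsilon> \<le> ?K ^ vsum (d \<mu>) * \<epsilon>" 
      using mult_right_mono[OF one_le_power[of ?K "vsum (d \<mu>)"] e0] by simp
    have "card (C - {q}) \<le> card N" using fN by (intro card_mono) (auto simp: C_def)
    then show "(\<Sum>p\<in>C - {q}. ?K ^ vsum (d \<mu>) * \<epsilon>) \<le> real (card N) * (?K ^ vsum (d \<mu>) * \<epsilon>)"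
      using e0 by (simp add: mult_right_mono)
  qed
  also have "\<dots> = ?K ^ Suc (vsum (d (fst q))) * \<epsilon>" by (simp add: q algebra_simps)
  finally show ?case .
qed

text \<open>The constant is chosen before \<open>x\<close>, \<open>i\<close> and
  \<open>\<epsilon>\<close>: it depends on the index set alone, so the same one serves all powers of
  an element.\<close>

lemma core_norm_bound:
  assumes fin: "finite E" and E: "E \<subseteq> paths \<Lambda>" and I: "algebra_ideal I"
    and nI: "\<And>v. v \<in> vertices \<Lambda> \<Longrightarrow> s v \<notin> I"
  obtains C where "\<And>x i \<epsilon>. x \<in> unit_span (pairs E) \<Longrightarrow> i \<in> I \<Longrightarrow> cnorm A (x \<ominus> i) \<le> \<epsilon> \<Longrightarrow> cnorm A x \<le> C * \<epsilon>"
proof -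
  define N where "N = {(\<mu>, \<nu>). normal_pairs E \<mu> \<nu>}"
  let ?f = "\<lambda>p. \<Theta> (fst p) (snd p)"
  have NP: "pairs E (fst p) (snd p)" if "p \<in> N" for p
    using that by (auto simp: N_def normal_pairs_def)
  have "N \<subseteq> transport_closure E \<times> transport_closure E"
    by (auto simp: N_def normal_pairs_def pairs_def)
  then have fN: "finite N" using finite_transport_closure[OF fa fin E] finite_subset by blast
  have f: "?f p \<in> carrier A" "cnorm A (?f p) \<le> 1" if "p \<in> N" for p
    using pairsD(1,2)[OF NP[OF that] E] cnorm_mult_mono[of "s (fst p)" "star A (s (snd p))" 1 1]
    by (auto simp: cnorm_s_le_1)
  have f': "?f \<in> N \<rightarrow> carrier A" using f by auto
  have gens: "{\<Theta> \<mu> \<nu> |\<mu> \<nu>. \<mu> \<in> paths \<Lambda> \<and> \<nu> \<in> paths \<Lambda> \<and> src \<Lambda> \<mu> = src \<Lambda> \<nu> \<and> normal_pairs E \<mu> \<nu>} \<subseteq> ?f ` N"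
    by (auto simp: N_def image_iff) blast
  define C where "C = (\<Sum>p\<in>N. (1 + real (card N)) ^ Suc (vsum (d (fst p))))"
  show ?thesis
  proof (rule that[of C])
    fix x i \<epsilon> assume x: "x \<in> unit_span (pairs E)" and i: "i \<in> I" and le: "cnorm A (x \<ominus> i) \<le> \<epsilon>"
    have "x \<in> lin_span (?f ` N)"
      using x lin_span_mono[OF gens] unit_span_normal_pairs[OF fin E] by (auto simp: unit_span_def)
    then obtain c where c: "x = (\<Oplus>p\<in>N. c p \<odot> ?f p)"
      using lin_span_finite_combination[OF fN f'] by blast
    have "cnorm A x \<le> (\<Sum>p\<in>N. cnorm A (c p \<odot> ?f p))"
      unfolding c by (rule cnorm_finsum_le) (use f in auto)
    also have "\<dots> \<le> (\<Sum>p\<in>N. (1 + real (card N)) ^ Suc (vsum (d (fst p))) * \<epsilon>)"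
    proof (rule sum_mono)
      fix p assume p: "p \<in> N"
      have "cnorm A (c p \<odot> ?f p) \<le> cmod (c p) * 1"
        using f[OF p] by (simp add: cnorm_smult mult_left_le)
      also have "\<dots> \<le> (1 + real (card N)) ^ Suc (vsum (d (fst p))) * \<epsilon>"
        using coefficient_bound[OF fin E I nI N_def i _ p, of c \<epsilon>] le c by simp
      finally show "cnorm A (c p \<odot> ?f p) \<le> (1 + real (card N)) ^ Suc (vsum (d (fst p))) * \<epsilon>" .
    qed
    also have "\<dots> = C * \<epsilon>" by (simp add: C_def sum_distrib_right)
    finally show "cnorm A x \<le> C * \<epsilon>" .
  qed
qed

text \<open>Squaring repeatedly turns the bound up to the constant \<open>C\<close> into a sharp one, by the C*-identity.\<close>

lemma core_norm_le_dist_ideal: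
  assumes fin: "finite E" and E: "E \<subseteq> paths \<Lambda>" and I: "algebra_ideal I"
    and nI: "\<And>v. v \<in> vertices \<Lambda> \<Longrightarrow> s v \<notin> I"
    and b: "b \<in> unit_span (pairs E)" "star A b = b" and i: "i \<in> I" "cnorm A (b \<ominus> i) \<le> \<epsilon>" and e: "\<epsilon> > 0"
  shows "cnorm A b \<le> \<epsilon>"
proof (rule ccontr)
  assume *: "\<not> ?thesis"
  obtain C where C: "\<And>x i \<epsilon>. x \<in> unit_span (pairs E) \<Longrightarrow> i \<in> I \<Longrightarrow> cnorm A (x \<ominus> i) \<le> \<epsilon> \<Longrightarrow> cnorm A x \<le> C * \<epsilon>"
    using core_norm_bound[OF fin E I nI] by metis
  note L = linear_subspaceD[OF algebra_idealD(1)[OF I]] and D = algebra_idealD(2,3)[OF I]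
  have "\<exists>x\<in>unit_span (pairs E). star A x = x \<and> cnorm A x = cnorm A b ^ (2 ^ n) \<and>
      (\<exists>j\<in>I. cnorm A (x \<ominus> j) \<le> \<epsilon> ^ (2 ^ n))" for n
  proof (induction n)
    case 0
    then show ?case using b i by auto
  next
    case (Suc n)
    then obtain x j where x: "x \<in> unit_span (pairs E)" "star A x = x" "cnorm A x = cnorm A b ^ (2 ^ n)"
      and j: "j \<in> I" "cnorm A (x \<ominus> j) \<le> \<epsilon> ^ (2 ^ n)" by blast
    have xc: "x \<in> carrier A" "j \<in> carrier A" using unit_span_carrier x(1) L(1) j(1) by auto
    let ?e = "x \<ominus> j"
    \<comment> \<open>This element of \<open>I\<close> differs from \<open>x^2\<close> by exactly
      \<open>(x - j)^2\<close>, so squaring \<open>x\<close> also squares the bound on its distance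
      to the ideal.\<close>
    have "x \<otimes> j \<oplus> j \<otimes> (x \<ominus> j) \<in> I" using xc L j D by simp
    moreover have "x \<otimes> x \<ominus> (x \<otimes> j \<oplus> j \<otimes> (x \<ominus> j)) = ?e \<otimes> ?e"
      using xc by (simp add: linear_simps M.a_ac)
    moreover have "cnorm A (?e \<otimes> ?e) \<le> \<epsilon> ^ (2 ^ Suc n)"
      using cnorm_mult_mono[of ?e ?e "\<epsilon> ^ (2 ^ n)" "\<epsilon> ^ (2 ^ n)"] xc j(2)
      by (simp add: power2_eq_square power_mult mult.commute flip: power_add mult_2)
    moreover have "cnorm A (x \<otimes> x) = cnorm A b ^ (2 ^ Suc n)"
      using cnorm_square[of x] x xc by (simp add: power_mult[symmetric] mult.commute)
    ultimately show ?case
      using pairs_mult[OF E x(1) x(1)] xc x(2)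
      by (intro bexI[of _ "x \<otimes> x"] conjI bexI[of _ "x \<otimes> j \<oplus> j \<otimes> (x \<ominus> j)"]) (simp_all add: star_mult)
  qed
  then have bound: "cnorm A b ^ (2 ^ n) \<le> C * \<epsilon> ^ (2 ^ n)" for n using C by metis
  define r where "r = cnorm A b / \<epsilon>"
  have r: "r > 1" using * e by (simp add: r_def)
  have rC: "r ^ (2 ^ n) \<le> C" for n
    using bound[of n] e by (simp add: r_def power_divide pos_divide_le_eq)
  obtain n where n: "C < r ^ n" using real_arch_pow[OF r] by blast
  also have "\<dots> \<le> r ^ (2 ^ n)" using r less_exp[of n] by (intro power_increasing) (auto intro: less_imp_le)
  finally show False using rC[of n] by simp
qed

lemma core_pairs_finite:
  assumes "x \<in> unit_span (\<lambda>\<mu> \<nu>. d \<mu> = d \<nu>)"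
  shows "\<exists>E. finite E \<and> E \<subseteq> paths \<Lambda> \<and> x \<in> unit_span (pairs E)"
  using assms
proof (induction rule: unit_span_induct)
  case (base \<mu> \<nu>)
  then have "pairs {\<mu>, \<nu>} \<mu> \<nu>" by (auto simp: pairs_def intro: transport_closure.base)
  then show ?case using base unit_span_base by (intro exI[of _ "{\<mu>, \<nu>}"]) auto
next
  case zero
  show ?case using linear_subspaceD(2)[OF linear_subspace_unit_span] by (intro exI[of _ "{}"]) auto
next
  case (add x y)
  then obtain E F where E: "finite E" "E \<subseteq> paths \<Lambda>" "x \<in> unit_span (pairs E)"
    and F: "finite F" "F \<subseteq> paths \<Lambda>" "y \<in> unit_span (pairs F)" by blast
  have "unit_span (pairs G) \<subseteq> unit_span (pairs (E \<union> F))" if "G \<subseteq> E \<union> F" for G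
    by (rule unit_span_mono) (use transport_closure_mono[OF that] in \<open>auto simp: pairs_def\<close>)
  from this[of E] this[of F]
  have "unit_span (pairs E) \<subseteq> unit_span (pairs (E \<union> F))" "unit_span (pairs F) \<subseteq> unit_span (pairs (E \<union> F))"
    by auto
  then have "x \<oplus> y \<in> unit_span (pairs (E \<union> F))"
    using E F linear_subspaceD(3)[OF linear_subspace_unit_span] by blast
  then show ?case using E F by (intro exI[of _ "E \<union> F"]) auto
next
  case (smult z x)
  then obtain E where "finite E" "E \<subseteq> paths \<Lambda>" "x \<in> unit_span (pairs E)" by blast
  then show ?case
    using linear_subspaceD(4)[OF linear_subspace_unit_span] by (intro exI[of _ E]) simp
qed

text \<open>Passing to \<open>h\<close>, the product of the adjoint of \<open>a\<close> with
  \<open>a\<close>, gives a nonzero self-adjoint element with the same properties. If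
  \<open>I\<close> had no vertex projection, a self-adjoint approximant of \<open>h\<close> from the
  core would be near \<open>I\<close>, hence small, and \<open>h\<close> would be too small.\<close>

theorem vertex_mem_of_core_ideal:
  assumes gen: "generates (s ` paths \<Lambda>) A" and \<gamma>: "is_gauge_action \<Lambda> A s \<gamma>"
    and I: "cstar_ideal I A" and a: "a \<in> I" "a \<in> fixed_point_algebra A \<gamma>" "a \<noteq> \<zero>"
  obtains v where "v \<in> vertices \<Lambda>" "s v \<in> I"
proof (rule ccontr)
  assume "\<not> thesis"
  then have nI: "\<And>v. v \<in> vertices \<Lambda> \<Longrightarrow> s v \<notin> I" using that by blast
  have I': "algebra_ideal I" using I by (simp add: cstar_ideal_iff)
  have ac: "a \<in> carrier A" using a(2) by (simp add: fixed_point_algebra_def)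
  define h where "h = star A a \<otimes> a"
  have h: "h \<in> carrier A" "star A h = h" using ac by (simp_all add: h_def star_mult)
  have hI: "h \<in> I" using algebra_idealD(3)[OF I'] a(1) ac by (simp add: h_def)
  have hf: "h \<in> fixed_point_algebra A \<gamma>"
  proof -
    have "\<gamma> z h = h" if z: "z \<in> torus" for z
    proof -
      have hom: "\<gamma> z \<in> cstar_hom A A" using \<gamma> z by (auto simp: is_gauge_action_def cstar_auto_def)
      have "\<gamma> z a = a" using a(2) z by (simp add: fixed_point_algebra_def)
      then show ?thesis using cstar_homD[OF hom] ac by (simp add: h_def)
    qed
    then show ?thesis using h by (simp add: fixed_point_algebra_def)
  qed
  have hn: "cnorm A h > 0"
    using a(3) ac cstar_identity[OF ac] cnorm_eq_zero[OF ac] by (simp add: h_def)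
  \<comment> \<open>A third suffices: the norms of \<open>h - b\<close> and \<open>b\<close> are
    both at most \<open>\<epsilon>\<close>, while their sum is at least the norm of
    \<open>h\<close>.\<close>
  define \<epsilon> where "\<epsilon> = cnorm A h / 3"
  have e: "\<epsilon> > 0" using hn by (simp add: \<epsilon>_def)
  obtain b0 where b0: "b0 \<in> unit_span (\<lambda>\<mu> \<nu>. d \<mu> = d \<nu>)" "cnorm A (h \<ominus> b0) < \<epsilon>"
    using fixed_point_core_approx[OF gen \<gamma> hf e] by blast
  obtain E where E: "finite E" "E \<subseteq> paths \<Lambda>" "b0 \<in> unit_span (pairs E)"
    using core_pairs_finite[OF b0(1)] by blast
  have b0c: "b0 \<in> carrier A" using unit_span_carrier[OF b0(1)] .
  \<comment> \<open>Taking the self-adjoint part keeps \<open>b\<close> in the span and no further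
    from the self-adjoint \<open>h\<close>.\<close>
  define b where "b = (1/2) \<odot> (b0 \<oplus> star A b0)"
  have "star A b0 \<in> unit_span (pairs E)"
    by (rule unit_span_star[OF _ E(3)]) (simp add: pairs_def)
  then have b: "b \<in> unit_span (pairs E)"
    using E(3) linear_subspaceD(3,4)[OF linear_subspace_unit_span] by (simp add: b_def)
  have sb: "star A b = b" using b0c by (simp add: b_def star_smult star_add M.a_comm)
  have bc: "b \<in> carrier A" using b0c by (simp add: b_def)
  have "b \<ominus> h = (1/2) \<odot> ((b0 \<ominus> h) \<oplus> star A (b0 \<ominus> h))"
  proof -
    have "h = (1/2) \<odot> (h \<oplus> h)" using h by (simp add: smult_add_right)
    then have "b \<ominus> h = (1/2) \<odot> (b0 \<oplus> star A b0) \<ominus> (1/2) \<odot> (h \<oplus> h)" by (simp add: b_def)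
    also have "\<dots> = (1/2) \<odot> ((b0 \<oplus> star A b0) \<ominus> (h \<oplus> h))" using b0c h by (simp add: smult_minus)
    also have "(b0 \<oplus> star A b0) \<ominus> (h \<oplus> h) = (b0 \<ominus> h) \<oplus> (star A b0 \<ominus> h)"
      using b0c h(1) by (simp add: a_minus_def M.minus_add M.a_ac)
    finally show ?thesis using b0c h by (simp add: star_minus)
  qed
  moreover have "cnorm A (b0 \<ominus> h) \<le> \<epsilon>" using b0(2) b0c h cnorm_minus_commute[of b0 h] by simp
  ultimately have bh: "cnorm A (b \<ominus> h) \<le> \<epsilon>"
    using cnorm_triangle[of "b0 \<ominus> h" "star A (b0 \<ominus> h)"] b0c h by (simp add: cnorm_smult)
  have "cnorm A b \<le> \<epsilon>"
    by (rule core_norm_le_dist_ideal[OF E(1,2) I' nI b sb hI bh e])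
  then have "cnorm A h \<le> 2 * \<epsilon>"
    using cnorm_le_minus_add[of h b] cnorm_minus_commute[of h b] h(1) bc bh by simp
  then show False using hn by (simp add: \<epsilon>_def)
qed

end

section \<open>The C*-algebra of operators, encoded by matrices\<close>

text \<open>The universal property admits only algebras whose carrier lies in
  \<open>nat \<Rightarrow> nat \<Rightarrow> complex\<close>. Operators are therefore stored as
  matrices, the first index being the column, and all operations are carried over along this
  injection.\<close>

definition matrix_of :: "(nat ell2 \<Rightarrow>\<^sub>L nat ell2) \<Rightarrow> nat \<Rightarrow> nat \<Rightarrow> complex" where
  "matrix_of T j i = coord (T (delta j 1)) i"

definition op_of :: "(nat \<Rightarrow> nat \<Rightarrow> complex) \<Rightarrow> nat ell2 \<Rightarrow>\<^sub>L nat ell2" where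
  "op_of = inv_into operators matrix_of"

text \<open>Complex linearity gives agreement on all \<open>delta j c\<close>. Adjoints are then
  compared by testing against these vectors, which separate points, and taking adjoints once more
  returns to \<open>T\<close> and \<open>T'\<close>.\<close>

lemma inj_on_matrix_of: "inj_on matrix_of operators"
proof (rule inj_onI)
  fix T T' :: "nat ell2 \<Rightarrow>\<^sub>L nat ell2"
  assume T: "T \<in> operators" "T' \<in> operators" and eq: "matrix_of T = matrix_of T'"
  have 1: "T (delta j 1) = T' (delta j 1)" for j
    using fun_cong[OF fun_cong[OF eq, of j]] by (intro ell2_eqI) (simp add: matrix_of_def)
  have *: "cscale c (delta j 1) = delta j c" for j :: nat and c by (rule ell2_eqI) simp
  have delta: "T (delta j c) = T' (delta j c)" for j c
    using operatorsD(1)[OF T(1), of c "delta j 1"] operatorsD(1)[OF T(2), of c "delta j 1"]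
    by (simp only: 1 *)
  have "adjoint_op T = adjoint_op T'"
  proof (rule blinfun_eqI, rule ell2_eqI_inner)
    fix y and j :: nat and c
    have "inner (delta j c) (adjoint_op T y) = inner (T (delta j c)) y"
      using operatorsD(2)[OF T(1)] by (simp add: is_adjoint_def)
    also have "\<dots> = inner (delta j c) (adjoint_op T' y)"
      unfolding delta using operatorsD(2)[OF T(2)] by (simp add: is_adjoint_def)
    finally show "inner (delta j c) (adjoint_op T y) = inner (delta j c) (adjoint_op T' y)" .
  qed
  then show "T = T'" using adjoint_op_adjoint_op T by metis
qed

lemma op_of_matrix_of [simp]: "T \<in> operators \<Longrightarrow> op_of (matrix_of T) = T"
  unfolding op_of_def by (rule inv_into_f_f[OF inj_on_matrix_of])

definition matrix_algebra :: "(nat \<Rightarrow> nat \<Rightarrow> complex) cstar_struct" where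
  "matrix_algebra = \<lparr>carrier = matrix_of ` operators,
     mult = (\<lambda>a b. matrix_of (op_of a o\<^sub>L op_of b)), one = undefined, zero = matrix_of 0,
     add = (\<lambda>a b. matrix_of (op_of a + op_of b)),
     smult = (\<lambda>z a. matrix_of (cscale_op z o\<^sub>L op_of a)),
     star = (\<lambda>a. matrix_of (adjoint_op (op_of a))), cnorm = (\<lambda>a. norm (op_of a))\<rparr>"

lemma matrix_algebra_simps:
  "carrier matrix_algebra = matrix_of ` operators" "\<zero>\<^bsub>matrix_algebra\<^esub> = matrix_of 0"
  "T \<in> operators \<Longrightarrow> T' \<in> operators \<Longrightarrow> matrix_of T \<otimes>\<^bsub>matrix_algebra\<^esub> matrix_of T' = matrix_of (T o\<^sub>L T')"
  "T \<in> operators \<Longrightarrow> T' \<in> operators \<Longrightarrow> matrix_of T \<oplus>\<^bsub>matrix_algebra\<^esub> matrix_of T' = matrix_of (T + T')"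
  "T \<in> operators \<Longrightarrow> z \<odot>\<^bsub>matrix_algebra\<^esub> matrix_of T = matrix_of (cscale_op z o\<^sub>L T)"
  "T \<in> operators \<Longrightarrow> star matrix_algebra (matrix_of T) = matrix_of (adjoint_op T)"
  "T \<in> operators \<Longrightarrow> cnorm matrix_algebra (matrix_of T) = norm T"
  by (simp_all add: matrix_algebra_def)

lemma matrix_of_eq_iff: "T \<in> operators \<Longrightarrow> T' \<in> operators \<Longrightarrow> matrix_of T = matrix_of T' \<longleftrightarrow> T = T'"
  using inj_on_matrix_of by (auto dest: inj_onD)

lemmas operators_closed = operators_zero operators_add operators_diff operators_compose operators_cscale
  adjoint_op_in

lemma cring_complex_field: "cring complex_field"
  by (rule cringI)
    (auto intro!: abelian_groupI comm_monoidI exI[of _ "- _"] simp: complex_field_def algebra_simps)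

lemma abelian_group_matrix_algebra: "abelian_group matrix_algebra"
proof (rule abelian_groupI)
  fix x assume "x \<in> carrier matrix_algebra"
  then obtain T where T: "T \<in> operators" "x = matrix_of T" by (auto simp: matrix_algebra_simps)
  then have "0 - T \<in> operators" by (intro operators_diff operators_zero)
  then have "- T \<in> operators" by simp
  then show "\<exists>y\<in>carrier matrix_algebra. y \<oplus>\<^bsub>matrix_algebra\<^esub> x = \<zero>\<^bsub>matrix_algebra\<^esub>"
    using T by (intro bexI[of _ "matrix_of (- T)"]) (auto simp: matrix_algebra_simps)
qed (auto simp: matrix_algebra_simps operators_closed algebra_simps)

lemma matrix_algebra_minus:
  assumes "T \<in> operators" "T' \<in> operators"
  shows "matrix_of T \<ominus>\<^bsub>matrix_algebra\<^esub> matrix_of T' = matrix_of (T - T')"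
proof -
  interpret abelian_group matrix_algebra by (rule abelian_group_matrix_algebra)
  have m: "- T' \<in> operators" using operators_diff[OF operators_zero assms(2)] by simp
  have "\<ominus>\<^bsub>matrix_algebra\<^esub> matrix_of T' = matrix_of (- T')"
    by (rule minus_equality) (use assms m in \<open>auto simp: matrix_algebra_simps\<close>)
  then show ?thesis using assms m by (simp add: a_minus_def matrix_algebra_simps)
qed

lemma cdist_matrix_algebra:
  "T \<in> operators \<Longrightarrow> T' \<in> operators \<Longrightarrow> cdist matrix_algebra (matrix_of T) (matrix_of T') = norm (T - T')"
  by (simp add: cdist_def matrix_algebra_minus matrix_algebra_simps operators_closed)

lemma Metric_space_matrix_algebra: "Metric_space (carrier matrix_algebra) (cdist matrix_algebra)"
proof
  fix x y
  show "0 \<le> cdist matrix_algebra x y"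
    by (cases "x \<in> carrier matrix_algebra \<and> y \<in> carrier matrix_algebra")
      (auto simp: matrix_algebra_simps(1) cdist_matrix_algebra, auto simp: cdist_def matrix_algebra_simps(1))
  show "cdist matrix_algebra x y = cdist matrix_algebra y x"
    by (cases "x \<in> carrier matrix_algebra \<and> y \<in> carrier matrix_algebra")
      (auto simp: matrix_algebra_simps(1) cdist_matrix_algebra norm_minus_commute, auto simp: cdist_def matrix_algebra_simps(1))
next
  fix x y assume "x \<in> carrier matrix_algebra" "y \<in> carrier matrix_algebra"
  then show "cdist matrix_algebra x y = 0 \<longleftrightarrow> x = y"
    by (auto simp: matrix_algebra_simps(1) cdist_matrix_algebra matrix_of_eq_iff)
next
  fix x y z assume "x \<in> carrier matrix_algebra" "y \<in> carrier matrix_algebra" "z \<in> carrier matrix_algebra"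
  then show "cdist matrix_algebra x z \<le> cdist matrix_algebra x y + cdist matrix_algebra y z"
    by (auto simp: matrix_algebra_simps(1) cdist_matrix_algebra)
      (metis dist_norm dist_triangle)
qed

lemma mcomplete_matrix_algebra: "Metric_space.mcomplete (carrier matrix_algebra) (cdist matrix_algebra)"
proof -
  interpret Metric_space "carrier matrix_algebra" "cdist matrix_algebra"
    by (rule Metric_space_matrix_algebra)
  show ?thesis
    unfolding mcomplete_def
  proof (intro allI impI)
    fix \<sigma> assume s: "MCauchy \<sigma>"
    then have "range \<sigma> \<subseteq> matrix_of ` operators"
      unfolding MCauchy_def by (simp add: matrix_algebra_simps(1))
    then have "\<forall>n. \<exists>T\<in>operators. \<sigma> n = matrix_of T" by auto
    then obtain T where T: "\<And>n. T n \<in> operators" "\<And>n. \<sigma> n = matrix_of (T n)" by metis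
    have "cdist matrix_algebra (\<sigma> m) (\<sigma> n) = norm (T m - T n)" for m n
      by (simp add: T cdist_matrix_algebra)
    then have "Cauchy T" using s unfolding MCauchy_def Cauchy_iff by simp
    then obtain L where L: "T \<longlonglongrightarrow> L" by (auto simp: Cauchy_convergent_iff convergent_def)
    have Lo: "L \<in> operators" using operators_limit T(1) L by blast
    have "limitin mtopology \<sigma> (matrix_of L) sequentially"
      unfolding limit_metric_sequentially
      using L Lo T by (auto simp: matrix_algebra_simps(1) cdist_matrix_algebra LIMSEQ_iff)
    then show "\<exists>x. limitin mtopology \<sigma> x sequentially" by blast
  qed
qed

lemma cscale_op_simps:
  "cscale_op (z + w) = cscale_op z + cscale_op w" "cscale_op z o\<^sub>L cscale_op w = cscale_op (z * w)"
  "cscale_op 1 o\<^sub>L T = T"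
  by (auto intro!: blinfun_eqI simp: blinfun.add_left cscale_add)

lemma blinfun_compose_assoc: "(T o\<^sub>L S) o\<^sub>L R = T o\<^sub>L (S o\<^sub>L R)"
  by (rule blinfun_eqI) simp

lemma blinfun_compose_add: "(T + S) o\<^sub>L R = (T o\<^sub>L R) + (S o\<^sub>L R)" "R o\<^sub>L (T + S) = (R o\<^sub>L T) + (R o\<^sub>L S)"
  by (auto intro!: blinfun_eqI simp: blinfun.bilinear_simps)

theorem cstar_algebra_matrix_algebra: "cstar_algebra matrix_algebra"
proof -
  have mod: "Module.module complex_field matrix_algebra"
  proof (rule Module.module.intro)
    show "cring complex_field" by (rule cring_complex_field)
    show "abelian_group matrix_algebra" by (rule abelian_group_matrix_algebra)
    show "module_axioms complex_field matrix_algebra"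
    proof
      fix z w x y
      assume "x \<in> carrier matrix_algebra" "y \<in> carrier matrix_algebra"
      then obtain T S where T: "T \<in> operators" "x = matrix_of T" and S: "S \<in> operators" "y = matrix_of S"
        by (auto simp: matrix_algebra_simps)
      show "z \<odot>\<^bsub>matrix_algebra\<^esub> (x \<oplus>\<^bsub>matrix_algebra\<^esub> y) =
          z \<odot>\<^bsub>matrix_algebra\<^esub> x \<oplus>\<^bsub>matrix_algebra\<^esub> z \<odot>\<^bsub>matrix_algebra\<^esub> y"
        using T S by (simp add: matrix_algebra_simps operators_closed blinfun_compose_add)
    next
      fix z w x assume "x \<in> carrier matrix_algebra"
      then obtain T where T: "T \<in> operators" "x = matrix_of T" by (auto simp: matrix_algebra_simps)
      show "z \<odot>\<^bsub>matrix_algebra\<^esub> x \<in> carrier matrix_algebra"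
        "(z \<oplus>\<^bsub>complex_field\<^esub> w) \<odot>\<^bsub>matrix_algebra\<^esub> x =
          z \<odot>\<^bsub>matrix_algebra\<^esub> x \<oplus>\<^bsub>matrix_algebra\<^esub> w \<odot>\<^bsub>matrix_algebra\<^esub> x"
        "\<one>\<^bsub>complex_field\<^esub> \<odot>\<^bsub>matrix_algebra\<^esub> x = x"
        using T by (simp_all add: matrix_algebra_simps operators_closed complex_field_def cscale_op_simps
            blinfun_compose_add)
      show "(z \<otimes>\<^bsub>complex_field\<^esub> w) \<odot>\<^bsub>matrix_algebra\<^esub> x =
          z \<odot>\<^bsub>matrix_algebra\<^esub> (w \<odot>\<^bsub>matrix_algebra\<^esub> x)"
        using T by (simp add: matrix_algebra_simps operators_closed complex_field_def
            flip: blinfun_compose_assoc cscale_op_simps(2))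
    qed
  qed
  have comm: "T o\<^sub>L (cscale_op z o\<^sub>L S) = cscale_op z o\<^sub>L (T o\<^sub>L S)" if "T \<in> operators" for T S z
    using operators_commute_cscale[OF that] by (metis blinfun_compose_assoc)
  show ?thesis
    by (rule cstar_algebra.intro[OF mod cstar_algebra_axioms.intro])
      (auto simp: matrix_algebra_simps operators_closed blinfun_compose_assoc blinfun_compose_add comm
        adjoint_op_adjoint_op adjoint_op_add adjoint_op_compose adjoint_op_eqI[OF is_adjoint_cscale]
        operators_commute_cscale[OF adjoint_op_in] matrix_of_eq_iff
        norm_triangle_ineq norm_cscale_op_compose norm_blinfun_compose
        mcomplete_matrix_algebra[unfolded matrix_algebra_simps(1)]
        norm_is_adjoint_compose(1)[OF operatorsD(2)])
qed

section \<open>Operators of partial bijections of a countable set\<close>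

text \<open>Numbering the countable set \<open>X\<close> lets relations on it act on the
  square-summable sequences over \<nat>; coordinates outside the numbering are sent to 0.\<close>

definition rel_op :: "'b set \<Rightarrow> ('b \<times> 'b) set \<Rightarrow> nat ell2 \<Rightarrow>\<^sub>L nat ell2" where
  "rel_op X Q = bij_op (map_prod (to_nat_on X) (to_nat_on X) ` Q)"

definition partial_bij_on :: "'b set \<Rightarrow> ('b \<times> 'b) set \<Rightarrow> bool" where
  "partial_bij_on X Q \<longleftrightarrow> Q \<subseteq> X \<times> X \<and> partial_bij Q"

locale countable_index =
  fixes X :: "'b set"
  assumes countable_X: "countable X"
begin

abbreviation enc where "enc \<equiv> to_nat_on X"
abbreviation enc_rel where "enc_rel Q \<equiv> map_prod enc enc ` Q"

lemma enc_eq_iff: "x \<in> X \<Longrightarrow> y \<in> X \<Longrightarrow> enc x = enc y \<longleftrightarrow> x = y"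
  using inj_on_to_nat_on[OF countable_X] by (auto dest: inj_onD)

lemma enc_relE:
  assumes "(i, j) \<in> enc_rel Q" "Q \<subseteq> X \<times> X"
  obtains x y where "i = enc x" "j = enc y" "(x, y) \<in> Q" "x \<in> X" "y \<in> X"
  using assms by (auto simp: map_prod_def)

lemma enc_rel_iff: "Q \<subseteq> X \<times> X \<Longrightarrow> x \<in> X \<Longrightarrow> y \<in> X \<Longrightarrow> (enc x, enc y) \<in> enc_rel Q \<longleftrightarrow> (x, y) \<in> Q"
proof
  assume Q: "Q \<subseteq> X \<times> X" and x: "x \<in> X" and y: "y \<in> X" and "(enc x, enc y) \<in> enc_rel Q"
  then obtain x' y' where "enc x = enc x'" "enc y = enc y'" "(x', y') \<in> Q" "x' \<in> X" "y' \<in> X"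
    using enc_relE by metis
  then show "(x, y) \<in> Q" using x y enc_eq_iff by metis
qed auto

lemma partial_bij_enc_rel:
  assumes Q: "partial_bij_on X Q" shows "partial_bij (enc_rel Q)"
proof -
  have sv: "single_valued (enc_rel R)" if R: "R \<subseteq> X \<times> X" "single_valued R" for R
  proof (rule single_valuedI)
    fix i j k assume 1: "(i, j) \<in> enc_rel R" and 2: "(i, k) \<in> enc_rel R"
    obtain x y where xy: "i = enc x" "j = enc y" "(x, y) \<in> R" "x \<in> X" by (rule enc_relE[OF 1 R(1)])
    obtain x' z where xz: "i = enc x'" "k = enc z" "(x', z) \<in> R" "x' \<in> X" by (rule enc_relE[OF 2 R(1)])
    have "x = x'" using xy xz enc_eq_iff by metis
    then show "j = k" using xy xz single_valuedD[OF R(2)] by metis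
  qed
  have "(enc_rel Q)\<inverse> = enc_rel (Q\<inverse>)" by force
  then show ?thesis
    using Q sv[of Q] sv[of "Q\<inverse>"] unfolding partial_bij_on_def partial_bij_def by auto
qed

lemma enc_rel_comp:
  assumes "Q \<subseteq> X \<times> X" "Q' \<subseteq> X \<times> X" shows "enc_rel (Q O Q') = enc_rel Q O enc_rel Q'"
proof (intro equalityI subsetI)
  fix p assume "p \<in> enc_rel Q O enc_rel Q'"
  then obtain i j k where p: "p = (i, k)" "(i, j) \<in> enc_rel Q" "(j, k) \<in> enc_rel Q'" by (rule relcompE)
  obtain x y where xy: "i = enc x" "j = enc y" "(x, y) \<in> Q" "x \<in> X" "y \<in> X"
    by (rule enc_relE[OF p(2) assms(1)])
  obtain y' z where yz: "j = enc y'" "k = enc z" "(y', z) \<in> Q'" "y' \<in> X" "z \<in> X"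
    by (rule enc_relE[OF p(3) assms(2)])
  have "y = y'" using xy yz enc_eq_iff[of y y'] by simp
  then have "(x, z) \<in> Q O Q'" using xy yz by blast
  then show "p \<in> enc_rel (Q O Q')" using p(1) xy(1) yz(2) by (auto intro: rev_image_eqI)
next
  fix p assume "p \<in> enc_rel (Q O Q')"
  then obtain x y z where "p = (enc x, enc z)" "(x, y) \<in> Q" "(y, z) \<in> Q'" by auto
  moreover from this have "(enc x, enc y) \<in> enc_rel Q" "(enc y, enc z) \<in> enc_rel Q'" by auto
  ultimately show "p \<in> enc_rel Q O enc_rel Q'" by blast
qed

lemma rel_op_in_operators: "partial_bij_on X Q \<Longrightarrow> rel_op X Q \<in> operators"
  unfolding rel_op_def by (intro bij_op_in_operators partial_bij_enc_rel)

lemma rel_op_compose: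
  assumes "partial_bij_on X Q" "partial_bij_on X Q'" shows "rel_op X Q o\<^sub>L rel_op X Q' = rel_op X (Q O Q')"
  using bij_op_compose[OF partial_bij_enc_rel[OF assms(1)] partial_bij_enc_rel[OF assms(2)]]
    enc_rel_comp[of Q Q'] assms by (simp add: rel_op_def partial_bij_on_def)

lemma adjoint_rel_op:
  assumes "partial_bij_on X Q" shows "adjoint_op (rel_op X Q) = rel_op X (Q\<inverse>)"
proof -
  have "enc_rel (Q\<inverse>) = (enc_rel Q)\<inverse>" by force
  then show ?thesis using adjoint_op_bij_op[OF partial_bij_enc_rel[OF assms]] by (simp add: rel_op_def)
qed

lemma rel_op_empty: "rel_op X {} = 0"
  by (simp add: rel_op_def bij_op_empty)

lemma rel_op_eq_0_iff: "partial_bij_on X Q \<Longrightarrow> rel_op X Q = 0 \<longleftrightarrow> Q = {}"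
  using bij_op_eq_0_iff[OF partial_bij_enc_rel] by (simp add: rel_op_def)

lemma rel_op_Un:
  assumes "partial_bij_on X (Q \<union> Q')" "Q \<inter> Q' = {}" shows "rel_op X (Q \<union> Q') = rel_op X Q + rel_op X Q'"
proof -
  have "Q \<subseteq> X \<times> X" "Q' \<subseteq> X \<times> X" using assms(1) by (auto simp: partial_bij_on_def)
  have "enc_rel Q \<inter> enc_rel Q' = {}"
  proof (rule equals0I)
    fix p assume "p \<in> enc_rel Q \<inter> enc_rel Q'"
    moreover obtain i j where "p = (i, j)" by (cases p)
    ultimately have p: "(i, j) \<in> enc_rel Q" "(i, j) \<in> enc_rel Q'" by simp_all
    obtain x y where "i = enc x" "j = enc y" "(x, y) \<in> Q" "x \<in> X" "y \<in> X"
      by (rule enc_relE[OF p(1) \<open>Q \<subseteq> X \<times> X\<close>])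
    moreover from this have "(x, y) \<in> Q'" using p(2) enc_rel_iff[OF \<open>Q' \<subseteq> X \<times> X\<close>] by simp
    ultimately show False using assms(2) by blast
  qed
  then show ?thesis
    using bij_op_Un[of "enc_rel Q" "enc_rel Q'"] partial_bij_enc_rel[OF assms(1)]
    by (simp add: rel_op_def image_Un)
qed

lemma rel_op_Id_on_diff:
  assumes "W \<subseteq> V" "V \<subseteq> X" shows "rel_op X (Id_on V) - rel_op X (Id_on W) = rel_op X (Id_on (V - W))"
proof -
  have "partial_bij_on X (Id_on (V - W) \<union> Id_on W)"
    using assms by (auto simp: partial_bij_on_def partial_bij_def single_valued_def)
  moreover have "Id_on (V - W) \<union> Id_on W = Id_on V" using assms by auto
  ultimately have "rel_op X (Id_on V) = rel_op X (Id_on (V - W)) + rel_op X (Id_on W)"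
    using rel_op_Un[of "Id_on (V - W)" "Id_on W"] by auto
  then show ?thesis by simp
qed

lemma partial_bij_on_ops:
  "partial_bij_on X Q \<Longrightarrow> partial_bij_on X (Q\<inverse>)"
  "partial_bij_on X Q \<Longrightarrow> partial_bij_on X Q' \<Longrightarrow> partial_bij_on X (Q O Q')"
  "V \<subseteq> X \<Longrightarrow> partial_bij_on X (Id_on V)"
  unfolding partial_bij_on_def using partial_bij_converse partial_bij_comp partial_bij_Id_on by auto

lemma partial_bij_on_subset:
  assumes "partial_bij_on X Q" "Q' \<subseteq> Q" shows "partial_bij_on X Q'"
proof -
  have "Q'\<inverse> \<subseteq> Q\<inverse>" using assms(2) by auto
  then show ?thesis
    using assms single_valued_subset unfolding partial_bij_on_def partial_bij_def by (meson order.trans)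
qed

lemma partial_bij_on_triple:
  assumes "partial_bij_on X Q" shows "(Q O Q\<inverse>) O Q = Q"
proof (intro equalityI subrelI)
  fix x y assume "(x, y) \<in> (Q O Q\<inverse>) O Q"
  then obtain a b where "(x, a) \<in> Q" "(b, a) \<in> Q" "(b, y) \<in> Q" by auto
  then show "(x, y) \<in> Q"
    using assms single_valuedD[of Q b a y] by (simp add: partial_bij_on_def partial_bij_def)
qed blast

text \<open>Prepares (CK3): there the sum of operators corresponds to a disjoint union of relations
  that is itself a partial bijection.\<close>

lemma finsum_rel_op:
  assumes "finite I" "partial_bij_on X (\<Union>i\<in>I. Q i)"
    "\<And>i j. i \<in> I \<Longrightarrow> j \<in> I \<Longrightarrow> i \<noteq> j \<Longrightarrow> Q i \<inter> Q j = {}"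
  shows "finsum matrix_algebra (\<lambda>i. matrix_of (rel_op X (Q i))) I = matrix_of (rel_op X (\<Union>i\<in>I. Q i))"
  using assms
proof (induction I)
  case empty
  interpret abelian_group matrix_algebra by (rule abelian_group_matrix_algebra)
  show ?case by (simp add: rel_op_empty matrix_algebra_simps)
next
  case (insert k I)
  interpret abelian_group matrix_algebra by (rule abelian_group_matrix_algebra)
  have sub: "partial_bij_on X Q'" if "Q' \<subseteq> (\<Union>i\<in>insert k I. Q i)" for Q'
    using partial_bij_on_subset[OF insert.prems(1) that] .
  have op: "rel_op X (Q i) \<in> operators" if "i \<in> insert k I" for i
    using that by (intro rel_op_in_operators sub) blast
  have U: "partial_bij_on X (\<Union>i\<in>I. Q i)" by (rule sub) blast
  have "Q k \<inter> (\<Union>i\<in>I. Q i) = {}" using insert.prems(2) insert.hyps(2) by blast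
  then have "rel_op X (\<Union>i\<in>insert k I. Q i) = rel_op X (Q k) + rel_op X (\<Union>i\<in>I. Q i)"
    using rel_op_Un[of "Q k" "\<Union>i\<in>I. Q i"] insert.prems(1) by simp
  moreover have "finsum matrix_algebra (\<lambda>i. matrix_of (rel_op X (Q i))) I = matrix_of (rel_op X (\<Union>i\<in>I. Q i))"
    using insert.IH[OF U] insert.prems(2) by blast
  ultimately show ?case
    using insert.hyps op rel_op_in_operators[OF U] by (simp add: matrix_algebra_simps Pi_iff)
qed

text \<open>Prepares (CK4): a product of projections onto complements projects onto the complement
  of the union.\<close>

lemma list_mult_Id_on:
  assumes "ls \<noteq> []" "V \<subseteq> X" "\<And>W. W \<in> set Ws \<Longrightarrow> W \<subseteq> V"
    "ls = map (\<lambda>W. matrix_of (rel_op X (Id_on (V - W)))) Ws"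
  shows "list_mult matrix_algebra ls = matrix_of (rel_op X (Id_on (V - \<Union>(set Ws))))"
  using assms
proof (induction Ws arbitrary: ls rule: induct_list012)
  case (3 W W' Ws)
  let ?R = "map (\<lambda>W. matrix_of (rel_op X (Id_on (V - W)))) (W' # Ws)"
  have "list_mult matrix_algebra ?R = matrix_of (rel_op X (Id_on (V - \<Union>(set (W' # Ws)))))"
    by (rule "3.IH"(2)) (use 3 in auto)
  then have "list_mult matrix_algebra ls =
      matrix_of (rel_op X (Id_on (V - W))) \<otimes>\<^bsub>matrix_algebra\<^esub> matrix_of (rel_op X (Id_on (V - \<Union>(set (W' # Ws)))))"
    using 3(6) by simp
  also have "\<dots> = matrix_of (rel_op X (Id_on (V - W) O Id_on (V - \<Union>(set (W' # Ws)))))"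
    using \<open>V \<subseteq> X\<close> by (subst matrix_algebra_simps)
      (auto intro!: rel_op_in_operators partial_bij_on_ops arg_cong[of _ _ matrix_of] rel_op_compose)
  also have "Id_on (V - W) O Id_on (V - \<Union>(set (W' # Ws))) = Id_on (V - \<Union>(set (W # W' # Ws)))" by auto
  finally show ?case .
qed auto

end

section \<open>Representations on orbits of boundary filters\<close>

text \<open>Invariance under removing and adding initial paths makes composition with
  \<open>\<sigma>\<close> a bijection from the members of \<open>X\<close> at its source to those
  that contain \<open>\<sigma>\<close>.\<close>

locale filter_system = kgraph \<Lambda> + countable_index X for \<Lambda> :: "('l, 'k::finite) kgraph" and X :: "'l set set" +
  assumes fa: "finitely_aligned \<Lambda>"
    and X_filter: "y \<in> X \<Longrightarrow> \<exists>v. boundary_filter v y"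
    and X_shift: "y \<in> X \<Longrightarrow> \<sigma> \<in> y \<Longrightarrow> shift \<sigma> y \<in> X"
    and X_prepend: "y \<in> X \<Longrightarrow> \<sigma> \<in> paths \<Lambda> \<Longrightarrow> boundary_filter (src \<Lambda> \<sigma>) y \<Longrightarrow> prepend \<sigma> y \<in> X"
begin

text \<open>In view of the orientation of \<open>pullback\<close>, the operator sends the basis
  vector of a filter \<open>z\<close> at the source of \<open>\<sigma>\<close> to that of
  \<open>prepend \<sigma> z\<close>: the boundary-path representation.\<close>

definition shift_rel :: "'l \<Rightarrow> ('l set \<times> 'l set) set" where
  "shift_rel \<sigma> = {(y, shift \<sigma> y) |y. y \<in> X \<and> \<sigma> \<in> y}"

definition rep :: "'l \<Rightarrow> nat \<Rightarrow> nat \<Rightarrow> complex" where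
  "rep \<sigma> = matrix_of (rel_op X (shift_rel \<sigma>))"

lemma filter_eq_prepend:
  assumes "y \<in> X" "\<sigma> \<in> y" shows "prepend \<sigma> (shift \<sigma> y) = y"
  using X_filter[OF assms(1)] prepend_shift assms(2) by blast

lemma shift_rel_partial_bij: "partial_bij_on X (shift_rel \<sigma>)"
  unfolding partial_bij_on_def partial_bij_def
proof (intro conjI)
  show "shift_rel \<sigma> \<subseteq> X \<times> X" using X_shift by (auto simp: shift_rel_def)
  show "single_valued (shift_rel \<sigma>)" by (auto simp: shift_rel_def single_valued_def)
  show "single_valued ((shift_rel \<sigma>)\<inverse>)"
  proof (rule single_valuedI)
    fix x y z assume "(x, y) \<in> (shift_rel \<sigma>)\<inverse>" "(x, z) \<in> (shift_rel \<sigma>)\<inverse>"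
    then have "y \<in> X" "\<sigma> \<in> y" "z \<in> X" "\<sigma> \<in> z" "shift \<sigma> y = shift \<sigma> z" by (auto simp: shift_rel_def)
    then show "y = z" using filter_eq_prepend by metis
  qed
qed

lemma shift_rel_vertex:
  assumes v: "v \<in> vertices \<Lambda>" shows "shift_rel v = Id_on {y \<in> X. v \<in> y}"
proof -
  have "shift v y = y" if y: "y \<in> X" "v \<in> y" for y
  proof -
    obtain w where w: "boundary_filter w y" using X_filter[OF y(1)] by blast
    then have "w = v" using boundary_filterD(3)[OF w y(2)] vertexD(2)[OF v] by simp
    then show ?thesis using shift_vertex w by blast
  qed
  then show ?thesis by (auto simp: shift_rel_def)
qed

lemma shift_rel_comp:
  assumes c: "composable \<mu> \<nu>" shows "shift_rel \<mu> O shift_rel \<nu> = shift_rel (\<mu> \<cdot> \<nu>)"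
proof -
  have *: "\<nu> \<in> shift \<mu> y \<longleftrightarrow> \<mu> \<cdot> \<nu> \<in> y" for y using c by (auto simp: shift_def)
  have "\<mu> \<in> y" if y: "y \<in> X" "\<mu> \<cdot> \<nu> \<in> y" for y
    using X_filter[OF y(1)] boundary_filterD(4) initial_cmp[OF c] y(2) by blast
  then show ?thesis
    using X_shift * shift_shift[OF c] unfolding shift_rel_def by (auto simp: relcomp_unfold)
qed

lemma mem_filter_rng:
  assumes "y \<in> X" "\<sigma> \<in> y" shows "\<sigma> \<in> paths \<Lambda>" "boundary_filter (rng \<Lambda> \<sigma>) y"
proof -
  obtain w where w: "boundary_filter w y" using X_filter assms by blast
  then show "\<sigma> \<in> paths \<Lambda>" "boundary_filter (rng \<Lambda> \<sigma>) y"
    using boundary_filterD(2,3)[OF w assms(2)] by auto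
qed

text \<open>(CK3) on the level of relations. A filter that contains \<open>\<mu>\<close> and
  \<open>\<nu>\<close> is directed, hence contains a minimal common extension, whose tails give the
  pair.\<close>

lemma shift_rel_converse_comp:
  assumes m: "\<mu> \<in> paths \<Lambda>" and n: "\<nu> \<in> paths \<Lambda>"
  shows "(shift_rel \<mu>)\<inverse> O shift_rel \<nu> = (\<Union>p\<in>mce_pairs \<mu> \<nu>. shift_rel (fst p) O (shift_rel (snd p))\<inverse>)"
proof (intro equalityI subsetI)
  fix p assume "p \<in> (shift_rel \<mu>)\<inverse> O shift_rel \<nu>"
  then obtain y where y: "y \<in> X" "\<mu> \<in> y" "\<nu> \<in> y" "p = (shift \<mu> y, shift \<nu> y)"
    by (auto simp: shift_rel_def)
  obtain w where w: "boundary_filter w y" using X_filter y by blast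
  then obtain \<kappa>' where k': "\<kappa>' \<in> y" "\<mu> \<preceq> \<kappa>'" "\<nu> \<preceq> \<kappa>'" using boundary_filterD(5)[OF w] y by blast
  then obtain \<kappa> where k: "\<kappa> \<in> MCE \<Lambda> \<mu> \<nu>" "\<kappa> \<preceq> \<kappa>'" using MCE_initial by metis
  then have ky: "\<kappa> \<in> y" using boundary_filterD(4)[OF w k'(1)] by blast
  obtain \<alpha> \<beta> where ab: "composable \<mu> \<alpha>" "\<kappa> = \<mu> \<cdot> \<alpha>" "composable \<nu> \<beta>" "\<kappa> = \<nu> \<cdot> \<beta>"
    using k(1) by (auto simp: MCE_iff initial_def)
  have "(\<alpha>, \<beta>) \<in> mce_pairs \<mu> \<nu>"
    using ab k(1) by (simp add: mce_pairs_def)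
  moreover have "\<alpha> \<in> shift \<mu> y" "\<beta> \<in> shift \<nu> y" using ab ky by (auto simp: shift_def)
  moreover have "shift \<alpha> (shift \<mu> y) = shift \<beta> (shift \<nu> y)" using ab shift_shift by metis
  moreover have "shift \<mu> y \<in> X" "shift \<nu> y \<in> X" using y X_shift by auto
  ultimately have "(shift \<mu> y, shift \<alpha> (shift \<mu> y)) \<in> shift_rel \<alpha>"
    "(shift \<alpha> (shift \<mu> y), shift \<nu> y) \<in> (shift_rel \<beta>)\<inverse>"
    by (auto simp: shift_rel_def)
  then have "p \<in> shift_rel (fst (\<alpha>, \<beta>)) O (shift_rel (snd (\<alpha>, \<beta>)))\<inverse>" using y(4) by auto
  then show "p \<in> (\<Union>p\<in>mce_pairs \<mu> \<nu>. shift_rel (fst p) O (shift_rel (snd p))\<inverse>)"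
    using \<open>(\<alpha>, \<beta>) \<in> mce_pairs \<mu> \<nu>\<close> by blast
next
  fix p assume "p \<in> (\<Union>p\<in>mce_pairs \<mu> \<nu>. shift_rel (fst p) O (shift_rel (snd p))\<inverse>)"
  then obtain \<alpha> \<beta> a b where ab: "(\<alpha>, \<beta>) \<in> mce_pairs \<mu> \<nu>" "p = (a, b)" "a \<in> X" "\<alpha> \<in> a" "b \<in> X" "\<beta> \<in> b"
    "shift \<alpha> a = shift \<beta> b"
    by (auto simp: shift_rel_def)
  have c: "composable \<mu> \<alpha>" "composable \<nu> \<beta>" "\<mu> \<cdot> \<alpha> = \<nu> \<cdot> \<beta>"
    using ab(1) by (auto simp: mce_pairs_def)
  have fa': "boundary_filter (src \<Lambda> \<mu>) a" "boundary_filter (src \<Lambda> \<nu>) b"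
    using mem_filter_rng(2)[OF ab(3,4)] mem_filter_rng(2)[OF ab(5,6)] c by (auto simp: composable_def)
  define y where "y = prepend \<mu> a"
  define z where "z = prepend \<nu> b"
  have y: "y \<in> X" "\<mu> \<in> y" "shift \<mu> y = a"
    using X_prepend[OF ab(3) m fa'(1)] mem_prepend[OF m fa'(1)] shift_prepend[OF m fa'(1)] by (auto simp: y_def)
  have z: "z \<in> X" "\<nu> \<in> z" "shift \<nu> z = b"
    using X_prepend[OF ab(5) n fa'(2)] mem_prepend[OF n fa'(2)] shift_prepend[OF n fa'(2)] by (auto simp: z_def)
  have "\<mu> \<cdot> \<alpha> \<in> y" "\<nu> \<cdot> \<beta> \<in> z"
    using ab y z by (auto simp: shift_def)
  moreover have "shift (\<mu> \<cdot> \<alpha>) y = shift (\<nu> \<cdot> \<beta>) z"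
    using shift_shift[OF c(1), of y] shift_shift[OF c(2), of z] y z ab(7) by simp
  \<comment> \<open>Both filters contain the path
    \<open>\<mu> \<cdot> \<alpha> = \<nu> \<cdot> \<beta>\<close> and agree after its
    removal.\<close>
  ultimately have "y = z"
    using filter_eq_prepend[OF y(1)] filter_eq_prepend[OF z(1)] c(3) by metis
  then have "(a, y) \<in> (shift_rel \<mu>)\<inverse>" "(y, b) \<in> shift_rel \<nu>"
    using y z by (auto simp: shift_rel_def)
  then show "p \<in> (shift_rel \<mu>)\<inverse> O shift_rel \<nu>" using ab(2) by blast
qed

text \<open>The first tails of all pairs have the same degree, and a filter contains at most one
  path of each degree.\<close>

lemma pair_rel_disjoint:
  assumes p: "p \<in> mce_pairs \<mu> \<nu>" and q: "q \<in> mce_pairs \<mu> \<nu>" and "p \<noteq> q"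
  shows "(shift_rel (fst p) O (shift_rel (snd p))\<inverse>) \<inter> (shift_rel (fst q) O (shift_rel (snd q))\<inverse>) = {}"
proof (rule equals0I)
  fix r assume "r \<in> (shift_rel (fst p) O (shift_rel (snd p))\<inverse>) \<inter> (shift_rel (fst q) O (shift_rel (snd q))\<inverse>)"
  then obtain a where a: "a \<in> X" "fst p \<in> a" "fst q \<in> a" by (auto simp: shift_rel_def)
  have "d (\<mu> \<cdot> fst p) = d (\<mu> \<cdot> fst q)"
    using mce_pairsD(4)[OF p] mce_pairsD(4)[OF q] by (simp add: MCE_iff)
  then have "d (fst p) = d (fst q)"
    using deg_comp[OF mce_pairsD(1)[OF p]] deg_comp[OF mce_pairsD(1)[OF q]] by simp
  then have "fst p = fst q" using boundary_filter_unique a X_filter by blast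
  then show False using mce_pairs_eqI[OF p q] \<open>p \<noteq> q\<close> by simp
qed

lemma rep_simps:
  "rep \<mu> \<otimes>\<^bsub>matrix_algebra\<^esub> rep \<nu> = matrix_of (rel_op X (shift_rel \<mu> O shift_rel \<nu>))"
  "star matrix_algebra (rep \<mu>) = matrix_of (rel_op X ((shift_rel \<mu>)\<inverse>))"
  "rep \<mu> \<otimes>\<^bsub>matrix_algebra\<^esub> star matrix_algebra (rep \<nu>) = matrix_of (rel_op X (shift_rel \<mu> O (shift_rel \<nu>)\<inverse>))"
  "star matrix_algebra (rep \<mu>) \<otimes>\<^bsub>matrix_algebra\<^esub> rep \<nu> = matrix_of (rel_op X ((shift_rel \<mu>)\<inverse> O shift_rel \<nu>))"
  using shift_rel_partial_bij
  by (simp_all add: rep_def matrix_algebra_simps rel_op_in_operators adjoint_rel_op rel_op_compose partial_bij_on_ops)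

theorem CK_family_rep: "CK_family \<Lambda> matrix_algebra rep"
proof
  show "rep \<rho> \<in> carrier matrix_algebra" for \<rho>
    using rel_op_in_operators[OF shift_rel_partial_bij] by (simp add: rep_def matrix_algebra_simps)
  show "rep \<rho> \<otimes>\<^bsub>matrix_algebra\<^esub> star matrix_algebra (rep \<rho>) \<otimes>\<^bsub>matrix_algebra\<^esub> rep \<rho> = rep \<rho>" for \<rho>
  proof -
    have "(shift_rel \<rho> O (shift_rel \<rho>)\<inverse>) O shift_rel \<rho> = shift_rel \<rho>"
      by (rule partial_bij_on_triple[OF shift_rel_partial_bij])
    then show ?thesis
      using shift_rel_partial_bij[of \<rho>] unfolding rep_simps(3) unfolding rep_def
      by (subst matrix_algebra_simps) (simp_all add: rel_op_in_operators rel_op_compose partial_bij_on_ops)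
  qed
  show "rep v \<otimes>\<^bsub>matrix_algebra\<^esub> rep v = rep v \<and> star matrix_algebra (rep v) = rep v" if "v \<in> vertices \<Lambda>" for v
  proof -
    have "Id_on V O Id_on V = Id_on V" "(Id_on V)\<inverse> = Id_on V" for V :: "'l set set" by auto
    then show ?thesis unfolding rep_simps unfolding rep_def shift_rel_vertex[OF that] by simp
  qed
  show "rep v \<otimes>\<^bsub>matrix_algebra\<^esub> rep w = \<zero>\<^bsub>matrix_algebra\<^esub>"
    if v: "v \<in> vertices \<Lambda>" and w: "w \<in> vertices \<Lambda>" and "v \<noteq> w" for v w
  proof -
    have "False" if y: "y \<in> X" "v \<in> y" "w \<in> y" for y
      using X_filter[OF y(1)] boundary_filterD(3) y vertexD(2)[OF v] vertexD(2)[OF w] \<open>v \<noteq> w\<close> by metis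
    then have "shift_rel v O shift_rel w = {}"
      unfolding shift_rel_vertex[OF v] shift_rel_vertex[OF w] by auto
    then show ?thesis by (simp add: rep_simps rel_op_empty matrix_algebra_simps)
  qed
  show "rep \<mu> \<otimes>\<^bsub>matrix_algebra\<^esub> rep \<nu> = rep (\<mu> \<cdot> \<nu>)"
    if "\<mu> \<in> paths \<Lambda>" "\<nu> \<in> paths \<Lambda>" "src \<Lambda> \<mu> = rng \<Lambda> \<nu>" for \<mu> \<nu>
    using shift_rel_comp that unfolding rep_simps by (simp add: rep_def composable_def)
  show "star matrix_algebra (rep \<mu>) \<otimes>\<^bsub>matrix_algebra\<^esub> rep \<nu> =
      (\<Oplus>\<^bsub>matrix_algebra\<^esub>p\<in>{(\<alpha>, \<beta>). \<alpha> \<in> paths \<Lambda> \<and> \<beta> \<in> paths \<Lambda> \<and> src \<Lambda> \<mu> = rng \<Lambda> \<alpha> \<and> src \<Lambda> \<nu> = rng \<Lambda> \<beta> \<and>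
        \<mu> \<cdot> \<alpha> = \<nu> \<cdot> \<beta> \<and> \<mu> \<cdot> \<alpha> \<in> MCE \<Lambda> \<mu> \<nu>}. rep (fst p) \<otimes>\<^bsub>matrix_algebra\<^esub> star matrix_algebra (rep (snd p)))"
    if m: "\<mu> \<in> paths \<Lambda>" and n: "\<nu> \<in> paths \<Lambda>" for \<mu> \<nu>
  proof -
    have pb: "partial_bij_on X ((shift_rel \<mu>)\<inverse> O shift_rel \<nu>)"
      by (intro partial_bij_on_ops shift_rel_partial_bij)
    show ?thesis
      unfolding mce_pairs_eq[OF m n, symmetric] rep_simps(3,4) shift_rel_converse_comp[OF m n]
      by (rule finsum_rel_op[OF finite_mce_pairs[OF fa m n] pb[unfolded shift_rel_converse_comp[OF m n]]
            pair_rel_disjoint, symmetric])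
  qed
  show "list_mult matrix_algebra (map (\<lambda>\<rho>. rep v \<ominus>\<^bsub>matrix_algebra\<^esub>
      rep \<rho> \<otimes>\<^bsub>matrix_algebra\<^esub> star matrix_algebra (rep \<rho>)) ls) = \<zero>\<^bsub>matrix_algebra\<^esub>"
    if v: "v \<in> vertices \<Lambda>" and E: "E \<in> FE \<Lambda> v" and ls: "set ls = E" for v E ls
  proof -
    let ?V = "{y \<in> X. v \<in> y}"
    define W where "W \<rho> = {y \<in> X. \<rho> \<in> y}" for \<rho>
    have V: "?V \<subseteq> X" by blast
    have W: "W \<rho> \<subseteq> ?V" if "\<rho> \<in> E" for \<rho>
    proof
      fix y assume "y \<in> W \<rho>"
      then have y: "y \<in> X" "\<rho> \<in> y" by (auto simp: W_def)
      have "boundary_filter v y" using mem_filter_rng(2)[OF y] FE_D(2)[OF E that] by simp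
      then show "y \<in> ?V" using y boundary_filterD(1) by blast
    qed
    have factor: "rep v \<ominus>\<^bsub>matrix_algebra\<^esub> rep \<rho> \<otimes>\<^bsub>matrix_algebra\<^esub> star matrix_algebra (rep \<rho>) =
        matrix_of (rel_op X (Id_on (?V - W \<rho>)))" if r: "\<rho> \<in> E" for \<rho>
    proof -
      have "shift_rel \<rho> O (shift_rel \<rho>)\<inverse> = Id_on (W \<rho>)"
        using shift_rel_partial_bij[of \<rho>] unfolding partial_bij_on_def partial_bij_def
        by (auto simp: shift_rel_def W_def single_valued_def)
      moreover have "rel_op X (Id_on ?V) \<in> operators" "rel_op X (Id_on (W \<rho>)) \<in> operators"
        using W[OF r] by (auto intro!: rel_op_in_operators partial_bij_on_ops)
      ultimately show ?thesis
        unfolding rep_simps(3) unfolding rep_def shift_rel_vertex[OF v]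
        using matrix_algebra_minus rel_op_Id_on_diff[OF W[OF r] V] by simp
    qed
    have "ls \<noteq> []" using FE_nonempty[OF E v] ls by auto
    then have eq: "list_mult matrix_algebra (map (\<lambda>\<rho>. rep v \<ominus>\<^bsub>matrix_algebra\<^esub>
        rep \<rho> \<otimes>\<^bsub>matrix_algebra\<^esub> star matrix_algebra (rep \<rho>)) ls) =
        matrix_of (rel_op X (Id_on (?V - \<Union>(set (map W ls)))))"
      by (intro list_mult_Id_on) (use V W ls factor in auto)
    \<comment> \<open>Here the boundary condition enters: every filter at \<open>v\<close> contains
      a member of \<open>E\<close>, so the sets \<open>W \<rho>\<close> cover.\<close>
    have empty: "?V - \<Union>(set (map W ls)) = {}"
    proof -
      have "\<exists>\<rho>\<in>E. \<rho> \<in> y" if y: "y \<in> X" "v \<in> y" for y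
      proof -
        have f: "boundary_filter v y" using mem_filter_rng(2)[OF y] vertexD(2)[OF v] by simp
        obtain \<alpha> where "\<alpha> \<in> E" "v \<cdot> \<alpha> \<in> y"
          using boundary_filterD(6)[OF f y(2), of E] E vertexD(3)[OF v] by auto
        then show ?thesis using FE_D[OF E] cmp_rng by metis
      qed
      then show ?thesis by (auto simp: W_def ls)
    qed
    show ?thesis unfolding eq empty by (simp add: rel_op_empty matrix_algebra_simps)
  qed
qed

lemma rep_vertex_eq_zero_iff:
  assumes v: "v \<in> vertices \<Lambda>" shows "rep v = \<zero>\<^bsub>matrix_algebra\<^esub> \<longleftrightarrow> (\<forall>y\<in>X. v \<notin> y)"
proof -
  have "rep v = \<zero>\<^bsub>matrix_algebra\<^esub> \<longleftrightarrow> rel_op X (shift_rel v) = 0"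
    using matrix_of_eq_iff[OF rel_op_in_operators[OF shift_rel_partial_bij] operators_zero]
    by (simp add: rep_def matrix_algebra_simps)
  also have "\<dots> \<longleftrightarrow> shift_rel v = {}" by (rule rel_op_eq_0_iff[OF shift_rel_partial_bij])
  finally show ?thesis by (auto simp: shift_rel_def)
qed

end

section \<open>The orbit of a boundary filter\<close>

context kgraph
begin

text \<open>The tail-equivalence class of \<open>Y\<close>: the boundary filters that agree with
  \<open>Y\<close> once an initial path has been removed from each.\<close>

definition filter_orbit :: "'l set \<Rightarrow> 'l set set" where
  "filter_orbit Y = {prepend \<sigma> (shift \<mu> Y) |\<sigma> \<mu>. \<sigma> \<in> paths \<Lambda> \<and> \<mu> \<in> Y \<and> src \<Lambda> \<sigma> = src \<Lambda> \<mu>}"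

lemma filter_system_orbit:
  assumes fa: "finitely_aligned \<Lambda>" and Y: "boundary_filter w Y"
  shows "filter_system \<Lambda> (filter_orbit Y)"
proof
  note D = boundary_filterD[OF Y]
  have sf: "boundary_filter (src \<Lambda> \<sigma>) (shift \<mu> Y)" if "\<mu> \<in> Y" "src \<Lambda> \<sigma> = src \<Lambda> \<mu>" for \<sigma> \<mu>
    using boundary_filter_shift[OF Y that(1)] that(2) by simp
  show "countable (filter_orbit Y)"
  proof (rule countable_subset)
    show "filter_orbit Y \<subseteq> (\<lambda>(\<sigma>, \<mu>). prepend \<sigma> (shift \<mu> Y)) ` (paths \<Lambda> \<times> paths \<Lambda>)"
      using D(2) by (auto simp: filter_orbit_def)
    show "countable ((\<lambda>(\<sigma>, \<mu>). prepend \<sigma> (shift \<mu> Y)) ` (paths \<Lambda> \<times> paths \<Lambda>))"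
      using countable_paths by (intro countable_image countable_SIGMA)
  qed
  show "finitely_aligned \<Lambda>" by fact
  fix y \<nu> assume "y \<in> filter_orbit Y"
  then obtain \<sigma> \<mu> where y: "y = prepend \<sigma> (shift \<mu> Y)" and s: "\<sigma> \<in> paths \<Lambda>" "\<mu> \<in> Y" "src \<Lambda> \<sigma> = src \<Lambda> \<mu>"
    by (auto simp: filter_orbit_def)
  have yf: "boundary_filter (rng \<Lambda> \<sigma>) y"
    using boundary_filter_prepend[OF fa s(1) sf[OF s(2,3)]] y by simp
  have sy: "\<sigma> \<in> y" "shift \<sigma> y = shift \<mu> Y"
    using mem_prepend[OF s(1) sf[OF s(2,3)]] shift_prepend[OF s(1) sf[OF s(2,3)]] y by auto
  show "\<exists>v. boundary_filter v y" using yf by blast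
  show "shift \<nu> y \<in> filter_orbit Y" if n: "\<nu> \<in> y"
  proof -
    \<comment> \<open>The path \<open>\<nu>\<close> need not be comparable with
      \<open>\<sigma>\<close>. A common extension \<open>\<kappa>\<close> inside \<open>y\<close>
      replaces \<open>\<mu>\<close> by a longer path \<open>\<mu> \<cdot> \<alpha>\<close> of
      \<open>Y\<close> and exhibits \<open>shift \<nu> y\<close> in the required form.\<close>
    obtain \<kappa> where k: "\<kappa> \<in> y" "\<sigma> \<preceq> \<kappa>" "\<nu> \<preceq> \<kappa>" using boundary_filterD(5)[OF yf sy(1) n] by blast
    then obtain \<alpha> \<beta> where ab: "composable \<sigma> \<alpha>" "\<kappa> = \<sigma> \<cdot> \<alpha>" "composable \<nu> \<beta>" "\<kappa> = \<nu> \<cdot> \<beta>"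
      by (auto simp: initial_def)
    have "\<alpha> \<in> shift \<sigma> y" "\<beta> \<in> shift \<nu> y" using ab k(1) by (auto simp: shift_def)
    then have ma: "composable \<mu> \<alpha>" "\<mu> \<cdot> \<alpha> \<in> Y" using sy(2) by (auto simp: shift_def)
    have "shift \<beta> (shift \<nu> y) = shift (\<mu> \<cdot> \<alpha>) Y"
      using shift_shift[OF ab(3), of y] shift_shift[OF ab(1), of y] shift_shift[OF ma(1), of Y] ab sy(2) by simp
    then have "shift \<nu> y = prepend \<beta> (shift (\<mu> \<cdot> \<alpha>) Y)"
      using prepend_shift[OF boundary_filter_shift[OF yf n] \<open>\<beta> \<in> shift \<nu> y\<close>] by simp
    moreover have "src \<Lambda> \<beta> = src \<Lambda> (\<mu> \<cdot> \<alpha>)" using ab ma composableD(6) by metis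
    ultimately show ?thesis
      using ma(2) composableD(2)[OF ab(3)] unfolding filter_orbit_def by blast
  qed
  show "prepend \<nu> y \<in> filter_orbit Y" if n: "\<nu> \<in> paths \<Lambda>" "boundary_filter (src \<Lambda> \<nu>) y"
  proof -
    let ?z = "prepend \<nu> y"
    have c: "composable \<nu> \<sigma>"
      using n s(1) boundary_filterD(3)[OF n(2) sy(1)] by (simp add: composable_def)
    have zf: "boundary_filter (rng \<Lambda> \<nu>) ?z" by (rule boundary_filter_prepend[OF fa n])
    have sz: "shift \<nu> ?z = y" by (rule shift_prepend[OF n])
    have "\<nu> \<cdot> \<sigma> \<in> ?z" using sy(1) sz by (auto simp: shift_def)
    moreover have "shift (\<nu> \<cdot> \<sigma>) ?z = shift \<mu> Y" using shift_shift[OF c, of ?z] sz sy(2) by simp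
    ultimately have "?z = prepend (\<nu> \<cdot> \<sigma>) (shift \<mu> Y)" using prepend_shift[OF zf] by metis
    then show ?thesis
      unfolding filter_orbit_def
      using s composableD[OF c] by (intro CollectI exI[of _ "\<nu> \<cdot> \<sigma>"] exI[of _ \<mu>]) simp
  qed
qed

lemma mem_filter_orbit_self:
  assumes Y: "boundary_filter w Y" shows "Y \<in> filter_orbit Y"
  using prepend_shift[OF Y boundary_filterD(1)[OF Y]] boundary_filterD(1,2)[OF Y]
  unfolding filter_orbit_def by blast

text \<open>A filter of the orbit starts at the range of some \<open>\<sigma>\<close> that ends at
  the source of a path in \<open>Y\<close>. So vertices from which \<open>Y\<close> cannot be
  reached are represented by 0.\<close>

lemma filter_orbit_reaches:
  assumes Y: "boundary_filter w Y" and y: "y \<in> filter_orbit Y" and v: "v \<in> y" "v \<in> vertices \<Lambda>"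
  shows "\<exists>\<mu>\<in>Y. paths_between \<Lambda> v (src \<Lambda> \<mu>) \<noteq> {}"
proof -
  obtain \<sigma> \<mu> where s: "y = prepend \<sigma> (shift \<mu> Y)" "\<sigma> \<in> paths \<Lambda>" "\<mu> \<in> Y" "src \<Lambda> \<sigma> = src \<Lambda> \<mu>"
    using y by (auto simp: filter_orbit_def)
  obtain \<nu> where "composable \<sigma> \<nu>" "v \<preceq> \<sigma> \<cdot> \<nu>" using v(1) s(1) by (auto simp: prepend_def)
  then have "rng \<Lambda> \<sigma> = v" using initialD(3) composableD(5) vertexD(2)[OF v(2)] by metis
  then show ?thesis using s by (auto simp: paths_between_def)
qed

end

context graph_algebra
begin

section \<open>Consequences of the universal property\<close>

text \<open>\<open>K\<close> is the kernel of the representation on the orbit of \<open>Y\<close>;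
  the choice of \<open>Y\<close> decides which vertex projections it contains.\<close>

lemma boundary_representation:
  assumes univ: "is_graph_cstar_algebra \<Lambda> A s" and Y: "boundary_filter w Y"
  obtains K where "algebra_ideal K"
    "\<And>v. v \<in> vertices \<Lambda> \<Longrightarrow> s v \<in> K \<longleftrightarrow> (\<forall>y\<in>filter_orbit Y. v \<notin> y)"
proof -
  interpret R: filter_system \<Lambda> "filter_orbit Y" by (rule filter_system_orbit[OF fa Y])
  obtain \<pi> where \<pi>: "\<pi> \<in> cstar_hom A matrix_algebra" "\<And>\<rho>. \<rho> \<in> paths \<Lambda> \<Longrightarrow> \<pi> (s \<rho>) = R.rep \<rho>"
    using univ cstar_algebra_matrix_algebra R.CK_family_rep unfolding is_graph_cstar_algebra_def by blast
  show ?thesis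
  proof (rule that)
    show "algebra_ideal {a \<in> carrier A. \<pi> a = \<zero>\<^bsub>matrix_algebra\<^esub>}"
      by (rule algebra_ideal_kernel[OF cstar_algebra_axioms cstar_algebra_matrix_algebra \<pi>(1)])
    show "s v \<in> {a \<in> carrier A. \<pi> a = \<zero>\<^bsub>matrix_algebra\<^esub>} \<longleftrightarrow> (\<forall>y\<in>filter_orbit Y. v \<notin> y)"
      if "v \<in> vertices \<Lambda>" for v
      using R.rep_vertex_eq_zero_iff[OF that] \<pi>(2) vertexD(1)[OF that] by simp
  qed
qed

text \<open>The representation on the orbit of a boundary filter at \<open>v\<close> does not
  annihilate \<open>s v\<close>.\<close>

lemma s_vertex_nonzero:
  assumes univ: "is_graph_cstar_algebra \<Lambda> A s" and v: "v \<in> vertices \<Lambda>" shows "s v \<noteq> \<zero>"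
proof -
  obtain Y where Y: "boundary_filter v Y" using boundary_filter_at_vertex[OF fa v] by blast
  obtain K where K: "algebra_ideal K" "s v \<in> K \<longleftrightarrow> (\<forall>y\<in>filter_orbit Y. v \<notin> y)"
    using boundary_representation[OF univ Y] v by metis
  have "s v \<notin> K" using K(2) mem_filter_orbit_self[OF Y] boundary_filterD(1)[OF Y] by blast
  then show ?thesis using linear_subspaceD(2)[OF algebra_idealD(1)[OF K(1)]] by metis
qed

text \<open>
  The closure of the kernel is used because the representation is not known to be continuous;
  a projection in the closure of an ideal already lies in the ideal.
\<close>

lemma proper_ideal_of_not_cofinal:
  assumes univ: "is_graph_cstar_algebra \<Lambda> A s" and nc: "\<not> cofinal_kgraph \<Lambda>"
  obtains I v where "cstar_ideal I A" "v \<in> vertices \<Lambda>" "s v \<in> I" "I \<noteq> carrier A"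
proof -
  obtain v w Y where v: "v \<in> vertices \<Lambda>" and Y: "boundary_filter w Y"
    "\<And>\<mu>. \<mu> \<in> Y \<Longrightarrow> paths_between \<Lambda> v (src \<Lambda> \<mu>) = {}"
    using not_cofinal_boundary_filter[OF fa nc] by metis
  have w: "w \<in> vertices \<Lambda>" by (rule boundary_filter_vertex[OF Y(1)])
  obtain K where K: "algebra_ideal K"
    "\<And>v. v \<in> vertices \<Lambda> \<Longrightarrow> s v \<in> K \<longleftrightarrow> (\<forall>y\<in>filter_orbit Y. v \<notin> y)"
    using boundary_representation[OF univ Y(1)] by metis
  have sub: "K \<subseteq> carrier A" using linear_subspaceD(1)[OF algebra_idealD(1)[OF K(1)]] by blast
  have "s v \<in> K" using K(2)[OF v] filter_orbit_reaches[OF Y(1) _ _ v] Y(2) by blast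
  then have "s v \<in> norm_closure K" using norm_closure_subset[OF sub] by blast
  moreover have "s w \<notin> norm_closure K"
  proof
    assume "s w \<in> norm_closure K"
    then obtain i where "i \<in> K" "cnorm A (s w \<ominus> i) < 1" using norm_closureD(2)[of _ K 1] by auto
    then have "s w \<in> K" using projection_mem_ideal[OF K(1) s_vertex[OF w]] by blast
    then show False using K(2)[OF w] mem_filter_orbit_self[OF Y(1)] boundary_filterD(1)[OF Y(1)] by blast
  qed
  then have "norm_closure K \<noteq> carrier A" using s_vertex(1)[OF w] by blast
  ultimately show ?thesis using that cstar_ideal_norm_closure[OF K(1)] v by blast
qed

lemma zero_mem_ideal_fixed_points:
  assumes "is_gauge_action \<Lambda> A s \<gamma>" "cstar_ideal I A" shows "\<zero> \<in> I \<inter> fixed_point_algebra A \<gamma>"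
proof -
  have "\<gamma> z \<zero> = \<zero>" if "z \<in> torus" for z
  proof -
    have "\<gamma> z \<in> cstar_hom A A" using assms(1) that by (auto simp: is_gauge_action_def cstar_auto_def)
    from cstar_homD(1,5)[OF this, of "\<zero>"] show ?thesis by (metis M.zero_closed smult_0)
  qed
  then show ?thesis
    using assms(2) linear_subspaceD(2) algebra_idealD(1) by (auto simp: fixed_point_algebra_def cstar_ideal_iff)
qed

lemma s_vertex_fixed:
  assumes "is_gauge_action \<Lambda> A s \<gamma>" "v \<in> vertices \<Lambda>" shows "s v \<in> fixed_point_algebra A \<gamma>"
proof -
  have "multi_power z (d v) = 1" for z using vertexD(4)[OF assms(2)] by (simp add: multi_power_def)
  then show ?thesis
    using assms vertexD(1)[OF assms(2)] by (auto simp: is_gauge_action_def fixed_point_algebra_def)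
qed

end

section \<open>The equivalence of the four conditions\<close>

theorem theorem5p1:
  fixes \<Lambda> :: "('l, 'k::finite) kgraph"
    and A :: "'a cstar_struct"
    and s :: "'l \<Rightarrow> 'a"
    and \<gamma> :: "complex ^ 'k \<Rightarrow> 'a \<Rightarrow> 'a"
  assumes "kgraph \<Lambda>"
    and "finitely_aligned \<Lambda>"
    and "is_graph_cstar_algebra \<Lambda> A s"
    and "is_gauge_action \<Lambda> A s \<gamma>"
  shows "(cofinal_kgraph \<Lambda> \<longleftrightarrow>
            (\<forall>v\<in>vertices \<Lambda>. \<forall>(m, x)\<in>boundary_paths \<Lambda>.
               \<exists>n. emb n \<le> m \<and> paths_between \<Lambda> v (x (n, n)) \<noteq> {}))
       \<and> (cofinal_kgraph \<Lambda> \<longleftrightarrow>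
            (\<forall>I. cstar_ideal I A \<and> (\<exists>v\<in>vertices \<Lambda>. s v \<in> I) \<longrightarrow> I = carrier A))
       \<and> (cofinal_kgraph \<Lambda> \<longleftrightarrow>
            (\<forall>I. cstar_ideal I A \<and> I \<inter> fixed_point_algebra A \<gamma> \<noteq> {\<zero>\<^bsub>A\<^esub>} \<longrightarrow> I = carrier A))"
proof -
  have alg: "cstar_algebra A" "CK_family \<Lambda> A s" and gen: "generates (s ` paths \<Lambda>) A"
    using assms(3) by (auto simp: is_graph_cstar_algebra_def)
  interpret graph_algebra \<Lambda> A s
    by (intro graph_algebra.intro graph_algebra_axioms.intro assms(1,2) alg)
  have 2: "I = carrier A" if "cofinal_kgraph \<Lambda>" "cstar_ideal I A" "v \<in> vertices \<Lambda>" "s v \<in> I" for I v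
    using ideal_eq_carrier_of_cofinal[OF gen] that by blast
  have 3: "I = carrier A"
    if cof: "cofinal_kgraph \<Lambda>" and I: "cstar_ideal I A" and ne: "I \<inter> fixed_point_algebra A \<gamma> \<noteq> {\<zero>\<^bsub>A\<^esub>}" for I
  proof -
    obtain a where "a \<in> I" "a \<in> fixed_point_algebra A \<gamma>" "a \<noteq> \<zero>\<^bsub>A\<^esub>"
      using ne zero_mem_ideal_fixed_points[OF assms(4) I] by blast
    then obtain v where "v \<in> vertices \<Lambda>" "s v \<in> I"
      using vertex_mem_of_core_ideal[OF gen assms(4) I] by metis
    then show ?thesis using 2 cof I by blast
  qed
  \<comment> \<open>One ideal refutes (3) and (4) together: the vertex projection in it is fixed by
    the gauge action and nonzero.\<close>
  have 4: "\<exists>I v. cstar_ideal I A \<and> v \<in> vertices \<Lambda> \<and> s v \<in> I \<and> I \<noteq> carrier A \<and>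
      I \<inter> fixed_point_algebra A \<gamma> \<noteq> {\<zero>\<^bsub>A\<^esub>}" if nc: "\<not> cofinal_kgraph \<Lambda>"
  proof -
    obtain I v where I: "cstar_ideal I A" "v \<in> vertices \<Lambda>" "s v \<in> I" "I \<noteq> carrier A"
      using proper_ideal_of_not_cofinal[OF assms(3) nc] by metis
    then show ?thesis
      using s_vertex_nonzero[OF assms(3) I(2)] s_vertex_fixed[OF assms(4) I(2)] by blast
  qed
  show ?thesis
    using cofinal_iff_boundary_paths[OF assms(2)] 2 3 4 by meson
qed

end
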